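(* Let $\psi:[0,1]\to[0,\infty)$ be a non-negative, measurable function and let $\omega_1$ and $\omega_2$ be positive, continuous functions on $\mathbb{R}^+=[0,\infty)$. Assume that there exists a constant $C$ such that $$\int_0^1\omega_2(s/t)\,\frac{\psi(t)}{t}\,dt\le C\,\omega_1(s)\qquad\text{for every } s\in\mathbb{R}^+,$$ so that $U_\psi:L^1(\omega_1)\to L^1(\omega_2)$ is a bounded operator. Let $V_\psi:C_0(1/\omega_2)\to C_0(1/\omega_1)$ be the restriction of the adjoint $U_\psi^*$ to $C_0(1/\omega_2)$. Then the bounded operator $\overline{U}_\psi=V_\psi^*$ from $M(\omega_1)$ to $M(\omega_2)$ is an extension of $U_\psi$.
   Context: $\mathbb{R}^+=[0,\infty)$ with Lebesgue measure. For a positive, continuous function $\omega$ on $\mathbb{R}^+$: - $L^1(\omega)$ is the Banach space of (classes of) complex-valued measurable functions $f$ on $\mathbb{R}^+$ with $\|f\|_{L^1(\omega)}=\int_0^\infty|f(t)|\omega(t)\,dt<\infty$. - $L^\infty(1/\omega)$ is the space of (classes of) measurable functions $h$ on $\mathbb{R}^+$ with $\|h\|_{L^\infty(1/\omega)}=\operatorname{ess\,sup}_{t\in\mathbb{R}^+}|h(t)|/\omega(t)<\infty$; it is identified with the dual of $L^1(\omega)$ via $\langle f,h\rangle=\int_0^\infty f(t)h(t)\,dt$. - $C_0(1/\omega)$ is the closed subspace of $L^\infty(1/\omega)$ of continuous functions $g$ on $\mathbb{R}^+$ such that $g/\omega$ vanishes at infinity. - $M(\omega)$ is the space of locally finite complex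 Borel measures $\mu$ on $\mathbb{R}^+$ with $\|\mu\|_{M(\omega)}=\int_{\mathbb{R}^+}\omega(t)\,d|\mu|(t)<\infty$; it is identified with the dual of $C_0(1/\omega)$ via $\langle g,\mu\rangle=\int_{\mathbb{R}^+}g\,d\mu$. (Locally finite complex means complex-valued and countably additive on the Borel subsets of each compact subset of $\mathbb{R}^+$.) - $L^1(\omega)$ is regarded as a closed subspace of $M(\omega)$ by identifying $f$ with the measure $f(t)\,dt$. The generalized Hardy-Cesàro operator is $(U_\psi f)(x)=\int_0^1 f(tx)\psi(t)\,dt=\frac1x\int_0^x f(s)\psi(s/x)\,ds$. Under the displayed integral condition it is a bounded operator from $L^1(\omega_1)$ to $L^1(\omega_2)$, and its adjoint $U_\psi^*:L^\infty(1/\omega_2)\to L^\infty(1/\omega_1)$, given by $(U_\psi^*h)(x)=\int_0^1h(x/t)\frac{\psi(t)}{t}\,dt$ for almost all $x$, maps $C_0(1/\omega_2)$ into $C_0(1/\omega_1)$, so $V_\psi$ is well defined. *)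

theory Defs
  imports "HOL-Analysis.Analysis" "HOL-Probability.Essential_Supremum"
begin

text \<open>
  Functions on the half-line \<open>[0,\<infinity>)\<close> are represented by functions on \<^typ>\<open>real\<close> whose values at
  negative arguments are irrelevant. Elements of \<open>L\<^sup>1\<close> and \<open>L\<^sup>\<infinity>\<close> are represented by functions, not
  by classes, so the norms below are only seminorms; two representatives stand for the same element
  iff their difference has norm \<open>0\<close>.
\<close>

definition weight :: "(real \<Rightarrow> real) \<Rightarrow> bool" where
  "weight \<omega> \<longleftrightarrow> continuous_on {0..} \<omega> \<and> (\<forall>t\<ge>0. 0 < \<omega> t)"

text \<open>Linearity is required up to elements of norm \<open>0\<close>.\<close>

definition bounded_operator ::
  "('a \<Rightarrow> complex) set \<Rightarrow> (('a \<Rightarrow> complex) \<Rightarrow> real) \<Rightarrow>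
   ('b \<Rightarrow> complex) set \<Rightarrow> (('b \<Rightarrow> complex) \<Rightarrow> real) \<Rightarrow>
   (('a \<Rightarrow> complex) \<Rightarrow> ('b \<Rightarrow> complex)) \<Rightarrow> bool" where
  "bounded_operator X nX Y nY T \<longleftrightarrow>
     (\<forall>f\<in>X. T f \<in> Y) \<and>
     (\<forall>f\<in>X. \<forall>g\<in>X. nY (\<lambda>y. T (\<lambda>x. f x + g x) y - (T f y + T g y)) = 0) \<and>
     (\<forall>c. \<forall>f\<in>X. nY (\<lambda>y. T (\<lambda>x. c * f x) y - c * T f y) = 0) \<and>
     (\<exists>K. \<forall>f\<in>X. nY (T f) \<le> K * nX f)"


section \<open>Weighted function spaces\<close>

definition L1_space :: "(real \<Rightarrow> real) \<Rightarrow> (real \<Rightarrow> complex) set" where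
  "L1_space \<omega> = {f. f \<in> borel_measurable (lebesgue_on {0..}) \<and>
     integrable (lebesgue_on {0..}) (\<lambda>t. norm (f t) * \<omega> t)}"

definition L1_norm :: "(real \<Rightarrow> real) \<Rightarrow> (real \<Rightarrow> complex) \<Rightarrow> real" where
  "L1_norm \<omega> f = (LINT t|lebesgue_on {0..}. norm (f t) * \<omega> t)"

text \<open>The spaces \<open>L\<^sup>\<infinity>(1/\<omega>)\<close> and \<open>C\<^sub>0(1/\<omega>)\<close>; the argument is \<open>\<omega>\<close>, not \<open>1/\<omega>\<close>.\<close>

definition Linf_esssup :: "(real \<Rightarrow> real) \<Rightarrow> (real \<Rightarrow> complex) \<Rightarrow> ennreal" where
  "Linf_esssup \<omega> h = esssup (lebesgue_on {0..}) (\<lambda>t. ennreal (norm (h t) / \<omega> t))"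

definition Linf_space :: "(real \<Rightarrow> real) \<Rightarrow> (real \<Rightarrow> complex) set" where
  "Linf_space \<omega> = {h. h \<in> borel_measurable (lebesgue_on {0..}) \<and> Linf_esssup \<omega> h < \<infinity>}"

definition Linf_norm :: "(real \<Rightarrow> real) \<Rightarrow> (real \<Rightarrow> complex) \<Rightarrow> real" where
  "Linf_norm \<omega> h = enn2real (Linf_esssup \<omega> h)"

definition C0_space :: "(real \<Rightarrow> real) \<Rightarrow> (real \<Rightarrow> complex) set" where
  "C0_space \<omega> = {g. continuous_on {0..} g \<and> ((\<lambda>t. g t / of_real (\<omega> t)) \<longlongrightarrow> 0) at_top}"

definition L1_pairing :: "(real \<Rightarrow> complex) \<Rightarrow> (real \<Rightarrow> complex) \<Rightarrow> complex" where
  "L1_pairing f h = (LINT t|lebesgue_on {0..}. f t * h t)"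


section \<open>Locally finite complex Borel measures on the half-line\<close>

text \<open>The Borel subsets of compact subsets of \<open>[0,\<infinity>)\<close>\<close>

definition bdd_borel :: "real set set" where
  "bdd_borel = {A \<in> sets borel. A \<subseteq> {0..} \<and> bounded A}"

text \<open>
  A locally finite complex measure has no value on unbounded sets in general; the set function
  is normalised to \<open>0\<close> outside \<^const>\<open>bdd_borel\<close>, so that equality of measures is
  equality of set functions.
\<close>

definition locfin_measure :: "(real set \<Rightarrow> complex) \<Rightarrow> bool" where
  "locfin_measure \<mu> \<longleftrightarrow>
     (\<forall>K A. compact K \<and> K \<subseteq> {0..} \<and> (\<forall>n::nat. A n \<in> sets borel \<and> A n \<subseteq> K) \<and> disjoint_family A
        \<longrightarrow> (\<lambda>n. \<mu> (A n)) sums \<mu> (\<Union>n. A n)) \<and>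
     (\<forall>A. A \<notin> bdd_borel \<longrightarrow> \<mu> A = 0)"

text \<open>
  The total variation \<open>|\<mu>|\<close>. As \<open>\<mu>\<close> is only defined on bounded sets, the supremum is over finite
  disjoint families of bounded Borel subsets of \<open>A\<close> rather than over partitions of \<open>A\<close>.
\<close>

definition total_variation :: "(real set \<Rightarrow> complex) \<Rightarrow> real measure" where
  "total_variation \<mu> = measure_of UNIV (sets borel)
     (\<lambda>A. SUP P\<in>{P. finite P \<and> disjoint P \<and> P \<subseteq> bdd_borel \<and> \<Union>P \<subseteq> A}.
        \<Sum>B\<in>P. ennreal (norm (\<mu> B)))"

text \<open>
  The positive part of the Jordan decomposition of a real-valued locally finite measure \<open>\<nu>\<close>
  (\<^const>\<open>ennreal\<close> maps negative reals to \<open>0\<close>); the negative part is that of \<open>-\<nu>\<close>.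
\<close>

definition positive_variation :: "(real set \<Rightarrow> real) \<Rightarrow> real measure" where
  "positive_variation \<nu> = measure_of UNIV (sets borel)
     (\<lambda>A. SUP B\<in>{B \<in> bdd_borel. B \<subseteq> A}. ennreal (\<nu> B))"

text \<open>The integral of \<open>g\<close> with respect to \<open>\<mu>\<close>, by Jordan decomposition of \<open>Re \<mu>\<close> and \<open>Im \<mu>\<close>\<close>

definition cm_integral :: "(real set \<Rightarrow> complex) \<Rightarrow> (real \<Rightarrow> complex) \<Rightarrow> complex" where
  "cm_integral \<mu> g =
     (LINT x:{0..}|positive_variation (\<lambda>A. Re (\<mu> A)). g x)
     - (LINT x:{0..}|positive_variation (\<lambda>A. - Re (\<mu> A)). g x)
     + \<i> * ((LINT x:{0..}|positive_variation (\<lambda>A. Im (\<mu> A)). g x)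
          - (LINT x:{0..}|positive_variation (\<lambda>A. - Im (\<mu> A)). g x))"

definition M_space :: "(real \<Rightarrow> real) \<Rightarrow> (real set \<Rightarrow> complex) set" where
  "M_space \<omega> = {\<mu>. locfin_measure \<mu> \<and>
     (\<integral>\<^sup>+x\<in>{0..}. ennreal (\<omega> x) \<partial>total_variation \<mu>) < \<infinity>}"

definition M_norm :: "(real \<Rightarrow> real) \<Rightarrow> (real set \<Rightarrow> complex) \<Rightarrow> real" where
  "M_norm \<omega> \<mu> = enn2real (\<integral>\<^sup>+x\<in>{0..}. ennreal (\<omega> x) \<partial>total_variation \<mu>)"

text \<open>The measure \<open>f(t) dt\<close>\<close>

definition fun_measure :: "(real \<Rightarrow> complex) \<Rightarrow> real set \<Rightarrow> complex" where
  "fun_measure f A = (if A \<in> bdd_borel then LINT t|lebesgue_on A. f t else 0)"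


section \<open>The operators\<close>

definition U_op :: "(real \<Rightarrow> real) \<Rightarrow> (real \<Rightarrow> complex) \<Rightarrow> real \<Rightarrow> complex" where
  "U_op \<psi> f x = (LINT t|lebesgue_on {0..1}. f (t * x) * of_real (\<psi> t))"

text \<open>
  The adjoint \<open>L\<^sup>\<infinity>(1/\<omega>2) \<rightarrow> L\<^sup>\<infinity>(1/\<omega>1)\<close> of an operator \<open>T : L\<^sup>1(\<omega>1) \<rightarrow> L\<^sup>1(\<omega>2)\<close>. The function chosen is
  a representative of a class, hence unique only almost everywhere.
\<close>

definition L1_adjoint ::
  "(real \<Rightarrow> real) \<Rightarrow> ((real \<Rightarrow> complex) \<Rightarrow> (real \<Rightarrow> complex)) \<Rightarrow>
   (real \<Rightarrow> complex) \<Rightarrow> (real \<Rightarrow> complex)" where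
  "L1_adjoint \<omega>1 T h = (SOME k. k \<in> Linf_space \<omega>1 \<and>
     (\<forall>f\<in>L1_space \<omega>1. L1_pairing f k = L1_pairing (T f) h))"

text \<open>
  The restriction of the adjoint of \<^const>\<open>U_op\<close> to \<open>C\<^sub>0(1/\<omega>2)\<close>, the values being the continuous
  representatives (which are unique on \<open>[0,\<infinity>)\<close>).
\<close>

definition V_op ::
  "(real \<Rightarrow> real) \<Rightarrow> (real \<Rightarrow> real) \<Rightarrow> (real \<Rightarrow> complex) \<Rightarrow> (real \<Rightarrow> complex)" where
  "V_op \<psi> \<omega>1 g = (SOME k. k \<in> C0_space \<omega>1 \<and>
     (AE x in lebesgue_on {0..}. k x = L1_adjoint \<omega>1 (U_op \<psi>) g x))"

text \<open>
  The adjoint \<open>M(\<omega>1) \<rightarrow> M(\<omega>2)\<close> of an operator \<open>S : C\<^sub>0(1/\<omega>2) \<rightarrow> C\<^sub>0(1/\<omega>1)\<close>, under the identification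
  of \<open>M(\<omega>)\<close> with the dual of \<open>C\<^sub>0(1/\<omega>)\<close>
\<close>

definition C0_adjoint ::
  "(real \<Rightarrow> real) \<Rightarrow> ((real \<Rightarrow> complex) \<Rightarrow> (real \<Rightarrow> complex)) \<Rightarrow>
   (real set \<Rightarrow> complex) \<Rightarrow> (real set \<Rightarrow> complex)" where
  "C0_adjoint \<omega>2 S \<mu> = (THE \<nu>. \<nu> \<in> M_space \<omega>2 \<and>
     (\<forall>g\<in>C0_space \<omega>2. cm_integral \<nu> g = cm_integral \<mu> (S g)))"

definition U_bar ::
  "(real \<Rightarrow> real) \<Rightarrow> (real \<Rightarrow> real) \<Rightarrow> (real \<Rightarrow> real) \<Rightarrow>
   (real set \<Rightarrow> complex) \<Rightarrow> (real set \<Rightarrow> complex)" where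
  "U_bar \<psi> \<omega>1 \<omega>2 = C0_adjoint \<omega>2 (V_op \<psi> \<omega>1)"

end

theory Submission
  imports Defs
begin

text \<open>
  Put \<open>\<phi>(t) = \<psi>(t) / t\<close> on \<open>(0, 1]\<close>. The integral condition says that a unit mass at \<open>s\<close>, spread along
  \<open>t \<mapsto> s / t\<close> with density \<open>\<phi>\<close>, has \<open>\<omega>2\<close>-mass at most \<open>C \<omega>1(s)\<close>. All three operators are governed by this one
  kernel, and the theorem is Fubini's theorem for it, read in three ways.

  On functions \<open>g\<close> in \<open>C\<^sub>0(1/\<omega>2)\<close> the kernel acts by averaging, \<open>s \<mapsto> \<integral> g(s / t) \<phi>(t) dt\<close>. This average is
  again in \<open>C\<^sub>0(1/\<omega>1)\<close> (\<open>kernel_average_C0\<close>): the condition at \<open>s = 0\<close> makes \<open>\<phi>\<close> integrable, because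
  \<open>\<omega>2(0) > 0\<close>, so averages of bounded continuous functions are continuous by dominated convergence; averages
  of functions that vanish beyond \<open>N\<close> vanish beyond \<open>N\<close>, because \<open>s / t \<ge> s\<close>; and such functions are dense.
  On \<open>L\<^sup>1(\<omega>1)\<close>, the substitution \<open>s = t x\<close> turns \<open>\<integral> (U f) g\<close> into the integral of \<open>f\<close> against the average of
  \<open>g\<close> (\<open>dilation_average_pairing\<close>). Elements of \<open>L\<^sup>\<infinity>(1/\<omega>1)\<close> are determined by their pairings, so \<open>V g\<close> is the
  average of \<open>g\<close> at every point of the half-line (\<open>V_op\<close>).

  On measures the kernel acts by transport: each positive part \<open>m\<close> of the Jordan decomposition of \<open>\<mu>\<close> is
  replaced by the image of \<open>m \<otimes> \<phi>(t) dt\<close> under \<open>(s, t) \<mapsto> s / t\<close>. The resulting measure lies in \<open>M(\<omega>2)\<close>, and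
  its integrals against \<open>C\<^sub>0(1/\<omega>2)\<close> are those of \<open>\<mu>\<close> against averages (\<open>cm_integral_pushed_measure\<close>). An element of
  \<open>M(\<omega>2)\<close> is determined by these integrals (\<open>M_space_eqI\<close>), so the transported measure is \<open>V\<^sup>* \<mu>\<close>. Finally
  \<open>(U f)(t) dt\<close> has the integrals that characterise \<open>V\<^sup>*(f(t) dt)\<close>, by the pairing identity, and so equals it.

  The integral against a complex measure is defined through a particular decomposition into positive measures,
  which is not preserved by sums, scalar multiples or transport. The notion that makes these manipulations
  possible is a representation of \<open>\<mu>\<close> as a finite sum of terms \<open>h \<cdot> m\<close> with \<open>m\<close> positive: the integral can be
  computed from any representation (\<open>cm_integral_eq_pieces_integral\<close>).
\<close>

section \<open>Integration against finite combinations of positive measures\<close>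

text \<open>
  Values at negative arguments are irrelevant, so measurability is asked of the extension by \<open>0\<close>.
\<close>

definition dominated :: "(real \<Rightarrow> real) \<Rightarrow> (real \<Rightarrow> complex) \<Rightarrow> bool" where
  "dominated \<omega> g \<longleftrightarrow> (\<lambda>x. indicator {0..} x *\<^sub>R g x) \<in> borel_measurable borel \<and>
     (\<exists>K. \<forall>x\<ge>0. norm (g x) \<le> K * \<omega> x)"

text \<open>
  A list of pairs \<open>(h, m)\<close> stands for the complex measure \<open>\<Sum> h \<cdot> m\<close>. A list of unrelated positive measures is
  used because the four parts of a Jordan decomposition come in this form, and because adding
  complex measures then amounts to appending lists.
\<close>

definition pieces_integral ::
  "((real \<Rightarrow> complex) \<times> real measure) list \<Rightarrow> (real \<Rightarrow> complex) \<Rightarrow> complex" where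
  "pieces_integral ms g = (\<Sum>(h, m)\<leftarrow>ms. LINT x:{0..}|m. g x * h x)"

definition admissible :: "(real \<Rightarrow> real) \<Rightarrow> ((real \<Rightarrow> complex) \<times> real measure) list \<Rightarrow> bool" where
  "admissible \<omega> ms \<longleftrightarrow> (\<forall>(h, m)\<in>set ms. sets m = sets borel \<and> h \<in> borel_measurable borel \<and>
     (\<integral>\<^sup>+x\<in>{0..}. ennreal (\<omega> x * norm (h x)) \<partial>m) < \<infinity>)"

definition represents ::
  "(real \<Rightarrow> real) \<Rightarrow> ((real \<Rightarrow> complex) \<times> real measure) list \<Rightarrow> (real set \<Rightarrow> complex) \<Rightarrow> bool" where
  "represents \<omega> ms \<mu> \<longleftrightarrow> admissible \<omega> ms \<and>
     (\<forall>A. \<mu> A = (if A \<in> bdd_borel then pieces_integral ms (indicator A) else 0))"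

lemma pieces_integral_Nil [simp]: "pieces_integral [] g = 0"
  and pieces_integral_Cons [simp]:
    "pieces_integral ((h, m) # ms) g = (LINT x:{0..}|m. g x * h x) + pieces_integral ms g"
  and pieces_integral_append [simp]:
    "pieces_integral (ms @ ms') g = pieces_integral ms g + pieces_integral ms' g"
  by (simp_all add: pieces_integral_def)

lemma admissible_Nil [simp]: "admissible \<omega> []"
  and admissible_Cons: "admissible \<omega> ((h, m) # ms) \<longleftrightarrow> sets m = sets borel \<and> h \<in> borel_measurable borel \<and>
     (\<integral>\<^sup>+x\<in>{0..}. ennreal (\<omega> x * norm (h x)) \<partial>m) < \<infinity> \<and> admissible \<omega> ms"
  and admissible_append [simp]: "admissible \<omega> (ms @ ms') \<longleftrightarrow> admissible \<omega> ms \<and> admissible \<omega> ms'"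
  by (auto simp: admissible_def)

lemma weight_measurable:
  assumes "weight \<omega>" shows "(\<lambda>x. indicator {0..} x * \<omega> x) \<in> borel_measurable borel"
  using borel_measurable_continuous_on_indicator[of "{0..}" \<omega>] assms by (simp add: weight_def)

text \<open>
  A positive continuous weight is bounded below on compact sets. This is what makes measures with finite
  weighted mass finite on bounded sets.
\<close>

lemma dominated_indicator_bounded:
  assumes w: "weight \<omega>" and A: "A \<in> bdd_borel" shows "dominated \<omega> (indicator A)"
proof -
  obtain r where r: "A \<subseteq> {0..r}"
    using A unfolding bdd_borel_def bounded_iff by fastforce
  have "\<exists>c>0. \<forall>x\<in>{0..r}. c \<le> \<omega> x"
  proof (cases "r \<ge> 0")
    case True
    have "continuous_on {0..r} \<omega>" using w by (auto simp: weight_def intro: continuous_on_subset)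
    then obtain x0 where "x0 \<in> {0..r}" "\<forall>x\<in>{0..r}. \<omega> x0 \<le> \<omega> x"
      using continuous_attains_inf[of "{0..r}" \<omega>] True by auto
    then show ?thesis using w by (intro exI[of _ "\<omega> x0"]) (auto simp: weight_def)
  qed (auto intro: exI[of _ 1])
  then obtain c where c: "c > 0" "\<And>x. x \<in> {0..r} \<Longrightarrow> c \<le> \<omega> x" by blast
  have [measurable]: "A \<in> sets borel" using A by (simp add: bdd_borel_def)
  have "norm (indicator A x :: complex) \<le> (1 / c) * \<omega> x" if "x \<ge> 0" for x
    using c(1) c(2)[of x] r that w by (auto simp: indicator_def field_simps weight_def less_imp_le)
  then have "\<exists>K. \<forall>x\<ge>0. norm (indicator A x :: complex) \<le> K * \<omega> x" by blast
  then show ?thesis by (simp add: dominated_def)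
qed

lemma dominated_add: "dominated \<omega> f \<Longrightarrow> dominated \<omega> g \<Longrightarrow> dominated \<omega> (\<lambda>x. f x + g x)"
  unfolding dominated_def
proof (elim conjE exE, intro conjI)
  fix K L assume *: "\<forall>x\<ge>0. norm (f x) \<le> K * \<omega> x" "\<forall>x\<ge>0. norm (g x) \<le> L * \<omega> x"
  show "\<exists>K. \<forall>x\<ge>0. norm (f x + g x) \<le> K * \<omega> x"
  proof (intro exI[of _ "K + L"] allI impI)
    fix x :: real assume "x \<ge> 0" with * have "norm (f x) \<le> K * \<omega> x" "norm (g x) \<le> L * \<omega> x" by auto
    then show "norm (f x + g x) \<le> (K + L) * \<omega> x"
      using norm_triangle_ineq[of "f x" "g x"] by (simp add: distrib_right)
  qed
qed (simp add: scaleR_add_right)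

lemma dominated_cmult: "dominated \<omega> g \<Longrightarrow> dominated \<omega> (\<lambda>x. c * g x)"
  unfolding dominated_def
proof (elim conjE exE, intro conjI)
  assume m: "(\<lambda>x. indicator {0..} x *\<^sub>R g x) \<in> borel_measurable borel"
  show "(\<lambda>x. indicator {0..} x *\<^sub>R (c * g x)) \<in> borel_measurable borel"
    using borel_measurable_times[OF borel_measurable_const m, of c] by (simp add: mult.left_commute)
  fix K assume "\<forall>x\<ge>0. norm (g x) \<le> K * \<omega> x"
  then show "\<exists>K. \<forall>x\<ge>0. norm (c * g x) \<le> K * \<omega> x"
    by (intro exI[of _ "norm c * K"]) (auto simp: norm_mult mult.assoc intro: mult_left_mono)
qed

lemma dominated_sum:
  "weight \<omega> \<Longrightarrow> (\<And>i. i \<in> I \<Longrightarrow> dominated \<omega> (f i)) \<Longrightarrow> dominated \<omega> (\<lambda>x. \<Sum>i\<in>I. f i x)"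
proof (induction I rule: infinite_finite_induct)
  case (insert i I)
  then show ?case using dominated_add[of \<omega> "f i" "\<lambda>x. \<Sum>i\<in>I. f i x"] by auto
qed (auto simp: dominated_def intro!: exI[of _ 0])

lemma piece_integrable:
  assumes w: "weight \<omega>" and m: "sets m = sets borel" and h: "h \<in> borel_measurable borel"
    and fin: "(\<integral>\<^sup>+x\<in>{0..}. ennreal (\<omega> x * norm (h x)) \<partial>m) < \<infinity>" and g: "dominated \<omega> g"
  shows "set_integrable m {0..} (\<lambda>x. g x * h x)"
  unfolding set_integrable_def
proof (rule integrableI_bounded)
  note [measurable_cong] = m
  note [measurable] = h weight_measurable[OF w]
  have g'[measurable]: "(\<lambda>x. indicator {0..} x *\<^sub>R g x) \<in> borel_measurable borel"
    using g by (simp add: dominated_def)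
  obtain K where K: "\<And>x. x \<ge> 0 \<Longrightarrow> norm (g x) \<le> K * \<omega> x" using g by (auto simp: dominated_def)
  have "(\<lambda>x. (indicator {0..} x *\<^sub>R g x) * h x) \<in> borel_measurable m" by measurable
  then show "(\<lambda>x. indicator {0..} x *\<^sub>R (g x * h x)) \<in> borel_measurable m"
    by (simp add: scaleR_conv_of_real mult.assoc)
  have M: "(\<lambda>x. ennreal (\<omega> x * norm (h x)) * indicator {0..} x) \<in> borel_measurable m"
  proof -
    have "(\<lambda>x. ennreal ((indicator {0..} x * \<omega> x) * norm (h x))) \<in> borel_measurable m" by measurable
    also have "(\<lambda>x. ennreal ((indicator {0..} x * \<omega> x) * norm (h x))) =
        (\<lambda>x. ennreal (\<omega> x * norm (h x)) * indicator {0..} x)" by (auto simp: indicator_def)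
    finally show ?thesis .
  qed
  have "(\<integral>\<^sup>+ x. ennreal (norm (indicator {0..} x *\<^sub>R (g x * h x))) \<partial>m) \<le>
      (\<integral>\<^sup>+ x. ennreal \<bar>K\<bar> * (ennreal (\<omega> x * norm (h x)) * indicator {0..} x) \<partial>m)"
  proof (rule nn_integral_mono)
    fix x
    have "norm (g x) * norm (h x) \<le> \<bar>K\<bar> * (\<omega> x * norm (h x))" if "x \<ge> 0"
    proof -
      have "norm (g x) \<le> \<bar>K\<bar> * \<omega> x"
        using K[OF that] w that by (smt (verit) mult_right_mono weight_def)
      then have "norm (g x) * norm (h x) \<le> (\<bar>K\<bar> * \<omega> x) * norm (h x)" by (rule mult_right_mono) simp
      then show ?thesis by (simp add: mult.assoc)
    qed
    then show "ennreal (norm (indicator {0..} x *\<^sub>R (g x * h x))) \<le>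
        ennreal \<bar>K\<bar> * (ennreal (\<omega> x * norm (h x)) * indicator {0..} x)"
      by (auto simp: indicator_def norm_mult ennreal_mult'[symmetric] intro!: ennreal_leI)
  qed
  also have "\<dots> = ennreal \<bar>K\<bar> * (\<integral>\<^sup>+x\<in>{0..}. ennreal (\<omega> x * norm (h x)) \<partial>m)"
    using M by (rule nn_integral_cmult)
  also have "\<dots> < \<infinity>" using fin by (simp add: ennreal_mult_less_top)
  finally show "(\<integral>\<^sup>+ x. ennreal (norm (indicator {0..} x *\<^sub>R (g x * h x))) \<partial>m) < \<infinity>" .
qed

lemma pieces_integral_add:
  assumes "weight \<omega>" "admissible \<omega> ms" "dominated \<omega> f" "dominated \<omega> g"
  shows "pieces_integral ms (\<lambda>x. f x + g x) = pieces_integral ms f + pieces_integral ms g"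
  using assms(2)
proof (induction ms)
  case (Cons p ms)
  obtain h m where [simp]: "p = (h, m)" by (cases p)
  have "set_integrable m {0..} (\<lambda>x. f x * h x)" "set_integrable m {0..} (\<lambda>x. g x * h x)"
    using Cons.prems assms by (auto simp: admissible_Cons intro!: piece_integrable)
  then show ?case using Cons by (simp add: distrib_right admissible_Cons)
qed simp

lemma pieces_integral_cmult:
  "pieces_integral ms (\<lambda>x. c * g x) = c * pieces_integral ms g"
  by (induction ms) (auto simp: mult.assoc distrib_left)

lemma pieces_integral_sum:
  assumes "weight \<omega>" "admissible \<omega> ms"
  shows "(\<And>i. i \<in> I \<Longrightarrow> dominated \<omega> (f i)) \<Longrightarrow>
    pieces_integral ms (\<lambda>x. \<Sum>i\<in>I. f i x) = (\<Sum>i\<in>I. pieces_integral ms (f i))"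
proof (induction I rule: infinite_finite_induct)
  case (infinite I) then show ?case using pieces_integral_cmult[of ms 0] by simp
next
  case empty then show ?case using pieces_integral_cmult[of ms 0] by simp
next
  case (insert i I)
  have "dominated \<omega> (\<lambda>x. \<Sum>i\<in>I. f i x)" using insert.prems assms(1) by (intro dominated_sum) auto
  then show ?case using insert assms pieces_integral_add[of \<omega> ms "f i" "\<lambda>x. \<Sum>i\<in>I. f i x"] by auto
qed

lemma pieces_integral_cong:
  "(\<And>x. x \<ge> 0 \<Longrightarrow> f x = g x) \<Longrightarrow> pieces_integral ms f = pieces_integral ms g"
proof (induction ms)
  case (Cons p ms)
  have "set_lebesgue_integral m {0..} (\<lambda>x. f x * h x) = set_lebesgue_integral m {0..} (\<lambda>x. g x * h x)" for m h
    unfolding set_lebesgue_integral_def using Cons.prems by (intro Bochner_Integration.integral_cong) (auto simp: indicator_def)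
  then show ?case using Cons by (cases p) simp
qed simp

lemma pieces_integral_dominated_convergence:
  assumes w: "weight \<omega>" and ms: "admissible \<omega> ms"
    and G: "\<And>n. (\<lambda>x. indicator {0..} x *\<^sub>R G n x) \<in> borel_measurable borel"
    and bound: "\<And>n x. x \<ge> 0 \<Longrightarrow> norm (G n x) \<le> K * \<omega> x"
    and lim: "\<And>x. x \<ge> 0 \<Longrightarrow> (\<lambda>n. G n x) \<longlonglongrightarrow> G' x"
  shows "(\<lambda>n. pieces_integral ms (G n)) \<longlonglongrightarrow> pieces_integral ms G'"
  using ms
proof (induction ms)
  case (Cons p ms)
  obtain h m where p[simp]: "p = (h, m)" by (cases p)
  have m: "sets m = sets borel" and h: "h \<in> borel_measurable borel"
    and fin: "(\<integral>\<^sup>+x\<in>{0..}. ennreal (\<omega> x * norm (h x)) \<partial>m) < \<infinity>"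
    using Cons.prems by (auto simp: admissible_Cons)
  note [measurable_cong] = m
  note [measurable] = h weight_measurable[OF w] G
  have [measurable]: "(\<lambda>x. indicator {0..} x *\<^sub>R G' x) \<in> borel_measurable borel"
    by (rule borel_measurable_LIMSEQ_metric[where f = "\<lambda>n x. indicator {0..} x *\<^sub>R G n x", OF G])
       (auto simp: indicator_def lim)
  have mm: "(\<lambda>x. indicator {0..} x *\<^sub>R (F x * h x)) \<in> borel_measurable m"
    if [measurable]: "(\<lambda>x. indicator {0..} x *\<^sub>R F x) \<in> borel_measurable borel" for F :: "real \<Rightarrow> complex"
  proof -
    have "(\<lambda>x. (indicator {0..} x *\<^sub>R F x) * h x) \<in> borel_measurable m" by measurable
    then show ?thesis by (simp add: scaleR_conv_of_real mult.assoc)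
  qed
  have dw: "dominated \<omega> (\<lambda>x. of_real (K * \<omega> x))"
    unfolding dominated_def
  proof
    have "(\<lambda>x. of_real K * of_real (indicator {0..} x * \<omega> x) :: complex) \<in> borel_measurable borel" by measurable
    then show "(\<lambda>x. indicat_real {0..} x *\<^sub>R (of_real (K * \<omega> x) :: complex)) \<in> borel_measurable borel"
      by (simp add: scaleR_conv_of_real mult.left_commute)
    show "\<exists>L. \<forall>x\<ge>0. norm (of_real (K * \<omega> x) :: complex) \<le> L * \<omega> x"
      using w by (intro exI[of _ "\<bar>K\<bar>"]) (auto simp: abs_mult weight_def simp flip: of_real_mult)
  qed
  have "integrable m (\<lambda>x. norm (indicator {0..} x *\<^sub>R (of_real (K * \<omega> x) * h x)))"
    using piece_integrable[OF w m h fin dw] unfolding set_integrable_def by (rule integrable_norm)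
  then have "(\<lambda>n. LINT x:{0..}|m. G n x * h x) \<longlonglongrightarrow> (LINT x:{0..}|m. G' x * h x)"
    unfolding set_lebesgue_integral_def
  proof (rule integral_dominated_convergence[rotated 2])
    show "AE x in m. (\<lambda>n. indicator {0..} x *\<^sub>R (G n x * h x)) \<longlonglongrightarrow> indicator {0..} x *\<^sub>R (G' x * h x)"
      by (auto simp: indicator_def intro!: tendsto_mult lim)
    show "AE x in m. norm (indicator {0..} x *\<^sub>R (G n x * h x)) \<le>
        norm (indicator {0..} x *\<^sub>R (of_real (K * \<omega> x) * h x))" for n
    proof (rule AE_I2)
      fix x
      have "norm (G n x) * norm (h x) \<le> \<bar>K * \<omega> x\<bar> * norm (h x)" if "x \<ge> 0"
        using bound[OF that, of n] by (intro mult_right_mono) auto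
      then show "norm (indicator {0..} x *\<^sub>R (G n x * h x)) \<le>
        norm (indicator {0..} x *\<^sub>R (of_real (K * \<omega> x) * h x))"
        by (auto simp: indicator_def norm_mult abs_mult)
    qed
  qed (auto intro!: mm)
  then show ?case using Cons by (auto simp: admissible_Cons intro!: tendsto_add)
qed simp

lemma simple_function_pieces_integral:
  assumes w: "weight \<omega>" and ms: "admissible \<omega> ms" and s: "simple_function borel s" and A: "A \<in> bdd_borel"
  shows "pieces_integral ms (\<lambda>x. indicator A x * s x) =
     (\<Sum>y\<in>range s. y * pieces_integral ms (indicator (s -` {y} \<inter> A)))"
proof -
  have fin: "finite (range s)" using s by (simp add: simple_function_def)
  have "s -` {y} \<inter> A \<in> bdd_borel" for y
  proof -
    have "s -` {y} \<inter> A \<in> sets borel"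
      using s A simple_functionD(2)[OF s, of "{y}"] by (auto simp: bdd_borel_def)
    then show ?thesis using A by (auto simp: bdd_borel_def)
  qed
  then have d: "dominated \<omega> (\<lambda>x. y * indicator (s -` {y} \<inter> A) x)" for y
    using w by (intro dominated_cmult dominated_indicator_bounded) auto
  have "(\<lambda>x. indicator A x * s x) = (\<lambda>x. \<Sum>y\<in>range s. y * indicator (s -` {y} \<inter> A) x)"
  proof
    fix x
    have "(\<Sum>y\<in>range s. y * indicator (s -` {y} \<inter> A) x) = (\<Sum>y\<in>range s. if y = s x then s x * indicator A x else 0)"
      by (intro sum.cong) (auto simp: indicator_def)
    then show "indicator A x * s x = (\<Sum>y\<in>range s. y * indicator (s -` {y} \<inter> A) x)"
      using fin by (simp add: sum.delta)
  qed
  then show ?thesis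
    using pieces_integral_sum[OF w ms, of "range s", OF d] by (simp add: pieces_integral_cmult)
qed

text \<open>
  Two representations of \<open>\<mu>\<close> agree on indicators of bounded Borel sets, hence on simple functions restricted to a
  bounded interval, and dominated convergence extends this to every dominated function.
\<close>

lemma represents_integral_unique:
  assumes w: "weight \<omega>" and ms: "represents \<omega> ms \<mu>" and ms': "represents \<omega> ms' \<mu>" and g: "dominated \<omega> g"
  shows "pieces_integral ms g = pieces_integral ms' g"
proof -
  define g0 where "g0 x = indicator {0..} x *\<^sub>R g x" for x
  have g0: "g0 \<in> borel_measurable borel" using g by (simp add: dominated_def g0_def[abs_def])
  obtain s where s: "\<And>i. simple_function borel (s i)" "\<And>x. (\<lambda>i. s i x) \<longlonglongrightarrow> g0 x"
      "\<And>i x. norm (s i x) \<le> 2 * norm (g0 x)"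
    using borel_measurable_implies_sequence_metric[OF g0, of 0] unfolding norm_conv_dist by auto
  obtain K where K: "\<And>x. x \<ge> 0 \<Longrightarrow> norm (g x) \<le> K * \<omega> x" using g by (auto simp: dominated_def)
  define G where "G n x = indicator {0..real n} x * s n x" for n x
  have [measurable]: "s n \<in> borel_measurable borel" for n using s(1) by (rule borel_measurable_simple_function)
  have lim: "(\<lambda>n. pieces_integral ks (G n)) \<longlonglongrightarrow> pieces_integral ks g" if "admissible \<omega> ks" for ks
    using w that
  proof (rule pieces_integral_dominated_convergence)
    fix n show "(\<lambda>x. indicator {0..} x *\<^sub>R G n x) \<in> borel_measurable borel" unfolding G_def by measurable
  next
    fix n and x :: real assume x: "x \<ge> 0"
    have "norm (G n x) \<le> norm (s n x)" by (auto simp: G_def indicator_def)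
    also have "\<dots> \<le> 2 * norm (g x)" using s(3)[of n x] x by (simp add: g0_def)
    also have "\<dots> \<le> (2 * K) * \<omega> x" using K[OF x] by simp
    finally show "norm (G n x) \<le> (2 * K) * \<omega> x" .
  next
    fix x :: real assume x: "x \<ge> 0"
    obtain N where N: "x \<le> real N" using real_arch_simple by blast
    have "eventually (\<lambda>n. s n x = G n x) sequentially"
      using eventually_ge_at_top[of N] by eventually_elim (use x N in \<open>auto simp: G_def\<close>)
    then show "(\<lambda>n. G n x) \<longlonglongrightarrow> g x"
      using s(2)[of x] x tendsto_cong by (force simp: g0_def)
  qed
  have eq: "pieces_integral ms (G n) = pieces_integral ms' (G n)" for n
  proof -
    have A: "{0..real n} \<in> bdd_borel" by (auto simp: bdd_borel_def)
    have "s n -` {y} \<inter> {0..real n} \<in> bdd_borel" for y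
      using simple_functionD(2)[OF s(1), of n "{y}"] by (auto simp: bdd_borel_def intro: bounded_subset)
    then have "pieces_integral ms (indicator (s n -` {y} \<inter> {0..real n})) =
         pieces_integral ms' (indicator (s n -` {y} \<inter> {0..real n}))" for y
      using ms ms' unfolding represents_def by metis
    then show ?thesis unfolding G_def
      using simple_function_pieces_integral[OF w _ s(1) A] ms ms' by (simp add: represents_def)
  qed
  have "(\<lambda>n. pieces_integral ms' (G n)) \<longlonglongrightarrow> pieces_integral ms g"
    using lim[of ms] ms eq by (simp add: represents_def)
  then show ?thesis using lim[of ms'] ms' by (auto simp: represents_def intro: LIMSEQ_unique)
qed

section \<open>Positive and total variation as measures\<close>

lemma bdd_borel_Int: "A \<in> bdd_borel \<Longrightarrow> B \<in> sets borel \<Longrightarrow> A \<inter> B \<in> bdd_borel"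
  by (auto simp: bdd_borel_def intro: bounded_subset)

lemma bdd_borel_empty [simp]: "{} \<in> bdd_borel"
  by (simp add: bdd_borel_def)

lemma bdd_borel_Un: "A \<in> bdd_borel \<Longrightarrow> B \<in> bdd_borel \<Longrightarrow> A \<union> B \<in> bdd_borel"
  by (auto simp: bdd_borel_def)

lemma locfin_sums:
  assumes "locfin_measure \<mu>" "A \<in> bdd_borel" "disjoint_family B" "range B \<subseteq> sets borel"
  shows "(\<lambda>n. \<mu> (A \<inter> B n)) sums \<mu> (A \<inter> (\<Union>n. B n))"
proof -
  let ?K = "closure A"
  have "compact ?K" using assms(2) by (simp add: bdd_borel_def compact_closure)
  moreover have "?K \<subseteq> {0..}" using assms(2) by (intro closure_minimal) (auto simp: bdd_borel_def)
  moreover have "\<forall>n. A \<inter> B n \<in> sets borel \<and> A \<inter> B n \<subseteq> ?K"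
    using assms(2,4) closure_subset[of A] by (auto simp: bdd_borel_def)
  moreover have "disjoint_family (\<lambda>n. A \<inter> B n)"
    using assms(3) by (auto simp: disjoint_family_on_def)
  ultimately have "(\<lambda>n. \<mu> (A \<inter> B n)) sums \<mu> (\<Union>n. A \<inter> B n)"
    by (intro conjunct1[OF assms(1)[unfolded locfin_measure_def], rule_format, of ?K "\<lambda>n. A \<inter> B n"]) simp
  then show ?thesis by (simp only: Int_UN_distrib)
qed

lemma locfin_empty: "locfin_measure \<mu> \<Longrightarrow> \<mu> {} = 0"
  using locfin_sums[of \<mu> "{}" "\<lambda>_. {}"] sums_summable summable_const_iff
  by (fastforce simp: disjoint_family_on_def)

lemma locfin_Un:
  assumes \<mu>: "locfin_measure \<mu>" and A: "A \<in> bdd_borel" and B: "B \<in> bdd_borel" and AB: "A \<inter> B = {}"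
  shows "\<mu> (A \<union> B) = \<mu> A + \<mu> B"
proof -
  have r: "range (binaryset A B) \<subseteq> sets borel"
    using A B by (auto simp: range_binaryset_eq bdd_borel_def)
  have d: "disjoint_family (binaryset A B)"
    using AB by (auto simp: disjoint_family_on_def binaryset_def)
  have "(\<lambda>n. \<mu> ((A \<union> B) \<inter> binaryset A B n)) sums \<mu> (A \<union> B)"
    using locfin_sums[OF \<mu> bdd_borel_Un[OF A B] d r] by (simp add: UN_binaryset_eq)
  moreover have "(A \<union> B) \<inter> binaryset A B n = binaryset A B n" for n
    by (auto simp: binaryset_def)
  moreover have "(\<lambda>n. \<mu> (binaryset A B n)) sums (\<mu> A + \<mu> B)"
    using locfin_empty[OF \<mu>] by (rule binaryset_sums)
  ultimately show ?thesis using sums_unique2 by fastforce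
qed

lemma locfin_cmult:
  assumes "locfin_measure \<mu>" shows "locfin_measure (\<lambda>A. c * \<mu> A)"
  unfolding locfin_measure_def
proof (intro conjI allI impI)
  fix K and A :: "nat \<Rightarrow> real set"
  assume "compact K \<and> K \<subseteq> {0..} \<and> (\<forall>n. A n \<in> sets borel \<and> A n \<subseteq> K) \<and> disjoint_family A"
  then show "(\<lambda>n. c * \<mu> (A n)) sums (c * \<mu> (\<Union>n. A n))"
    by (intro sums_mult conjunct1[OF assms[unfolded locfin_measure_def], rule_format])
next
  fix A :: "real set" assume "A \<notin> bdd_borel"
  then show "c * \<mu> A = 0" using assms by (simp add: locfin_measure_def)
qed

text \<open>
  Both variations are suprema over what fits inside a set, hence monotone and superadditive. Only countable
  subadditivity has to be derived from the additivity of \<open>\<mu>\<close>.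
\<close>

lemma countably_additive_if_superadditive:
  fixes f :: "'a set \<Rightarrow> ennreal"
  assumes M: "sigma_algebra \<Omega> M" and empty: "f {} = 0" and mono: "\<And>A B. A \<subseteq> B \<Longrightarrow> f A \<le> f B"
    and super: "\<And>A B. A \<in> M \<Longrightarrow> B \<in> M \<Longrightarrow> A \<inter> B = {} \<Longrightarrow> f A + f B \<le> f (A \<union> B)"
    and sub: "\<And>A. disjoint_family A \<Longrightarrow> range A \<subseteq> M \<Longrightarrow> f (\<Union>n::nat. A n) \<le> (\<Sum>n. f (A n))"
  shows "countably_additive M f"
proof (rule countably_additiveI)
  interpret sigma_algebra \<Omega> M by fact
  fix A :: "nat \<Rightarrow> 'a set" assume A: "range A \<subseteq> M" "disjoint_family A"
  have "(\<Sum>i<n. f (A i)) \<le> f (\<Union>i<n. A i)" for n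
  proof (induction n)
    case (Suc n)
    have "(\<Sum>i<Suc n. f (A i)) \<le> f (\<Union>i<n. A i) + f (A n)" using Suc by (simp add: add_right_mono)
    also have "\<dots> \<le> f ((\<Union>i<n. A i) \<union> A n)"
    proof (rule super)
      have "A i \<inter> A n = {}" if "i < n" for i
        using A(2) that by (simp add: disjoint_family_on_def)
      then show "(\<Union>i<n. A i) \<inter> A n = {}" by blast
    qed (use A in auto)
    also have "(\<Union>i<n. A i) \<union> A n = (\<Union>i<Suc n. A i)" by (auto simp: less_Suc_eq)
    finally show ?case .
  qed (simp add: empty)
  also have "f (\<Union>i<n. A i) \<le> f (\<Union>i. A i)" for n by (intro mono) auto
  finally have "(\<Sum>i. f (A i)) \<le> f (\<Union>i. A i)" by (intro suminf_le_const) auto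
  with sub[OF A(2,1)] show "(\<Sum>i. f (A i)) = f (\<Union>i. A i)" by (rule antisym[rotated])
qed

lemma SUP_add_SUP_le_ennreal:
  fixes F :: "'i \<Rightarrow> ennreal" and G :: "'j \<Rightarrow> ennreal"
  assumes "I \<noteq> {}" "J \<noteq> {}" "\<And>i j. i \<in> I \<Longrightarrow> j \<in> J \<Longrightarrow> F i + G j \<le> c"
  shows "(SUP i\<in>I. F i) + (SUP j\<in>J. G j) \<le> c"
  using assms by (auto simp: ennreal_SUP_add_left[symmetric] ennreal_SUP_add_right intro!: SUP_least)

lemma ennreal_sums_le:
  fixes f :: "nat \<Rightarrow> real"
  assumes "f sums s" shows "ennreal s \<le> (\<Sum>n. ennreal (f n))"
proof (rule LIMSEQ_le_const2)
  show "(\<lambda>n. ennreal (\<Sum>i<n. f i)) \<longlonglongrightarrow> ennreal s"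
    using assms by (intro tendsto_ennrealI) (simp add: sums_def)
  have "ennreal (\<Sum>i<n. f i) \<le> (\<Sum>n. ennreal (f n))" for n
  proof -
    have "ennreal (\<Sum>i<n. f i) \<le> ennreal (\<Sum>i<n. max 0 (f i))" by (intro ennreal_leI sum_mono) auto
    also have "\<dots> = (\<Sum>i<n. ennreal (max 0 (f i)))" by simp
    also have "\<dots> = (\<Sum>i<n. ennreal (f i))" by (simp add: ennreal_max_0)
    also have "\<dots> \<le> (\<Sum>n. ennreal (f n))" by (intro sum_le_suminf) auto
    finally show ?thesis .
  qed
  then show "\<exists>N. \<forall>n\<ge>N. ennreal (\<Sum>i<n. f i) \<le> (\<Sum>n. ennreal (f n))" by blast
qed

lemma ennreal_norm_sums_le:
  fixes f :: "nat \<Rightarrow> 'a::real_normed_vector"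
  assumes "f sums s" shows "ennreal (norm s) \<le> (\<Sum>n. ennreal (norm (f n)))"
proof (rule LIMSEQ_le_const2)
  show "(\<lambda>n. ennreal (norm (\<Sum>i<n. f i))) \<longlonglongrightarrow> ennreal (norm s)"
    using assms by (intro tendsto_ennrealI tendsto_norm) (simp add: sums_def)
  have "ennreal (norm (\<Sum>i<n. f i)) \<le> (\<Sum>n. ennreal (norm (f n)))" for n
  proof -
    have "ennreal (norm (\<Sum>i<n. f i)) \<le> ennreal (\<Sum>i<n. norm (f i))" by (intro ennreal_leI norm_sum)
    also have "\<dots> = (\<Sum>i<n. ennreal (norm (f i)))" by simp
    also have "\<dots> \<le> (\<Sum>n. ennreal (norm (f n)))" by (intro sum_le_suminf) auto
    finally show ?thesis .
  qed
  then show "\<exists>N. \<forall>n\<ge>N. ennreal (norm (\<Sum>i<n. f i)) \<le> (\<Sum>n. ennreal (norm (f n)))" by blast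
qed

lemma sets_positive_variation [simp, measurable_cong]: "sets (positive_variation \<nu>) = sets borel"
  and sets_total_variation [simp, measurable_cong]: "sets (total_variation \<mu>) = sets borel"
  using sets.sigma_sets_eq[of borel] by (simp_all add: positive_variation_def total_variation_def)

text \<open>
  The constant is defined by \<^const>\<open>measure_of\<close>, so this equation is the assertion that the supremum is a
  measure. Countable subadditivity holds because a bounded set inside \<open>\<Union>n. A n\<close> is cut by the \<open>A n\<close> into
  pieces over which \<open>\<mu>\<close> sums up.
\<close>

lemma emeasure_positive_variation:
  assumes \<mu>: "locfin_measure \<mu>" and A: "A \<in> sets borel"
  shows "emeasure (positive_variation (\<lambda>A. Re (\<mu> A))) A = (SUP B\<in>{B \<in> bdd_borel. B \<subseteq> A}. ennreal (Re (\<mu> B)))"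
  unfolding positive_variation_def
proof (rule emeasure_measure_of_sigma)
  let ?f = "\<lambda>A. SUP B\<in>{B \<in> bdd_borel. B \<subseteq> A}. ennreal (Re (\<mu> B))"
  show sa: "sigma_algebra UNIV (sets (borel :: real measure))"
    using sets.sigma_algebra_axioms[of "borel :: real measure"] by simp
  have f0: "?f {} = 0"
    using locfin_empty[OF \<mu>] by (auto intro!: antisym SUP_least simp: bot_ennreal[symmetric])
  then show "positive (sets borel) ?f" by (simp add: positive_def)
  show "countably_additive (sets borel) ?f"
    using sa f0
  proof (rule countably_additive_if_superadditive)
    show "?f A \<le> ?f B" if "A \<subseteq> B" for A B using that by (intro SUP_subset_mono) auto
    show "?f A + ?f B \<le> ?f (A \<union> B)" if AB: "A \<inter> B = {}" for A B
    proof (rule SUP_add_SUP_le_ennreal)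
      fix P Q assume P: "P \<in> {B \<in> bdd_borel. B \<subseteq> A}" and Q: "Q \<in> {P \<in> bdd_borel. P \<subseteq> B}"
      have ub: "ennreal (Re (\<mu> R)) \<le> ?f (A \<union> B)" if "R \<in> bdd_borel" "R \<subseteq> A \<union> B" for R
        using that by (intro SUP_upper) auto
      consider "Re (\<mu> P) \<le> 0" | "Re (\<mu> Q) \<le> 0" | "Re (\<mu> P) \<ge> 0" "Re (\<mu> Q) \<ge> 0" by linarith
      then show "ennreal (Re (\<mu> P)) + ennreal (Re (\<mu> Q)) \<le> ?f (A \<union> B)"
      proof cases
        case 1 then show ?thesis using ub[of Q] Q by (auto simp: ennreal_neg)
      next
        case 2 then show ?thesis using ub[of P] P by (auto simp: ennreal_neg)
      next
        case 3
        have "\<mu> (P \<union> Q) = \<mu> P + \<mu> Q" using P Q AB by (intro locfin_Un[OF \<mu>]) auto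
        then have "ennreal (Re (\<mu> P)) + ennreal (Re (\<mu> Q)) = ennreal (Re (\<mu> (P \<union> Q)))"
          using 3 by (simp add: ennreal_plus)
        then show ?thesis using ub[of "P \<union> Q"] P Q by (auto intro: bdd_borel_Un)
      qed
    qed (auto intro: exI[of _ "{}"])
    show "?f (\<Union>n. A n) \<le> (\<Sum>n. ?f (A n))" if A: "disjoint_family A" "range A \<subseteq> sets borel" for A :: "nat \<Rightarrow> real set"
    proof (rule SUP_least)
      fix B assume B: "B \<in> {B \<in> bdd_borel. B \<subseteq> (\<Union>n. A n)}"
      then have "B \<inter> (\<Union>n. A n) = B" by auto
      then have "(\<lambda>n. \<mu> (B \<inter> A n)) sums \<mu> B" using locfin_sums[OF \<mu> _ A, of B] B by simp
      then have "ennreal (Re (\<mu> B)) \<le> (\<Sum>n. ennreal (Re (\<mu> (B \<inter> A n))))"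
        by (intro ennreal_sums_le sums_Re)
      also have "\<dots> \<le> (\<Sum>n. ?f (A n))"
        using B A by (intro suminf_le SUP_upper) (auto intro: bdd_borel_Int)
      finally show "ennreal (Re (\<mu> B)) \<le> (\<Sum>n. ?f (A n))" .
    qed
  qed
qed fact

lemma emeasure_total_variation:
  assumes \<mu>: "locfin_measure \<mu>" and A: "A \<in> sets borel"
  shows "emeasure (total_variation \<mu>) A =
    (SUP P\<in>{P. finite P \<and> disjoint P \<and> P \<subseteq> bdd_borel \<and> \<Union>P \<subseteq> A}. \<Sum>B\<in>P. ennreal (norm (\<mu> B)))"
  unfolding total_variation_def
proof (rule emeasure_measure_of_sigma)
  let ?D = "\<lambda>A. {P. finite P \<and> disjoint P \<and> P \<subseteq> bdd_borel \<and> \<Union>P \<subseteq> A}"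
  let ?f = "\<lambda>A. SUP P\<in>?D A. \<Sum>B\<in>P. ennreal (norm (\<mu> B))"
  show sa: "sigma_algebra UNIV (sets (borel :: real measure))"
    using sets.sigma_algebra_axioms[of "borel :: real measure"] by simp
  have zero: "(\<Sum>B\<in>P. ennreal (norm (\<mu> B))) = 0" if "\<Union>P \<subseteq> {}" for P
    using that locfin_empty[OF \<mu>] by (intro sum.neutral) auto
  have f0: "?f {} = 0"
    using zero by (auto intro!: antisym SUP_least simp: bot_ennreal[symmetric])
  then show "positive (sets borel) ?f" by (simp add: positive_def)
  show "countably_additive (sets borel) ?f"
    using sa f0
  proof (rule countably_additive_if_superadditive)
    show "?f A \<le> ?f B" if "A \<subseteq> B" for A B using that by (intro SUP_subset_mono) auto
    show "?f A + ?f B \<le> ?f (A \<union> B)" if AB: "A \<inter> B = {}" for A B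
    proof (rule SUP_add_SUP_le_ennreal)
      fix P Q assume P: "P \<in> ?D A" and Q: "Q \<in> ?D B"
      have "(\<Sum>B\<in>P \<inter> Q. ennreal (norm (\<mu> B))) = 0" using P Q AB by (intro zero) blast
      then have "(\<Sum>B\<in>P. ennreal (norm (\<mu> B))) + (\<Sum>B\<in>Q. ennreal (norm (\<mu> B))) = (\<Sum>B\<in>P \<union> Q. ennreal (norm (\<mu> B)))"
        using sum.union_inter[of P Q "\<lambda>B. ennreal (norm (\<mu> B))"] P Q by simp
      moreover have "P \<union> Q \<in> ?D (A \<union> B)"
      proof -
        have "\<Union>P \<inter> \<Union>Q = {}" using P Q AB by blast
        then have "disjoint (P \<union> Q)" using P Q by (intro disjoint_union) auto
        then show ?thesis using P Q by auto
      qed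
      ultimately show "(\<Sum>B\<in>P. ennreal (norm (\<mu> B))) + (\<Sum>B\<in>Q. ennreal (norm (\<mu> B))) \<le> ?f (A \<union> B)"
        by (metis (no_types, lifting) SUP_upper)
    qed (auto intro: exI[of _ "{}"])
    show "?f (\<Union>n. A n) \<le> (\<Sum>n. ?f (A n))" if A: "disjoint_family A" "range A \<subseteq> sets borel" for A :: "nat \<Rightarrow> real set"
    proof (rule SUP_least)
      fix P assume P: "P \<in> ?D (\<Union>n. A n)"
      have "(\<Sum>B\<in>P. ennreal (norm (\<mu> B))) \<le> (\<Sum>B\<in>P. \<Sum>n. ennreal (norm (\<mu> (B \<inter> A n))))"
      proof (rule sum_mono)
        fix B assume B: "B \<in> P"
        then have "B \<inter> (\<Union>n. A n) = B" "B \<in> bdd_borel" using P by auto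
        then have "(\<lambda>n. \<mu> (B \<inter> A n)) sums \<mu> B" using locfin_sums[OF \<mu> _ A, of B] by simp
        then show "ennreal (norm (\<mu> B)) \<le> (\<Sum>n. ennreal (norm (\<mu> (B \<inter> A n))))"
          by (rule ennreal_norm_sums_le)
      qed
      also have "\<dots> = (\<Sum>n. \<Sum>B\<in>P. ennreal (norm (\<mu> (B \<inter> A n))))"
        by (rule suminf_sum[symmetric]) auto
      also have "\<dots> \<le> (\<Sum>n. ?f (A n))"
      proof (rule suminf_le)
        fix n
        have "(\<Sum>B\<in>P. ennreal (norm (\<mu> (B \<inter> A n)))) = (\<Sum>B\<in>(\<lambda>B. B \<inter> A n) ` P. ennreal (norm (\<mu> B)))"
        \<comment> \<open>Cutting by \<open>A n\<close> can make distinct members of \<open>P\<close> equal, but only if both become empty.\<close>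
        proof (rule sum.reindex_nontrivial[symmetric, unfolded comp_def])
          show "finite P" using P by simp
          fix B B' assume *: "B \<in> P" "B' \<in> P" "B \<noteq> B'" "B \<inter> A n = B' \<inter> A n"
          then have "B \<inter> B' = {}" using P unfolding disjoint_def by auto
          with * have "B \<inter> A n = {}" by blast
          then show "ennreal (norm (\<mu> (B \<inter> A n))) = 0" using locfin_empty[OF \<mu>] by simp
        qed
        also have "\<dots> \<le> ?f (A n)"
        proof (rule SUP_upper)
          have "disjoint ((\<lambda>B. B \<inter> A n) ` P)" using P unfolding disjoint_def by blast
          moreover have "B \<inter> A n \<in> bdd_borel" if "B \<in> P" for B
            using that P A by (intro bdd_borel_Int) auto
          ultimately show "(\<lambda>B. B \<inter> A n) ` P \<in> ?D (A n)" using P by auto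
        qed
        finally show "(\<Sum>B\<in>P. ennreal (norm (\<mu> (B \<inter> A n)))) \<le> ?f (A n)" .
      qed auto
      finally show "(\<Sum>B\<in>P. ennreal (norm (\<mu> B))) \<le> (\<Sum>n. ?f (A n))" .
    qed
  qed
qed fact

text \<open>
  Both sides are additive and continuous along increasing sequences, so an inequality between measures of
  sets passes to integrals of non-negative functions.
\<close>

lemma nn_integral_le_sum_list:
  assumes T: "sets T = sets borel" and ns: "\<And>n. n \<in> set ns \<Longrightarrow> sets n = sets borel"
    and le: "\<And>A. A \<in> sets borel \<Longrightarrow> emeasure T A \<le> (\<Sum>n\<leftarrow>ns. emeasure n A)"
    and F: "F \<in> borel_measurable borel"
  shows "nn_integral T F \<le> (\<Sum>n\<leftarrow>ns. nn_integral n F)"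
  using F
proof (induction F rule: borel_measurable_induct)
  case (cong f g) then show ?case by (simp add: space_borel cong: nn_integral_cong)
next
  case (set A)
  have "(\<Sum>n\<leftarrow>ns. nn_integral n (indicator A)) = (\<Sum>n\<leftarrow>ns. emeasure n A)"
    using ns set by (intro arg_cong[of _ _ sum_list] map_cong) auto
  then show ?case using le[OF set] set T by simp
next
  case (mult u c)
  have "(\<Sum>n\<leftarrow>ns. \<integral>\<^sup>+x. c * u x \<partial>n) = (\<Sum>n\<leftarrow>ns. c * nn_integral n u)"
    using mult(2) ns by (intro arg_cong[of _ _ sum_list] map_cong refl nn_integral_cmult) (auto cong: measurable_cong_sets)
  also have "\<dots> = c * (\<Sum>n\<leftarrow>ns. nn_integral n u)" by (simp add: sum_list_const_mult)
  finally show ?case using mult T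
    by (subst nn_integral_cmult) (auto cong: measurable_cong_sets intro!: mult_left_mono)
next
  case (add u v)
  have "(\<Sum>n\<leftarrow>ns. \<integral>\<^sup>+x. v x + u x \<partial>n) = (\<Sum>n\<leftarrow>ns. nn_integral n v + nn_integral n u)"
    using add ns by (intro arg_cong[of _ _ sum_list] map_cong refl nn_integral_add) (auto cong: measurable_cong_sets)
  also have "\<dots> = (\<Sum>n\<leftarrow>ns. nn_integral n v) + (\<Sum>n\<leftarrow>ns. nn_integral n u)" by (simp add: sum_list_addf)
  finally show ?case using add T
    by (subst nn_integral_add) (auto cong: measurable_cong_sets intro!: add_mono)
next
  case (seq U)
  have "(SUP i. U i) = (\<lambda>x. SUP i. U i x)" by (rule ext) (simp add: image_comp)
  then have "nn_integral T (SUP i. U i) = (SUP i. nn_integral T (U i))"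
    using seq T nn_integral_monotone_convergence_SUP[of U T] by (simp cong: measurable_cong_sets)
  also have "\<dots> \<le> (\<Sum>n\<leftarrow>ns. nn_integral n (SUP i. U i))"
  proof (rule SUP_least)
    fix i
    have "nn_integral T (U i) \<le> (\<Sum>n\<leftarrow>ns. nn_integral n (U i))" by (rule seq)
    also have "\<dots> \<le> (\<Sum>n\<leftarrow>ns. nn_integral n (SUP i. U i))"
      by (intro sum_list_mono nn_integral_mono le_funD[OF SUP_upper]) simp
    finally show "nn_integral T (U i) \<le> (\<Sum>n\<leftarrow>ns. nn_integral n (SUP i. U i))" .
  qed
  finally show ?case .
qed

section \<open>The Jordan decomposition and the integral\<close>

lemma weight_nn_measurable:
  assumes "weight \<omega>" shows "(\<lambda>x. ennreal (\<omega> x) * indicator {0..} x) \<in> borel_measurable borel"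
proof -
  note [measurable] = weight_measurable[OF assms]
  have "(\<lambda>x. ennreal (indicator {0..} x * \<omega> x)) \<in> borel_measurable borel" by measurable
  also have "(\<lambda>x. ennreal (indicator {0..} x * \<omega> x)) = (\<lambda>x. ennreal (\<omega> x) * indicator {0..} x)"
    by (auto simp: indicator_def)
  finally show ?thesis .
qed

lemma M_space_total_variation_finite:
  assumes w: "weight \<omega>" and \<mu>: "\<mu> \<in> M_space \<omega>" and A: "A \<in> bdd_borel"
  shows "emeasure (total_variation \<mu>) A < \<infinity>"
proof -
  have m: "(\<lambda>x. ennreal (\<omega> x) * indicator {0..} x) \<in> borel_measurable (total_variation \<mu>)"
    using weight_nn_measurable[OF w] by (simp cong: measurable_cong_sets)
  obtain K where K: "\<And>x. x \<ge> 0 \<Longrightarrow> norm (indicator A x :: complex) \<le> K * \<omega> x"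
    using dominated_indicator_bounded[OF w A] by (auto simp: dominated_def)
  have "emeasure (total_variation \<mu>) A = (\<integral>\<^sup>+x. indicator A x \<partial>total_variation \<mu>)"
    using A by (simp add: bdd_borel_def)
  also have "\<dots> \<le> (\<integral>\<^sup>+x. ennreal \<bar>K\<bar> * (ennreal (\<omega> x) * indicator {0..} x) \<partial>total_variation \<mu>)"
  proof (rule nn_integral_mono)
    fix x
    show "indicator A x \<le> ennreal \<bar>K\<bar> * (ennreal (\<omega> x) * indicator {0..} x)"
    proof (cases "x \<in> A")
      case True
      then have x: "x \<ge> 0" using A by (auto simp: bdd_borel_def)
      have "1 \<le> \<bar>K\<bar> * \<omega> x"
        using K[OF x] True w x by (smt (verit) indicator_simps(1) mult_right_mono norm_one weight_def)
      then have "ennreal 1 \<le> ennreal (\<bar>K\<bar> * \<omega> x)" by (rule ennreal_leI)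
      then show ?thesis using True x by (simp add: ennreal_mult')
    qed simp
  qed
  also have "\<dots> = ennreal \<bar>K\<bar> * (\<integral>\<^sup>+x\<in>{0..}. ennreal (\<omega> x) \<partial>total_variation \<mu>)"
    using m by (rule nn_integral_cmult)
  also have "\<dots> < \<infinity>" using \<mu> by (simp add: M_space_def ennreal_mult_less_top)
  finally show ?thesis .
qed

text \<open>
  For \<open>c = 1, -1, -\<i>, \<i>\<close> these are the positive parts of \<open>Re \<mu>\<close>, \<open>- Re \<mu>\<close>, \<open>Im \<mu>\<close> and \<open>- Im \<mu>\<close>. The factor
  \<open>c\<close> allows one argument for all four.
\<close>

definition rotated_variation :: "(real set \<Rightarrow> complex) \<Rightarrow> complex \<Rightarrow> real measure" where
  "rotated_variation \<mu> c = positive_variation (\<lambda>A. Re (c * \<mu> A))"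

text \<open>
  The variation of \<open>Re (c \<mu>)\<close> contributes to \<open>\<mu>\<close> with coefficient \<open>1 / c\<close>, which is \<open>cnj c\<close> as \<open>c\<close> has modulus \<open>1\<close>.
\<close>

definition jordan_pieces :: "(real set \<Rightarrow> complex) \<Rightarrow> ((real \<Rightarrow> complex) \<times> real measure) list" where
  "jordan_pieces \<mu> = map (\<lambda>c. (\<lambda>_. cnj c, rotated_variation \<mu> c)) [1, -1, -\<i>, \<i>]"

lemma sets_rotated_variation [simp, measurable_cong]: "sets (rotated_variation \<mu> c) = sets borel"
  by (simp add: rotated_variation_def)

lemma emeasure_rotated_variation:
  assumes "locfin_measure \<mu>" "A \<in> sets borel"
  shows "emeasure (rotated_variation \<mu> c) A = (SUP B\<in>{B \<in> bdd_borel. B \<subseteq> A}. ennreal (Re (c * \<mu> B)))"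
  unfolding rotated_variation_def by (intro emeasure_positive_variation locfin_cmult assms)

lemma rotated_variation_le_total_variation:
  assumes \<mu>: "locfin_measure \<mu>" and c: "norm c = 1" and A: "A \<in> sets borel"
  shows "emeasure (rotated_variation \<mu> c) A \<le> emeasure (total_variation \<mu>) A"
  unfolding emeasure_rotated_variation[OF \<mu> A]
proof (rule SUP_least)
  fix B assume B: "B \<in> {B \<in> bdd_borel. B \<subseteq> A}"
  have "ennreal (Re (c * \<mu> B)) \<le> ennreal (norm (\<mu> B))"
    using complex_Re_le_cmod[of "c * \<mu> B"] c by (intro ennreal_leI) (simp add: norm_mult)
  also have "\<dots> = (\<Sum>B\<in>{B}. ennreal (norm (\<mu> B)))" by simp
  also have "\<dots> \<le> emeasure (total_variation \<mu>) A"
    unfolding emeasure_total_variation[OF \<mu> A] using B by (intro SUP_upper) auto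
  finally show "ennreal (Re (c * \<mu> B)) \<le> emeasure (total_variation \<mu>) A" .
qed

lemma nn_integral_rotated_variation_le:
  assumes "locfin_measure \<mu>" "norm c = 1" "F \<in> borel_measurable borel"
  shows "nn_integral (rotated_variation \<mu> c) F \<le> nn_integral (total_variation \<mu>) F"
  using nn_integral_le_sum_list[of "rotated_variation \<mu> c" "[total_variation \<mu>]" F]
    rotated_variation_le_total_variation[OF assms(1,2)] assms(3) by simp

lemma rotated_variation_finite:
  assumes "weight \<omega>" "\<mu> \<in> M_space \<omega>" "norm c = 1" "A \<in> bdd_borel"
  shows "emeasure (rotated_variation \<mu> c) A < \<infinity>"
  using rotated_variation_le_total_variation[of \<mu> c A] M_space_total_variation_finite[of \<omega> \<mu> A] assms
  by (auto simp: M_space_def bdd_borel_def intro: le_less_trans)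

lemma rotated_variation_sigma_finite:
  assumes w: "weight \<omega>" and \<mu>: "\<mu> \<in> M_space \<omega>" and c: "norm c = 1"
  shows "sigma_finite_measure (rotated_variation \<mu> c)"
proof
  let ?A = "range (\<lambda>n. {..real n})"
  have lf: "locfin_measure \<mu>" using \<mu> by (simp add: M_space_def)
  have "emeasure (rotated_variation \<mu> c) {..real n} \<noteq> \<infinity>" for n
  proof -
    have "emeasure (rotated_variation \<mu> c) {..real n} \<le> emeasure (rotated_variation \<mu> c) {0..real n}"
      unfolding emeasure_rotated_variation[OF lf borel_closed[OF closed_atMost]]
        emeasure_rotated_variation[OF lf borel_closed[OF closed_atLeastAtMost]]
      by (intro SUP_subset_mono) (auto simp: bdd_borel_def)
    also have "\<dots> < \<infinity>"
      using w \<mu> c by (rule rotated_variation_finite) (simp add: bdd_borel_def)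
    finally show ?thesis by simp
  qed
  moreover have "\<Union>?A = space (rotated_variation \<mu> c)"
    using real_arch_simple sets_eq_imp_space_eq[OF sets_rotated_variation, of \<mu> c] by auto
  ultimately show "\<exists>A. countable A \<and> A \<subseteq> sets (rotated_variation \<mu> c) \<and>
      \<Union>A = space (rotated_variation \<mu> c) \<and> (\<forall>a\<in>A. emeasure (rotated_variation \<mu> c) a \<noteq> \<infinity>)"
    by (intro exI[of _ ?A]) auto
qed

text \<open>
  For \<open>B \<subseteq> A\<close> we have \<open>\<mu> B = \<mu> A - \<mu> (A - B)\<close>, and the real part of \<open>- c \<mu> (A - B)\<close> is at most the variation for
  \<open>-c\<close>. The supremum over \<open>B\<close> gives one half of the Jordan decomposition, and exchanging \<open>c\<close> with \<open>-c\<close> the other.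
\<close>

lemma measure_rotated_variation_le:
  assumes w: "weight \<omega>" and \<mu>: "\<mu> \<in> M_space \<omega>" and c: "norm c = 1" and A: "A \<in> bdd_borel"
  shows "measure (rotated_variation \<mu> c) A \<le> Re (c * \<mu> A) + measure (rotated_variation \<mu> (-c)) A"
proof -
  have lf: "locfin_measure \<mu>" using \<mu> by (simp add: M_space_def)
  have A': "A \<in> sets borel" using A by (simp add: bdd_borel_def)
  have e: "emeasure (rotated_variation \<mu> d) A = ennreal (measure (rotated_variation \<mu> d) A)" if "norm d = 1" for d
    using rotated_variation_finite[OF w \<mu> that A] by (simp add: emeasure_eq_ennreal_measure)
  have ub: "Re (c * \<mu> B) \<le> Re (c * \<mu> A) + measure (rotated_variation \<mu> (-c)) A"
    if B: "B \<in> bdd_borel" "B \<subseteq> A" for B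
  proof -
    have AB: "A - B \<in> bdd_borel" using B A by (auto simp: bdd_borel_def intro: bounded_subset)
    have "\<mu> A = \<mu> B + \<mu> (A - B)" using locfin_Un[OF lf B(1) AB] B by (simp add: Un_absorb1)
    then have *: "Re (c * \<mu> B) = Re (c * \<mu> A) + Re (- c * \<mu> (A - B))" by (simp add: distrib_left)
    have "ennreal (Re (- c * \<mu> (A - B))) \<le> ennreal (measure (rotated_variation \<mu> (-c)) A)"
      using c AB by (subst e[symmetric]) (auto simp: emeasure_rotated_variation[OF lf A'] intro!: SUP_upper)
    then have "Re (- c * \<mu> (A - B)) \<le> measure (rotated_variation \<mu> (-c)) A"
      by (simp only: ennreal_le_iff[OF measure_nonneg])
    then show ?thesis using * by simp
  qed
  have 0: "0 \<le> Re (c * \<mu> A) + measure (rotated_variation \<mu> (-c)) A"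
    using ub[of "{}"] locfin_empty[OF lf] by simp
  have "emeasure (rotated_variation \<mu> c) A \<le> ennreal (Re (c * \<mu> A) + measure (rotated_variation \<mu> (-c)) A)"
    unfolding emeasure_rotated_variation[OF lf A'] by (intro SUP_least ennreal_leI ub) auto
  then show ?thesis unfolding e[OF c] using 0 by (simp only: ennreal_le_iff)
qed

lemma Re_eq_rotated_variation:
  assumes w: "weight \<omega>" and \<mu>: "\<mu> \<in> M_space \<omega>" and c: "norm c = 1" and A: "A \<in> bdd_borel"
  shows "Re (c * \<mu> A) = measure (rotated_variation \<mu> c) A - measure (rotated_variation \<mu> (-c)) A"
  using measure_rotated_variation_le[OF w \<mu> c A] measure_rotated_variation_le[OF w \<mu> _ A, of "- c"] c by simp

lemma piece_integral_indicator:
  assumes "sets m = sets borel" "A \<in> bdd_borel" "emeasure m A < \<infinity>"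
  shows "(LINT x:{0..}|m. indicator A x * c) = of_real (measure m A) * (c :: complex)"
proof -
  have "(\<lambda>x. indicat_real {0..} x *\<^sub>R (indicator A x * c)) = (\<lambda>x. indicator A x *\<^sub>R c)"
    using assms(2) by (auto simp: bdd_borel_def indicator_def fun_eq_iff)
  moreover have "integrable m (indicat_real A)" using assms by (auto simp: bdd_borel_def)
  moreover have "space m = UNIV" using assms(1) sets_eq_imp_space_eq[of m borel] by simp
  ultimately show ?thesis unfolding set_lebesgue_integral_def by (simp add: scaleR_conv_of_real)
qed

lemma pieces_integral_jordan_pieces:
  "pieces_integral (jordan_pieces \<mu>) g =
     (\<Sum>c\<leftarrow>[1, -1, -\<i>, \<i>]. (LINT x:{0..}|rotated_variation \<mu> c. g x) * cnj c)"
  by (simp only: pieces_integral_def jordan_pieces_def map_map comp_def prod.case set_integral_mult_left)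

lemma jordan_pieces_represent:
  assumes w: "weight \<omega>" and \<mu>: "\<mu> \<in> M_space \<omega>"
  shows "represents \<omega> (jordan_pieces \<mu>) \<mu>"
proof -
  have lf: "locfin_measure \<mu>" using \<mu> by (simp add: M_space_def)
  have fin: "(\<integral>\<^sup>+x\<in>{0..}. ennreal (\<omega> x) \<partial>rotated_variation \<mu> c) < \<infinity>" if "norm c = 1" for c
    using nn_integral_rotated_variation_le[OF lf that weight_nn_measurable[OF w]] \<mu>
    by (auto simp: M_space_def intro: le_less_trans)
  have "admissible \<omega> (jordan_pieces \<mu>)"
    by (auto simp: admissible_def jordan_pieces_def fin[simplified])
  moreover have "\<mu> A = pieces_integral (jordan_pieces \<mu>) (indicator A)" if A: "A \<in> bdd_borel" for A
  proof -
    have p: "(LINT x:{0..}|rotated_variation \<mu> c. indicator A x) = complex_of_real (measure (rotated_variation \<mu> c) A)"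
      if "norm c = 1" for c
      using piece_integral_indicator[of "rotated_variation \<mu> c" A 1] A rotated_variation_finite[OF w \<mu> that A] by simp
    have "Re (\<mu> A) = measure (rotated_variation \<mu> 1) A - measure (rotated_variation \<mu> (-1)) A"
         "Im (\<mu> A) = measure (rotated_variation \<mu> (-\<i>)) A - measure (rotated_variation \<mu> \<i>) A"
      using Re_eq_rotated_variation[OF w \<mu> _ A, of 1] Re_eq_rotated_variation[OF w \<mu> _ A, of "-\<i>"] by simp_all
    then show ?thesis by (simp add: pieces_integral_jordan_pieces p complex_eq_iff)
  qed
  moreover have "\<mu> A = 0" if "A \<notin> bdd_borel" for A using lf that by (simp add: locfin_measure_def)
  ultimately show ?thesis by (simp add: represents_def)
qed

lemma cm_integral_jordan_pieces: "cm_integral \<mu> g = pieces_integral (jordan_pieces \<mu>) g"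
  by (simp add: pieces_integral_jordan_pieces cm_integral_def rotated_variation_def algebra_simps)

text \<open>
  This frees the integral from the Jordan decomposition in its definition; linearity in \<open>\<mu>\<close>, the integral of a
  transported measure and that of \<open>f(t) dt\<close> are all read off from convenient representations.
\<close>

lemma cm_integral_eq_pieces_integral:
  assumes w: "weight \<omega>" and \<mu>: "\<mu> \<in> M_space \<omega>" and ms: "represents \<omega> ms \<mu>" and g: "dominated \<omega> g"
  shows "cm_integral \<mu> g = pieces_integral ms g"
  unfolding cm_integral_jordan_pieces
  using represents_integral_unique[OF w jordan_pieces_represent[OF w \<mu>] ms g] .

lemma represents_locfin:
  assumes w: "weight \<omega>" and ms: "represents \<omega> ms \<mu>"
  shows "locfin_measure \<mu>"
  unfolding locfin_measure_def
proof (intro conjI allI impI)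
  fix K and A :: "nat \<Rightarrow> real set"
  assume *: "compact K \<and> K \<subseteq> {0..} \<and> (\<forall>n. A n \<in> sets borel \<and> A n \<subseteq> K) \<and> disjoint_family A"
  then have b: "B \<in> bdd_borel" if "B \<in> sets borel" "B \<subseteq> K" for B
    using that by (auto simp: bdd_borel_def dest: compact_imp_bounded intro: bounded_subset)
  have adm: "admissible \<omega> ms" using ms by (simp add: represents_def)
  have \<mu>: "\<mu> B = pieces_integral ms (indicator B)" if "B \<in> bdd_borel" for B
    using ms that by (simp add: represents_def)
  have An: "A n \<in> bdd_borel" for n using * by (intro b) auto
  have UA: "(\<Union>n. A n) \<in> bdd_borel" using * by (intro b) auto
  have Un: "(\<Union>i<n. A i) \<in> bdd_borel" for n using * by (intro b) auto
  obtain L where L: "\<And>x. x \<ge> 0 \<Longrightarrow> norm (indicator (\<Union>n. A n) x :: complex) \<le> L * \<omega> x"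
    using dominated_indicator_bounded[OF w UA] by (auto simp: dominated_def)
  have "(\<Sum>i<n. \<mu> (A i)) = pieces_integral ms (indicator (\<Union>i<n. A i))" for n
  proof -
    have "(\<lambda>x. \<Sum>i<n. indicator (A i) x) = (indicator (\<Union>i<n. A i) :: real \<Rightarrow> complex)"
      using * by (intro ext indicator_UN_disjoint[symmetric]) (auto simp: disjoint_family_on_def)
    moreover have "(\<Sum>i<n. \<mu> (A i)) = pieces_integral ms (\<lambda>x. \<Sum>i<n. indicator (A i) x)"
      using pieces_integral_sum[OF w adm, of "{..<n}" "\<lambda>i. indicator (A i)"] An
      by (simp add: \<mu> dominated_indicator_bounded[OF w])
    ultimately show ?thesis by simp
  qed
  moreover have "(\<lambda>n. pieces_integral ms (indicator (\<Union>i<n. A i))) \<longlonglongrightarrow> pieces_integral ms (indicator (\<Union>n. A n))"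
    using w adm
  proof (rule pieces_integral_dominated_convergence)
    show "(\<lambda>x. indicator {0..} x *\<^sub>R indicator (\<Union>i<n. A i) x :: complex) \<in> borel_measurable borel" for n
      using dominated_indicator_bounded[OF w Un] by (simp add: dominated_def)
    show "norm (indicator (\<Union>i<n. A i) x :: complex) \<le> L * \<omega> x" if "x \<ge> 0" for n x
      using L[OF that] by (rule order_trans[rotated]) (auto simp: indicator_def)
    show "(\<lambda>n. indicator (\<Union>i<n. A i) x :: complex) \<longlonglongrightarrow> indicator (\<Union>n. A n) x" for x
      by (rule LIMSEQ_indicator_UN)
  qed
  ultimately show "(\<lambda>n. \<mu> (A n)) sums \<mu> (\<Union>n. A n)"
    unfolding sums_def by (simp add: \<mu>[OF UA])
next
  fix A :: "real set" assume "A \<notin> bdd_borel" then show "\<mu> A = 0" using ms by (simp add: represents_def)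
qed

definition piece_modulus :: "(real \<Rightarrow> complex) \<times> real measure \<Rightarrow> real measure" where
  "piece_modulus p = density (snd p) (\<lambda>x. ennreal (norm (fst p x)) * indicator {0..} x)"

lemma norm_pieces_integral_le:
  assumes "weight \<omega>" "admissible \<omega> ms" "B \<in> bdd_borel"
  shows "ennreal (norm (pieces_integral ms (indicator B))) \<le> (\<Sum>n\<leftarrow>map piece_modulus ms. emeasure n B)"
  using assms(2)
proof (induction ms)
  case (Cons p ms)
  obtain h m where p[simp]: "p = (h, m)" by (cases p)
  have m: "sets m = sets borel" and h[measurable]: "h \<in> borel_measurable borel"
    using Cons.prems by (auto simp: admissible_Cons)
  note [measurable_cong] = m
  have B[measurable]: "B \<in> sets borel" "B \<in> sets m" and B0: "B \<subseteq> {0..}" using assms(3) m by (auto simp: bdd_borel_def)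
  let ?I = "LINT x:{0..}|m. indicator B x * h x"
  have "set_integrable m {0..} (\<lambda>x. indicator B x * h x)"
    using Cons.prems assms by (intro piece_integrable[of \<omega>] dominated_indicator_bounded) (auto simp: admissible_Cons)
  then have "ennreal (norm ?I) \<le> (\<integral>\<^sup>+x. norm (indicator {0..} x *\<^sub>R (indicator B x * h x)) \<partial>m)"
    unfolding set_lebesgue_integral_def set_integrable_def by (rule integral_norm_bound_ennreal)
  also have "\<dots> = (\<integral>\<^sup>+x. (ennreal (norm (h x)) * indicator {0..} x) * indicator B x \<partial>m)"
    by (intro nn_integral_cong) (auto simp: indicator_def)
  also have "\<dots> = emeasure (piece_modulus p) B"
    unfolding piece_modulus_def by (subst emeasure_density) auto
  finally have *: "ennreal (norm ?I) \<le> emeasure (piece_modulus p) B" .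
  have "ennreal (norm (?I + pieces_integral ms (indicator B))) \<le> ennreal (norm ?I + norm (pieces_integral ms (indicator B)))"
    by (intro ennreal_leI norm_triangle_ineq)
  also have "\<dots> = ennreal (norm ?I) + ennreal (norm (pieces_integral ms (indicator B)))" by simp
  finally show ?case using * Cons by (auto simp: admissible_Cons intro: order_trans add_mono)
qed simp

text \<open>
  Each \<open>|\<mu> B|\<close> is at most \<open>\<Sum> \<integral>\<^sub>B |h| dm\<close>, and this bound is additive over disjoint sets.
\<close>

lemma total_variation_le_pieces:
  assumes w: "weight \<omega>" and ms: "represents \<omega> ms \<mu>" and A: "A \<in> sets borel"
  shows "emeasure (total_variation \<mu>) A \<le> (\<Sum>n\<leftarrow>map piece_modulus ms. emeasure n A)"
  unfolding emeasure_total_variation[OF represents_locfin[OF w ms] A]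
proof (rule SUP_least)
  fix P assume P: "P \<in> {P. finite P \<and> disjoint P \<and> P \<subseteq> bdd_borel \<and> \<Union>P \<subseteq> A}"
  have adm: "admissible \<omega> ms" using ms by (simp add: represents_def)
  have "(\<Sum>B\<in>P. ennreal (norm (\<mu> B))) \<le> (\<Sum>B\<in>P. \<Sum>n\<leftarrow>map piece_modulus ms. emeasure n B)"
  proof (rule sum_mono)
    fix B assume "B \<in> P"
    then have B: "B \<in> bdd_borel" using P by auto
    then have "\<mu> B = pieces_integral ms (indicator B)" using ms by (simp add: represents_def)
    then show "ennreal (norm (\<mu> B)) \<le> (\<Sum>n\<leftarrow>map piece_modulus ms. emeasure n B)"
      using norm_pieces_integral_le[OF w adm B] by simp
  qed
  also have "\<dots> = (\<Sum>n\<leftarrow>map piece_modulus ms. \<Sum>B\<in>P. emeasure n B)"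
    by (induction ms) (simp_all add: sum.distrib)
  also have "\<dots> \<le> (\<Sum>n\<leftarrow>map piece_modulus ms. emeasure n A)"
  proof (rule sum_list_mono)
    fix n assume n: "n \<in> set (map piece_modulus ms)"
    then have s: "sets n = sets borel" using adm by (auto simp: piece_modulus_def admissible_def)
    have "(\<Sum>B\<in>P. emeasure n B) = emeasure n (\<Union>B\<in>P. B)"
      using P s by (intro sum_emeasure) (auto simp: bdd_borel_def disjoint_family_on_def disjoint_def)
    also have "\<dots> \<le> emeasure n A" using P A s by (intro emeasure_mono) auto
    finally show "(\<Sum>B\<in>P. emeasure n B) \<le> emeasure n A" .
  qed
  finally show "(\<Sum>B\<in>P. ennreal (norm (\<mu> B))) \<le> (\<Sum>n\<leftarrow>map piece_modulus ms. emeasure n A)" .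
qed

lemma represents_total_variation_le:
  assumes w: "weight \<omega>" and ms: "represents \<omega> ms \<mu>"
  shows "(\<integral>\<^sup>+x\<in>{0..}. ennreal (\<omega> x) \<partial>total_variation \<mu>) \<le>
    (\<Sum>(h, m)\<leftarrow>ms. \<integral>\<^sup>+x\<in>{0..}. ennreal (\<omega> x * norm (h x)) \<partial>m)"
proof -
  have adm: "admissible \<omega> ms" using ms by (simp add: represents_def)
  have "(\<integral>\<^sup>+x\<in>{0..}. ennreal (\<omega> x) \<partial>total_variation \<mu>) \<le>
     (\<Sum>n\<leftarrow>map piece_modulus ms. \<integral>\<^sup>+x\<in>{0..}. ennreal (\<omega> x) \<partial>n)"
    using adm total_variation_le_pieces[OF w ms] weight_nn_measurable[OF w]
    by (intro nn_integral_le_sum_list) (auto simp: piece_modulus_def admissible_def)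
  also have "\<dots> = (\<Sum>(h, m)\<leftarrow>ms. \<integral>\<^sup>+x\<in>{0..}. ennreal (\<omega> x * norm (h x)) \<partial>m)"
    unfolding map_map
  proof (intro arg_cong[of _ _ sum_list] map_cong refl)
    fix p assume p: "p \<in> set ms"
    obtain h m where [simp]: "p = (h, m)" by (cases p)
    have m: "sets m = sets borel" and h[measurable]: "h \<in> borel_measurable borel"
      using adm p by (auto simp: admissible_def)
    note [measurable_cong] = m and [measurable] = weight_nn_measurable[OF w]
    have "((\<lambda>n. \<integral>\<^sup>+x\<in>{0..}. ennreal (\<omega> x) \<partial>n) \<circ> piece_modulus) p =
        (\<integral>\<^sup>+x. (ennreal (norm (h x)) * indicator {0..} x) * (ennreal (\<omega> x) * indicator {0..} x) \<partial>m)"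
      by (simp add: piece_modulus_def nn_integral_density)
    also have "\<dots> = (\<integral>\<^sup>+x\<in>{0..}. ennreal (\<omega> x * norm (h x)) \<partial>m)"
      by (intro nn_integral_cong) (auto simp: indicator_def ennreal_mult'' mult.commute)
    finally show "((\<lambda>n. \<integral>\<^sup>+x\<in>{0..}. ennreal (\<omega> x) \<partial>n) \<circ> piece_modulus) p =
        (case p of (h, m) \<Rightarrow> \<integral>\<^sup>+x\<in>{0..}. ennreal (\<omega> x * norm (h x)) \<partial>m)" by simp
  qed
  finally show ?thesis .
qed

lemma represents_M_space:
  assumes w: "weight \<omega>" and ms: "represents \<omega> ms \<mu>" shows "\<mu> \<in> M_space \<omega>"
proof -
  have "(\<Sum>(h, m)\<leftarrow>ks. \<integral>\<^sup>+x\<in>{0..}. ennreal (\<omega> x * norm (h x)) \<partial>m) < \<infinity>" if "admissible \<omega> ks" for ks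
    using that by (induction ks) (auto simp: admissible_Cons)
  then show ?thesis
    using represents_total_variation_le[OF w ms] represents_locfin[OF w ms] ms
    by (auto simp: M_space_def represents_def intro: le_less_trans)
qed

lemma represents_Nil: "represents \<omega> [] (\<lambda>A. 0)"
  by (simp add: represents_def)

lemma represents_add:
  "represents \<omega> ms \<mu> \<Longrightarrow> represents \<omega> ks \<nu> \<Longrightarrow> represents \<omega> (ms @ ks) (\<lambda>A. \<mu> A + \<nu> A)"
  by (simp add: represents_def)

lemma represents_cmult:
  assumes w: "weight \<omega>" and ms: "represents \<omega> ms \<mu>"
  shows "represents \<omega> (map (\<lambda>(h, m). (\<lambda>x. c * h x, m)) ms) (\<lambda>A. c * \<mu> A)"
    and "pieces_integral (map (\<lambda>(h, m). (\<lambda>x. c * h x, m)) ms) g = c * pieces_integral ms g"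
proof -
  show I: "pieces_integral (map (\<lambda>(h, m). (\<lambda>x. c * h x, m)) ms) g = c * pieces_integral ms g" for g
  proof (induction ms)
    case (Cons p ms)
    have "(LINT x:{0..}|m. g x * (c * h x)) = c * (LINT x:{0..}|m. g x * h x)" for h m
      by (simp flip: set_integral_mult_right add: mult.left_commute)
    then show ?case using Cons by (cases p) (simp add: distrib_left)
  qed simp
  have "admissible \<omega> (map (\<lambda>(h, m). (\<lambda>x. c * h x, m)) ks)" if "admissible \<omega> ks" for ks
    using that
  proof (induction ks)
    case (Cons p ks)
    obtain h m where [simp]: "p = (h, m)" by (cases p)
    have m: "sets m = sets borel" and h[measurable]: "h \<in> borel_measurable borel"
      and fin: "(\<integral>\<^sup>+x\<in>{0..}. ennreal (\<omega> x * norm (h x)) \<partial>m) < \<infinity>"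
      using Cons.prems by (auto simp: admissible_Cons)
    note [measurable_cong] = m and [measurable] = weight_nn_measurable[OF w]
    have [measurable]: "(\<lambda>x. ennreal (\<omega> x * norm (h x)) * indicator {0..} x) \<in> borel_measurable m"
    proof -
      have "(\<lambda>x. (ennreal (\<omega> x) * indicator {0..} x) * ennreal (norm (h x))) \<in> borel_measurable m" by measurable
      then show ?thesis by (simp add: ennreal_mult'' mult.assoc mult.commute mult.left_commute)
    qed
    have "(\<integral>\<^sup>+x\<in>{0..}. ennreal (\<omega> x * norm (c * h x)) \<partial>m) =
      (\<integral>\<^sup>+x. ennreal (norm c) * (ennreal (\<omega> x * norm (h x)) * indicator {0..} x) \<partial>m)"
      by (intro nn_integral_cong) (auto simp: norm_mult indicator_def ennreal_mult'[symmetric] algebra_simps)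
    also have "\<dots> = ennreal (norm c) * (\<integral>\<^sup>+x\<in>{0..}. ennreal (\<omega> x * norm (h x)) \<partial>m)"
      by (intro nn_integral_cmult) measurable
    also have "\<dots> < \<infinity>" using fin by (simp add: ennreal_mult_less_top)
    finally show ?case using Cons h m by (simp add: admissible_Cons)
  qed simp
  then show "represents \<omega> (map (\<lambda>(h, m). (\<lambda>x. c * h x, m)) ms) (\<lambda>A. c * \<mu> A)"
    using ms by (simp add: represents_def I)
qed

lemma C0_dominated:
  assumes w: "weight \<omega>" and g: "g \<in> C0_space \<omega>" shows "dominated \<omega> g"
proof -
  have c: "continuous_on {0..} g" and l: "((\<lambda>t. g t / of_real (\<omega> t)) \<longlongrightarrow> 0) at_top"
    using g by (auto simp: C0_space_def)
  have cw: "continuous_on {0..} \<omega>" and pos: "\<And>t. t \<ge> 0 \<Longrightarrow> \<omega> t > 0" using w by (auto simp: weight_def)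
  have "eventually (\<lambda>t. norm (g t / of_real (\<omega> t)) < 1) at_top"
    using tendstoD[OF l, of 1] by simp
  then obtain N where N: "\<And>t. t \<ge> N \<Longrightarrow> norm (g t / of_real (\<omega> t)) < 1"
    by (auto simp: eventually_at_top_linorder)
  have "compact ((\<lambda>t. g t / of_real (\<omega> t)) ` {0..N})"
    using pos by (intro compact_continuous_image continuous_intros continuous_on_subset[OF c] continuous_on_subset[OF cw])
      (auto simp: less_imp_neq[symmetric])
  then obtain L where L: "\<And>t. t \<in> {0..N} \<Longrightarrow> norm (g t / of_real (\<omega> t)) \<le> L"
    by (meson bounded_iff compact_imp_bounded imageI)
  have "norm (g t) \<le> max 1 L * \<omega> t" if t: "t \<ge> 0" for t
  proof -
    have "norm (g t / of_real (\<omega> t)) \<le> max 1 L" using N[of t] L[of t] t by fastforce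
    then show ?thesis using pos[OF t] by (simp add: norm_divide divide_le_eq)
  qed
  then show ?thesis unfolding dominated_def
    using borel_measurable_continuous_on_indicator[OF _ c] by auto
qed

text \<open>
  On the half-line, \<open>ramp n a\<close> tends to the indicator of \<open>{0..a}\<close> as \<open>n\<close> grows; it vanishes beyond \<open>a + 1\<close>.
\<close>

definition ramp :: "nat \<Rightarrow> real \<Rightarrow> real \<Rightarrow> complex" where
  "ramp n a x = of_real (max 0 (min 1 (1 + real (Suc n) * (a - x))))"

lemma ramp_C0: "ramp n a \<in> C0_space \<omega>"
proof -
  have "eventually (\<lambda>t. ramp n a t / of_real (\<omega> t) = 0) at_top"
    unfolding eventually_at_top_linorder
  proof (intro exI allI impI)
    fix t assume t: "t \<ge> a + 1"
    have "real (Suc n) * (a - t) \<le> 1 * (a - t)" using t by (intro mult_right_mono_neg) auto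
    then have "1 + real (Suc n) * (a - t) \<le> 1 + 1 * (a - t)" by (rule add_left_mono)
    also have "\<dots> \<le> 0" using t by simp
    finally have "1 + real (Suc n) * (a - t) \<le> 0" .
    then show "ramp n a t / of_real (\<omega> t) = 0" by (simp add: ramp_def min_def del: of_nat_Suc)
  qed
  then show ?thesis unfolding C0_space_def ramp_def
    by (auto intro!: continuous_intros tendsto_eventually)
qed

lemma ramp_limit:
  assumes w: "weight \<omega>" and \<mu>: "\<mu> \<in> M_space \<omega>"
  shows "(\<lambda>n. cm_integral \<mu> (ramp n a)) \<longlonglongrightarrow> \<mu> {0..a}"
proof -
  have ms: "represents \<omega> (jordan_pieces \<mu>) \<mu>" by (rule jordan_pieces_represent[OF w \<mu>])
  have b: "{0..r} \<in> bdd_borel" for r :: real by (auto simp: bdd_borel_def)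
  obtain L where L: "\<And>x. x \<ge> 0 \<Longrightarrow> norm (indicator {0..a + 1} x :: complex) \<le> L * \<omega> x"
    using dominated_indicator_bounded[OF w b[of "a + 1"]] by (auto simp: dominated_def)
  have "(\<lambda>n. pieces_integral (jordan_pieces \<mu>) (ramp n a)) \<longlonglongrightarrow> pieces_integral (jordan_pieces \<mu>) (indicator {0..a})"
    using w
  proof (rule pieces_integral_dominated_convergence)
    show "admissible \<omega> (jordan_pieces \<mu>)" using ms by (simp add: represents_def)
    show "(\<lambda>x. indicator {0..} x *\<^sub>R ramp n a x) \<in> borel_measurable borel" for n
      using C0_dominated[OF w ramp_C0] by (simp add: dominated_def)
    fix x :: real assume x: "x \<ge> 0"
    show "norm (ramp n a x) \<le> L * \<omega> x" for n
    proof -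
      have "norm (ramp n a x) \<le> norm (indicator {0..a + 1} x :: complex)"
      proof (cases "x \<le> a + 1")
        case False
        then have "real (Suc n) * (a - x) \<le> 1 * (a - x)" by (intro mult_right_mono_neg) auto
        then have "1 + real (Suc n) * (a - x) \<le> 1 + 1 * (a - x)" by (rule add_left_mono)
        also have "\<dots> \<le> 0" using False by simp
        finally have "1 + real (Suc n) * (a - x) \<le> 0" .
        then show ?thesis by (simp add: ramp_def min_def del: of_nat_Suc)
      qed (use x in \<open>simp add: ramp_def\<close>)
      then show ?thesis using L[OF x] by simp
    qed
    show "(\<lambda>n. ramp n a x) \<longlonglongrightarrow> indicator {0..a} x"
    proof (cases "x \<le> a")
      case True then show ?thesis using x by (simp add: ramp_def)
    next
      case False
      obtain N :: nat where N: "1 / (x - a) \<le> real N" using real_arch_simple by blast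
      have "eventually (\<lambda>n. ramp n a x = 0) sequentially"
        using eventually_ge_at_top[of N]
      proof eventually_elim
        fix n assume "N \<le> n"
        then have "1 / (x - a) \<le> real (Suc n)" using N by linarith
        then have "1 \<le> real (Suc n) * (x - a)" using False by (simp add: divide_le_eq del: of_nat_Suc)
        then have "1 + real (Suc n) * (a - x) \<le> 0" by (simp add: algebra_simps del: of_nat_Suc)
        then show "ramp n a x = 0" by (simp add: ramp_def del: of_nat_Suc)
      qed
      then show ?thesis using False by (simp add: tendsto_eventually)
    qed
  qed
  then show ?thesis using ms b[of a] by (simp add: cm_integral_jordan_pieces represents_def)
qed

text \<open>
  Ramps show that the two measures agree on the intervals \<open>{0..a}\<close>. The sets \<open>A\<close> for which they agree on
  \<open>{0..r} \<inter> A\<close> form a Dynkin class; intersecting with \<open>{0..r}\<close> keeps all sets in the domain of the measures.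
\<close>

lemma M_space_eqI:
  assumes w: "weight \<omega>" and \<mu>: "\<mu> \<in> M_space \<omega>" and \<nu>: "\<nu> \<in> M_space \<omega>"
    and eq: "\<And>g. g \<in> C0_space \<omega> \<Longrightarrow> cm_integral \<mu> g = cm_integral \<nu> g"
  shows "\<mu> = \<nu>"
proof
  have lf: "locfin_measure \<mu>" "locfin_measure \<nu>" using \<mu> \<nu> by (auto simp: M_space_def)
  have b: "{0..r} \<in> bdd_borel" for r :: real by (auto simp: bdd_borel_def)
  have iv: "\<mu> {0..a} = \<nu> {0..a}" for a
    using ramp_limit[OF w \<mu>, of a] ramp_limit[OF w \<nu>, of a] eq[OF ramp_C0]
    by (auto intro: LIMSEQ_unique)
  have *: "\<mu> ({0..r} \<inter> A) = \<nu> ({0..r} \<inter> A)" if "A \<in> sets borel" for A r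
  proof -
    have A: "A \<in> sigma_sets UNIV (range (\<lambda>a::real. {..a}))"
      using that by (simp add: borel_eq_atMost)
    have sb: "B \<in> sets borel" if "B \<in> sigma_sets UNIV (range (\<lambda>a::real. {..a}))" for B
      using that by (simp add: borel_eq_atMost)
    have "Int_stable (range (\<lambda>a::real. {..a}))" by (auto simp: Int_stable_def min_def)
    moreover have "range (\<lambda>a::real. {..a}) \<subseteq> Pow UNIV" by simp
    ultimately show ?thesis using A
    proof (induction A rule: sigma_sets_induct_disjoint)
      case (basic B)
      then obtain a where "B = {..a}" by auto
      then have "{0..r} \<inter> B = {0..min r a}" by auto
      then show ?case using iv by simp
    next
      case empty then show ?case using locfin_empty[OF lf(1)] locfin_empty[OF lf(2)] by simp
    next
      case (compl B)
      have B: "{0..r} \<inter> B \<in> bdd_borel" "{0..r} \<inter> (UNIV - B) \<in> bdd_borel"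
        using sb[OF compl(1)] b by (auto intro: bdd_borel_Int)
      have "({0..r} \<inter> B) \<union> ({0..r} \<inter> (UNIV - B)) = {0..r}" by auto
      then have "\<mu> {0..r} = \<mu> ({0..r} \<inter> B) + \<mu> ({0..r} \<inter> (UNIV - B))"
          "\<nu> {0..r} = \<nu> ({0..r} \<inter> B) + \<nu> ({0..r} \<inter> (UNIV - B))"
        using locfin_Un[OF lf(1) B] locfin_Un[OF lf(2) B] by auto
      then show ?case using compl(2) iv[of r] by simp
    next
      case (union B)
      have rB: "range B \<subseteq> sets borel" using union(2) sb by auto
      show ?case
        using locfin_sums[OF lf(1) b[of r] union(1) rB] locfin_sums[OF lf(2) b[of r] union(1) rB] union(3)
        by (simp add: sums_unique2)
    qed
  qed
  fix A
  show "\<mu> A = \<nu> A"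
  proof (cases "A \<in> bdd_borel")
    case True
    then obtain r where "A \<subseteq> {0..r}" unfolding bdd_borel_def bounded_iff by fastforce
    then show ?thesis using *[of A r] True by (simp add: bdd_borel_def Int_absorb1)
  qed (use lf in \<open>simp add: locfin_measure_def\<close>)
qed

lemma M_space_add:
  assumes w: "weight \<omega>" and \<mu>: "\<mu> \<in> M_space \<omega>" and \<nu>: "\<nu> \<in> M_space \<omega>"
  shows "(\<lambda>A. \<mu> A + \<nu> A) \<in> M_space \<omega>"
  using represents_M_space[OF w represents_add[OF jordan_pieces_represent[OF w \<mu>] jordan_pieces_represent[OF w \<nu>]]] .

lemma M_space_cmult:
  assumes w: "weight \<omega>" and \<mu>: "\<mu> \<in> M_space \<omega>"
  shows "(\<lambda>A. c * \<mu> A) \<in> M_space \<omega>"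
  using represents_M_space[OF w represents_cmult(1)[OF w jordan_pieces_represent[OF w \<mu>]]] .

lemma cm_integral_add:
  assumes w: "weight \<omega>" and \<mu>: "\<mu> \<in> M_space \<omega>" and \<nu>: "\<nu> \<in> M_space \<omega>" and g: "g \<in> C0_space \<omega>"
  shows "cm_integral (\<lambda>A. \<mu> A + \<nu> A) g = cm_integral \<mu> g + cm_integral \<nu> g"
  using cm_integral_eq_pieces_integral[OF w M_space_add[OF w \<mu> \<nu>]
      represents_add[OF jordan_pieces_represent[OF w \<mu>] jordan_pieces_represent[OF w \<nu>]] C0_dominated[OF w g]]
  by (simp add: cm_integral_jordan_pieces)

lemma cm_integral_cmult:
  assumes w: "weight \<omega>" and \<mu>: "\<mu> \<in> M_space \<omega>" and g: "g \<in> C0_space \<omega>"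
  shows "cm_integral (\<lambda>A. c * \<mu> A) g = c * cm_integral \<mu> g"
  using cm_integral_eq_pieces_integral[OF w M_space_cmult[OF w \<mu>]
      represents_cmult(1)[OF w jordan_pieces_represent[OF w \<mu>]] C0_dominated[OF w g]]
    represents_cmult(2)[OF w jordan_pieces_represent[OF w \<mu>]]
  by (simp add: cm_integral_jordan_pieces)

lemma M_norm_zero: "weight \<omega> \<Longrightarrow> M_norm \<omega> (\<lambda>A. 0) = 0"
  using represents_total_variation_le[OF _ represents_Nil, of \<omega>] by (simp add: M_norm_def)

section \<open>The averaging kernel on continuous functions\<close>

text \<open>
  The kernel \<open>\<phi>\<close> is a Borel version of \<open>\<psi>(t) / t\<close> that vanishes outside \<open>(0, 1]\<close>, so that all integrals can be taken
  over the whole line and only positive \<open>t\<close> contribute.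
\<close>

locale dilation_kernel =
  fixes \<phi> \<omega>1 \<omega>2 :: "real \<Rightarrow> real" and C :: real
  assumes kernel_measurable [measurable]: "\<phi> \<in> borel_measurable borel"
    and kernel_nonneg: "0 \<le> \<phi> t"
    and kernel_support: "\<phi> t \<noteq> 0 \<Longrightarrow> 0 < t \<and> t \<le> 1"
    and w1: "weight \<omega>1" and w2: "weight \<omega>2" and C_nonneg: "0 \<le> C"
    and kernel_bound: "0 \<le> s \<Longrightarrow> (\<integral>\<^sup>+t. ennreal (\<omega>2 (s / t) * \<phi> t) \<partial>lborel) \<le> ennreal (C * \<omega>1 s)"
begin

text \<open>
  The formula for \<open>U\<^sup>* g\<close>, where \<open>\<phi>(t)\<close> stands for \<open>\<psi>(t) / t\<close>.
\<close>

definition kernel_average :: "(real \<Rightarrow> complex) \<Rightarrow> real \<Rightarrow> complex" where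
  "kernel_average g s = (LINT t|lborel. g (s / t) * of_real (\<phi> t))"

lemma w1_pos: "0 \<le> t \<Longrightarrow> 0 < \<omega>1 t" and w2_pos: "0 \<le> t \<Longrightarrow> 0 < \<omega>2 t"
  using w1 w2 by (auto simp: weight_def)

lemma kernel_restrict:
  assumes "0 \<le> s"
  shows "g (s / t) * of_real (\<phi> t) = (indicator {0..} (s / t) *\<^sub>R g (s / t)) * (of_real (\<phi> t) :: complex)"
  using kernel_support[of t] assms by (cases "\<phi> t = 0") auto

lemma dominated_constant_nonneg:
  "(\<And>x. 0 \<le> x \<Longrightarrow> norm (g x) \<le> K * \<omega>2 x) \<Longrightarrow> 0 \<le> K" for g :: "real \<Rightarrow> complex"
  using w2_pos[of 0] by (smt (verit) mult_neg_pos norm_ge_zero)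

lemma kernel_average_nn_bound:
  fixes g :: "real \<Rightarrow> complex"
  assumes g: "\<And>x. 0 \<le> x \<Longrightarrow> norm (g x) \<le> K * \<omega>2 x" and s: "0 \<le> s"
  shows "(\<integral>\<^sup>+t. ennreal (norm (g (s / t) * of_real (\<phi> t))) \<partial>lborel) \<le> ennreal (K * (C * \<omega>1 s))"
proof -
  have K: "0 \<le> K" using dominated_constant_nonneg g .
  have m: "(\<lambda>t. ennreal (\<omega>2 (s / t) * \<phi> t)) \<in> borel_measurable lborel"
  proof -
    note [measurable] = weight_measurable[OF w2]
    have "(\<lambda>t. ennreal ((indicator {0..} (s / t) * \<omega>2 (s / t)) * \<phi> t)) \<in> borel_measurable lborel" by measurable
    also have "(\<lambda>t. ennreal ((indicator {0..} (s / t) * \<omega>2 (s / t)) * \<phi> t)) = (\<lambda>t. ennreal (\<omega>2 (s / t) * \<phi> t))"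
    proof
      fix t show "ennreal ((indicator {0..} (s / t) * \<omega>2 (s / t)) * \<phi> t) = ennreal (\<omega>2 (s / t) * \<phi> t)"
        using kernel_support[of t] s by (cases "\<phi> t = 0") auto
    qed
    finally show ?thesis .
  qed
  have "(\<integral>\<^sup>+t. ennreal (norm (g (s / t) * of_real (\<phi> t))) \<partial>lborel) \<le>
      (\<integral>\<^sup>+t. ennreal K * ennreal (\<omega>2 (s / t) * \<phi> t) \<partial>lborel)"
  proof (rule nn_integral_mono)
    fix t
    show "ennreal (norm (g (s / t) * of_real (\<phi> t))) \<le> ennreal K * ennreal (\<omega>2 (s / t) * \<phi> t)"
    proof (cases "\<phi> t = 0")
      case False
      then have "0 \<le> s / t" using kernel_support[of t] s by simp
      then have "norm (g (s / t)) * \<phi> t \<le> (K * \<omega>2 (s / t)) * \<phi> t"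
        using g kernel_nonneg by (intro mult_right_mono) auto
      then show ?thesis using K kernel_nonneg[of t]
        by (auto simp: norm_mult ennreal_mult'[symmetric] mult.assoc intro!: ennreal_leI)
    qed simp
  qed
  also have "\<dots> = ennreal K * (\<integral>\<^sup>+t. ennreal (\<omega>2 (s / t) * \<phi> t) \<partial>lborel)"
    using m by (rule nn_integral_cmult)
  also have "\<dots> \<le> ennreal K * ennreal (C * \<omega>1 s)" by (intro mult_left_mono kernel_bound s) simp
  also have "\<dots> = ennreal (K * (C * \<omega>1 s))" using K by (simp add: ennreal_mult')
  finally show ?thesis .
qed

lemma kernel_average_integrable:
  assumes g: "dominated \<omega>2 g" and s: "0 \<le> s"
  shows "integrable lborel (\<lambda>t. g (s / t) * of_real (\<phi> t))"
proof (rule integrableI_bounded)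
  obtain K where "\<And>x. 0 \<le> x \<Longrightarrow> norm (g x) \<le> K * \<omega>2 x" using g by (auto simp: dominated_def)
  from kernel_average_nn_bound[OF this s]
  show "(\<integral>\<^sup>+t. ennreal (norm (g (s / t) * of_real (\<phi> t))) \<partial>lborel) < \<infinity>"
    using ennreal_less_top[of "K * (C * \<omega>1 s)"] unfolding infinity_ennreal_def by (rule le_less_trans)
  have [measurable]: "(\<lambda>x. indicator {0..} x *\<^sub>R g x) \<in> borel_measurable borel"
    using g by (simp add: dominated_def)
  have "(\<lambda>t. (indicator {0..} (s / t) *\<^sub>R g (s / t)) * of_real (\<phi> t)) \<in> borel_measurable lborel"
    by measurable
  then show "(\<lambda>t. g (s / t) * of_real (\<phi> t)) \<in> borel_measurable lborel"
    unfolding kernel_restrict[OF s, symmetric] .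
qed

lemma norm_kernel_average_le:
  assumes "dominated \<omega>2 g" "\<And>x. 0 \<le> x \<Longrightarrow> norm (g x) \<le> K * \<omega>2 x" "0 \<le> s"
  shows "norm (kernel_average g s) \<le> K * (C * \<omega>1 s)"
proof -
  have "ennreal (norm (kernel_average g s)) \<le> ennreal (K * (C * \<omega>1 s))"
    unfolding kernel_average_def using integral_norm_bound_ennreal[OF kernel_average_integrable[OF assms(1,3)]] kernel_average_nn_bound[of g, OF assms(2,3)]
    by (rule order_trans)
  moreover have "0 \<le> K * (C * \<omega>1 s)"
    using dominated_constant_nonneg[of g K] assms(2) C_nonneg w1_pos[OF assms(3)] by simp
  ultimately show ?thesis by simp
qed

lemma kernel_average_add:
  assumes "dominated \<omega>2 f" "dominated \<omega>2 g" "0 \<le> s"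
  shows "kernel_average (\<lambda>x. f x + g x) s = kernel_average f s + kernel_average g s"
  using kernel_average_integrable[OF assms(1,3)] kernel_average_integrable[OF assms(2,3)] by (simp add: kernel_average_def distrib_right)

lemma kernel_average_cmult: "kernel_average (\<lambda>x. c * g x) s = c * kernel_average g s"
  by (simp add: kernel_average_def mult.assoc)

text \<open>
  At \<open>s = 0\<close> the kernel condition reads \<open>\<omega>2 0 * \<integral> \<phi> \<le> C * \<omega>1 0\<close>.
\<close>

lemma kernel_integrable: "integrable lborel \<phi>"
proof -
  have "dominated \<omega>2 (indicator {0})"
    by (rule dominated_indicator_bounded[OF w2]) (simp add: bdd_borel_def)
  from kernel_average_integrable[OF this, of 0] have "integrable lborel (\<lambda>t. complex_of_real (\<phi> t))" by simp
  then show ?thesis by (simp add: complex_of_real_integrable_eq)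
qed

lemma kernel_average_continuous_bounded:
  assumes g: "dominated \<omega>2 g" and c: "continuous_on {0..} g" and B: "\<And>x. 0 \<le> x \<Longrightarrow> norm (g x) \<le> B"
  shows "continuous_on {0..} (kernel_average g)"
proof (rule continuous_on_sequentiallyI)
  fix u :: "nat \<Rightarrow> real" and a assume u: "\<forall>n. u n \<in> {0..}" "u \<longlonglongrightarrow> a" and a: "a \<in> {0..}"
  show "(\<lambda>n. kernel_average g (u n)) \<longlonglongrightarrow> kernel_average g a"
    unfolding kernel_average_def
  proof (rule integral_dominated_convergence[where w = "\<lambda>t. B * \<phi> t"])
    show "(\<lambda>t. g (a / t) * of_real (\<phi> t)) \<in> borel_measurable lborel"
      using kernel_average_integrable[OF g, of a] a by auto
    show "(\<lambda>t. g (u n / t) * of_real (\<phi> t)) \<in> borel_measurable lborel" for n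
      using kernel_average_integrable[OF g, of "u n"] u by auto
    show "integrable lborel (\<lambda>t. B * \<phi> t)" using kernel_integrable by simp
    show "AE t in lborel. (\<lambda>n. g (u n / t) * of_real (\<phi> t)) \<longlonglongrightarrow> g (a / t) * of_real (\<phi> t)"
    proof (rule AE_I2)
      fix t
      show "(\<lambda>n. g (u n / t) * of_real (\<phi> t)) \<longlonglongrightarrow> g (a / t) * of_real (\<phi> t)"
      proof (cases "\<phi> t = 0")
        case False
        then have t: "0 < t" using kernel_support[of t] by simp
        then have "(\<lambda>n. u n / t) \<longlonglongrightarrow> a / t" using u by (intro tendsto_divide) auto
        then have "(g \<circ> (\<lambda>n. u n / t)) \<longlonglongrightarrow> g (a / t)"
          using c u a t unfolding continuous_on_sequentially by auto
        then show ?thesis by (intro tendsto_mult) (auto simp: comp_def)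
      qed simp
    qed
    show "AE t in lborel. norm (g (u n / t) * of_real (\<phi> t)) \<le> B * \<phi> t" for n
    proof (rule AE_I2)
      fix t
      show "norm (g (u n / t) * of_real (\<phi> t)) \<le> B * \<phi> t"
      proof (cases "\<phi> t = 0")
        case False
        then have "0 \<le> u n / t" using kernel_support[of t] u by simp
        then show ?thesis using B[of "u n / t"] kernel_nonneg[of t] by (simp add: norm_mult mult_right_mono)
      qed simp
    qed
  qed
qed

text \<open>
  Multiplication by a ramp makes \<open>g\<close> bounded, so that its average is continuous. The average vanishes beyond
  \<open>N + 1\<close> together with the function, as \<open>s / t \<ge> s\<close> for \<open>t\<close> in the support of the kernel.
\<close>

lemma kernel_average_cutoff:
  assumes g: "g \<in> C0_space \<omega>2"
  defines "h \<equiv> \<lambda>N x. g x * ramp 0 N x"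
  shows "dominated \<omega>2 (h N)" "continuous_on {0..} (kernel_average (h N))" "N + 1 \<le> s \<Longrightarrow> 0 \<le> s \<Longrightarrow> kernel_average (h N) s = 0"
proof -
  have c: "continuous_on {0..} g" using g by (simp add: C0_space_def)
  have ch: "continuous_on {0..} (h N)"
    using ramp_C0[of 0 N \<omega>2] c unfolding h_def C0_space_def by (auto intro: continuous_on_mult)
  have r: "norm (ramp 0 N x) \<le> 1" for x by (simp add: ramp_def)
  have r0: "h N x = 0" if "N + 1 \<le> x" for x using that by (simp add: h_def ramp_def)
  obtain K where K: "\<And>x. 0 \<le> x \<Longrightarrow> norm (g x) \<le> K * \<omega>2 x"
    using C0_dominated[OF w2 g] by (auto simp: dominated_def)
  have "norm (h N x) \<le> K * \<omega>2 x" if "0 \<le> x" for x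
  proof -
    have "norm (h N x) \<le> norm (g x) * 1" unfolding h_def norm_mult using r by (intro mult_left_mono) auto
    then show ?thesis using K[OF that] by simp
  qed
  then show d: "dominated \<omega>2 (h N)"
    using borel_measurable_continuous_on_indicator[OF _ ch] unfolding dominated_def by auto
  have "bounded (h N ` {0..N + 1})"
    by (intro compact_imp_bounded compact_continuous_image continuous_on_subset[OF ch]) auto
  then obtain B where "\<forall>y\<in>h N ` {0..N + 1}. norm y \<le> B" unfolding bounded_iff by blast
  then have B: "norm (h N x) \<le> B" if "x \<in> {0..N + 1}" for x using that by blast
  have "norm (h N x) \<le> max 0 B" if "0 \<le> x" for x
    using B[of x] r0[of x] that by (cases "x \<le> N + 1") (auto simp: le_max_iff_disj)
  then show "continuous_on {0..} (kernel_average (h N))" by (rule kernel_average_continuous_bounded[OF d ch])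
  assume s: "N + 1 \<le> s" "0 \<le> s"
  have z: "h N (s / t) * of_real (\<phi> t) = 0" for t
  proof (cases "\<phi> t = 0")
    case False
    then have "s \<le> s / t" using kernel_support[of t] s by (simp add: le_divide_eq mult_left_le)
    then show ?thesis using r0[of "s / t"] s by simp
  qed simp
  show "kernel_average (h N) s = 0" unfolding kernel_average_def z by simp
qed

text \<open>
  Divided by the weights, averaging is bounded by \<open>C\<close> in the supremum norm. Hence the quotient by \<open>\<omega>1\<close> is a uniform
  limit of continuous functions with bounded support.
\<close>

lemma kernel_average_C0:
  assumes g: "g \<in> C0_space \<omega>2" shows "kernel_average g \<in> C0_space \<omega>1"
proof -
  define h where "h N x = g x * ramp 0 N x" for N x
  note cut = kernel_average_cutoff[OF g, folded h_def]
  have dg: "dominated \<omega>2 g" by (rule C0_dominated[OF w2 g])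
  have approx: "\<exists>N0. \<forall>N\<ge>N0. \<forall>x\<ge>0. norm (kernel_average g x - kernel_average (h N) x) \<le> \<epsilon> * (C * \<omega>1 x)" if \<epsilon>: "\<epsilon> > 0" for \<epsilon>
  proof -
    have "eventually (\<lambda>t. norm (g t / of_real (\<omega>2 t)) < \<epsilon>) at_top"
      using g tendstoD[OF _ \<epsilon>, of "\<lambda>t. g t / of_real (\<omega>2 t)" 0 at_top] by (simp add: C0_space_def)
    then obtain N0 where N0: "\<And>t. t \<ge> N0 \<Longrightarrow> norm (g t / of_real (\<omega>2 t)) < \<epsilon>"
      by (auto simp: eventually_at_top_linorder)
    have "norm (kernel_average g s - kernel_average (h N) s) \<le> \<epsilon> * (C * \<omega>1 s)" if N: "N \<ge> N0" and s: "0 \<le> s" for N s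
    proof -
      have d: "dominated \<omega>2 (\<lambda>x. g x + (- 1) * h N x)"
        by (intro dominated_add dominated_cmult dg cut)
      have "kernel_average (\<lambda>x. g x + (- 1) * h N x) s = kernel_average g s - kernel_average (h N) s"
        using kernel_average_add[OF dg dominated_cmult[OF cut(1)[of N], of "-1"] s] kernel_average_cmult[of "-1" "h N" s] by simp
      moreover have "norm (kernel_average (\<lambda>x. g x + (- 1) * h N x) s) \<le> \<epsilon> * (C * \<omega>1 s)"
        using d _ s
      proof (rule norm_kernel_average_le)
        fix x :: real assume x: "0 \<le> x"
        show "norm (g x + (- 1) * h N x) \<le> \<epsilon> * \<omega>2 x"
        proof (cases "x \<le> N")
          case True
          then show ?thesis using \<epsilon> w2_pos[OF x] by (simp add: h_def ramp_def)
        next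
          case False
          then have "norm (g x) < \<epsilon> * \<omega>2 x"
            using N0[of x] N w2_pos[OF x] by (simp add: norm_divide divide_less_eq)
          moreover have "g x + (- 1) * h N x = g x * (1 - ramp 0 N x)" by (simp add: h_def algebra_simps)
          moreover have "norm (1 - ramp 0 N x) \<le> 1"
            unfolding ramp_def of_real_1[symmetric, where 'a = complex] of_real_diff[symmetric] norm_of_real by simp
          ultimately show ?thesis
            by (smt (verit) mult_left_le norm_ge_zero norm_mult)
        qed
      qed
      ultimately show ?thesis by simp
    qed
    then show ?thesis by blast
  qed
  define q where "q x = kernel_average g x / of_real (\<omega>1 x)" for x
  have q_close: "\<exists>N. \<forall>x\<ge>0. dist (kernel_average (h N) x / of_real (\<omega>1 x)) (q x) < e \<and> N \<ge> N0" if e: "e > 0" for e N0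
  proof -
    obtain N1 where N1: "\<And>N x. N \<ge> N1 \<Longrightarrow> 0 \<le> x \<Longrightarrow> norm (kernel_average g x - kernel_average (h N) x) \<le> (e / (2 * (C + 1))) * (C * \<omega>1 x)"
      using approx[of "e / (2 * (C + 1))"] e C_nonneg by auto
    let ?N = "max N0 N1"
    have "dist (kernel_average (h ?N) x / of_real (\<omega>1 x)) (q x) < e" if x: "0 \<le> x" for x
    proof -
      have "dist (kernel_average (h ?N) x / of_real (\<omega>1 x)) (q x) = norm (kernel_average g x - kernel_average (h ?N) x) / \<omega>1 x"
        using w1_pos[OF x] unfolding q_def
        by (simp add: dist_norm norm_minus_commute norm_divide flip: diff_divide_distrib)
      also have "\<dots> \<le> (e / (2 * (C + 1))) * C"
        using N1[of ?N x] x w1_pos[OF x] by (simp add: divide_le_eq mult.assoc)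
      also have "\<dots> < e" using e C_nonneg add_nonneg_pos[of "C * e" "e * 2"] by (simp add: field_simps)
      finally show ?thesis .
    qed
    then show ?thesis by (intro exI[of _ ?N]) simp
  qed
  have c1: "continuous_on {0..} \<omega>1" using w1 by (simp add: weight_def)
  define Ns where "Ns n = (SOME N. \<forall>x\<ge>0. dist (kernel_average (h N) x / of_real (\<omega>1 x)) (q x) < 1 / real (Suc n))" for n
  have Ns: "dist (kernel_average (h (Ns n)) x / of_real (\<omega>1 x)) (q x) < 1 / real (Suc n)" if "0 \<le> x" for n x
    unfolding Ns_def
    using someI_ex[of "\<lambda>N. \<forall>x\<ge>0. dist (kernel_average (h N) x / of_real (\<omega>1 x)) (q x) < 1 / real (Suc n)"]
      q_close[of "1 / real (Suc n)" 0] that by auto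
  have "continuous_on {0..} q"
  proof (rule uniform_limit_theorem[where F = sequentially])
    show "\<forall>\<^sub>F n in sequentially. continuous_on {0..} (\<lambda>x. kernel_average (h (Ns n)) x / of_real (\<omega>1 x))"
      using w1_pos by (intro always_eventually allI continuous_intros cut c1) (auto simp: less_imp_neq[symmetric])
    show "uniform_limit {0..} (\<lambda>n x. kernel_average (h (Ns n)) x / of_real (\<omega>1 x)) q sequentially"
    proof (rule uniform_limitI)
      fix e :: real assume "e > 0"
      then obtain n0 where n0: "1 / real (Suc n0) < e" using nat_approx_posE by blast
      show "\<forall>\<^sub>F n in sequentially. \<forall>x\<in>{0..}. dist (kernel_average (h (Ns n)) x / of_real (\<omega>1 x)) (q x) < e"
        using eventually_ge_at_top[of n0]
      proof eventually_elim
        fix n assume "n0 \<le> n"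
        then have "1 / real (Suc n) \<le> 1 / real (Suc n0)" by (intro divide_left_mono) auto
        then show "\<forall>x\<in>{0..}. dist (kernel_average (h (Ns n)) x / of_real (\<omega>1 x)) (q x) < e"
          using Ns[of _ n] n0 by fastforce
      qed
    qed
  qed simp
  then have "continuous_on {0..} (\<lambda>x. q x * of_real (\<omega>1 x))" by (intro continuous_intros c1)
  also have "?this \<longleftrightarrow> continuous_on {0..} (kernel_average g)"
    using w1_pos by (intro continuous_on_cong) (auto simp: q_def less_imp_neq[symmetric])
  finally have cW: "continuous_on {0..} (kernel_average g)" .
  have "(q \<longlongrightarrow> 0) at_top"
  proof (rule tendstoI)
    fix e :: real assume "e > 0"
    then obtain N where N: "\<And>x. 0 \<le> x \<Longrightarrow> dist (kernel_average (h N) x / of_real (\<omega>1 x)) (q x) < e"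
      using q_close[of e 0] by auto
    show "\<forall>\<^sub>F x in at_top. dist (q x) 0 < e"
      using eventually_ge_at_top[of "max 0 (N + 1)"]
    proof eventually_elim
      fix x assume "max 0 (N + 1) \<le> x"
      then show "dist (q x) 0 < e" using N[of x] cut(3)[of N x] by (simp add: dist_commute)
    qed
  qed
  then show ?thesis using cW by (simp add: C0_space_def q_def[abs_def])
qed

section \<open>Transporting measures along the kernel\<close>

text \<open>
  Fubini's theorem with the absolute integrability condition stated for the density, where it can be checked by
  the transport formulas for non-negative functions.
\<close>

lemma integral_density_pair_lborel:
  fixes F :: "real \<times> real \<Rightarrow> complex" and \<theta> :: "real \<times> real \<Rightarrow> real"
  assumes m: "sets m = sets borel" and sf: "sigma_finite_measure m"
    and \<theta>: "\<theta> \<in> borel_measurable (borel \<Otimes>\<^sub>M borel)" "\<And>z. 0 \<le> \<theta> z"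
    and F: "F \<in> borel_measurable (borel \<Otimes>\<^sub>M borel)"
    and fin: "(\<integral>\<^sup>+z. ennreal (norm (F z)) \<partial>density (m \<Otimes>\<^sub>M lborel) \<theta>) < \<infinity>"
  shows "(LINT z|density (m \<Otimes>\<^sub>M lborel) \<theta>. F z) = (LINT s|m. LINT t|lborel. \<theta> (s, t) *\<^sub>R F (s, t))"
proof -
  interpret sigma_finite_measure m by fact
  interpret pair_sigma_finite m lborel ..
  have "sets (m \<Otimes>\<^sub>M lborel) = sets (borel \<Otimes>\<^sub>M borel)" by (intro sets_pair_measure_cong m) simp
  note e = measurable_cong_sets[OF this refl]
  have [measurable]: "\<theta> \<in> borel_measurable (m \<Otimes>\<^sub>M lborel)" "F \<in> borel_measurable (m \<Otimes>\<^sub>M lborel)"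
    using \<theta>(1) F e by blast+
  have "integrable (density (m \<Otimes>\<^sub>M lborel) \<theta>) F"
    using fin by (intro integrableI_bounded) auto
  also have "?this \<longleftrightarrow> integrable (m \<Otimes>\<^sub>M lborel) (\<lambda>z. \<theta> z *\<^sub>R F z)"
    by (rule integrable_density) (use \<theta>(2) in auto)
  finally have int: "integrable (m \<Otimes>\<^sub>M lborel) (\<lambda>z. \<theta> z *\<^sub>R F z)" .
  have "(LINT z|density (m \<Otimes>\<^sub>M lborel) \<theta>. F z) = (LINT z|(m \<Otimes>\<^sub>M lborel). \<theta> z *\<^sub>R F z)"
    by (rule integral_density) (use \<theta>(2) in auto)
  then show ?thesis using integral_fst'[OF int] by simp
qed

text \<open>
  Transport of measures, the norm estimate on \<open>L\<^sup>1\<close> and the pairing identity are all integrals against such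
  measures in the coordinates \<open>(s, t)\<close>.
\<close>

definition kernel_measure :: "real measure \<Rightarrow> (real \<times> real) measure" where
  "kernel_measure m = density (m \<Otimes>\<^sub>M lborel) (\<lambda>(s, t). ennreal (indicator {0..} s * \<phi> t))"

definition push :: "real measure \<Rightarrow> real measure" where
  "push m = distr (kernel_measure m) borel (\<lambda>(s, t). s / t)"

lemma sets_push [simp, measurable_cong]: "sets (push m) = sets borel"
  by (simp add: push_def)

lemma kernel_density_measurable:
  fixes m :: "real measure"
  assumes m: "sets m = sets borel"
  shows "(\<lambda>z. indicat_real {0..} (fst z) * \<phi> (snd z)) \<in> borel_measurable (m \<Otimes>\<^sub>M lborel)"
    and "F \<in> borel_measurable (borel \<Otimes>\<^sub>M borel) \<Longrightarrow> F \<in> borel_measurable (m \<Otimes>\<^sub>M lborel)"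
proof -
  have e: "sets (m \<Otimes>\<^sub>M lborel) = sets (borel \<Otimes>\<^sub>M borel)" by (intro sets_pair_measure_cong m) simp
  have "(\<lambda>z :: real \<times> real. indicat_real {0..} (fst z) * \<phi> (snd z)) \<in> borel_measurable (borel \<Otimes>\<^sub>M borel)"
    by measurable
  then show "(\<lambda>z. indicat_real {0..} (fst z) * \<phi> (snd z)) \<in> borel_measurable (m \<Otimes>\<^sub>M lborel)"
    using measurable_cong_sets[OF e refl] by blast
  show "F \<in> borel_measurable (borel \<Otimes>\<^sub>M borel) \<Longrightarrow> F \<in> borel_measurable (m \<Otimes>\<^sub>M lborel)"
    using measurable_cong_sets[OF e refl] by blast
qed

lemma nn_integral_kernel_measure:
  assumes m [measurable_cong]: "sets m = sets borel" and F [measurable]: "F \<in> borel_measurable (borel \<Otimes>\<^sub>M borel)"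
  shows "(\<integral>\<^sup>+z. F z \<partial>kernel_measure m) = (\<integral>\<^sup>+s\<in>{0..}. (\<integral>\<^sup>+t. ennreal (\<phi> t) * F (s, t) \<partial>lborel) \<partial>m)"
proof -
  note [measurable] = kernel_density_measurable(1)[OF m] kernel_density_measurable(2)[OF m F]
  have "(\<integral>\<^sup>+z. F z \<partial>kernel_measure m) =
      (\<integral>\<^sup>+z. ennreal (indicator {0..} (fst z) * \<phi> (snd z)) * F z \<partial>(m \<Otimes>\<^sub>M lborel))"
    unfolding kernel_measure_def case_prod_beta by (subst nn_integral_density) simp_all
  also have "\<dots> = (\<integral>\<^sup>+s. \<integral>\<^sup>+t. ennreal (indicator {0..} s * \<phi> t) * F (s, t) \<partial>lborel \<partial>m)"
    by (subst lborel.nn_integral_fst[symmetric]) simp_all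
  also have "\<dots> = (\<integral>\<^sup>+s\<in>{0..}. (\<integral>\<^sup>+t. ennreal (\<phi> t) * F (s, t) \<partial>lborel) \<partial>m)"
    by (intro nn_integral_cong) (auto simp: indicator_def)
  finally show ?thesis .
qed

lemma nn_integral_push:
  assumes m [measurable_cong]: "sets m = sets borel" and F [measurable]: "F \<in> borel_measurable borel"
  shows "(\<integral>\<^sup>+x. F x \<partial>push m) = (\<integral>\<^sup>+s\<in>{0..}. (\<integral>\<^sup>+t. ennreal (\<phi> t) * F (s / t) \<partial>lborel) \<partial>m)"
proof -
  have [measurable_cong]: "sets (kernel_measure m) = sets (borel \<Otimes>\<^sub>M borel)"
    unfolding kernel_measure_def by (simp cong: sets_pair_measure_cong add: m)
  have "(\<integral>\<^sup>+x. F x \<partial>push m) = (\<integral>\<^sup>+z. F (fst z / snd z) \<partial>kernel_measure m)"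
    unfolding push_def case_prod_beta by (subst nn_integral_distr) measurable
  then show ?thesis by (simp add: nn_integral_kernel_measure[OF m])
qed

lemma push_weight_le:
  assumes m [measurable_cong]: "sets m = sets borel"
  shows "(\<integral>\<^sup>+x\<in>{0..}. ennreal (\<omega>2 x) \<partial>push m) \<le> ennreal C * (\<integral>\<^sup>+x\<in>{0..}. ennreal (\<omega>1 x) \<partial>m)"
proof -
  note [measurable] = weight_nn_measurable[OF w1] weight_nn_measurable[OF w2]
  have "(\<integral>\<^sup>+x\<in>{0..}. ennreal (\<omega>2 x) \<partial>push m) =
      (\<integral>\<^sup>+s\<in>{0..}. (\<integral>\<^sup>+t. ennreal (\<phi> t) * (ennreal (\<omega>2 (s / t)) * indicator {0..} (s / t)) \<partial>lborel) \<partial>m)"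
    by (rule nn_integral_push[OF m]) measurable
  also have "\<dots> \<le> (\<integral>\<^sup>+s. ennreal C * (ennreal (\<omega>1 s) * indicator {0..} s) \<partial>m)"
  proof (rule nn_integral_mono)
    fix s
    have "(\<integral>\<^sup>+t. ennreal (\<phi> t) * (ennreal (\<omega>2 (s / t)) * indicator {0..} (s / t)) \<partial>lborel) \<le> ennreal C * ennreal (\<omega>1 s)"
      if s: "0 \<le> s"
    proof -
      have "(\<integral>\<^sup>+t. ennreal (\<phi> t) * (ennreal (\<omega>2 (s / t)) * indicator {0..} (s / t)) \<partial>lborel) \<le>
          (\<integral>\<^sup>+t. ennreal (\<omega>2 (s / t) * \<phi> t) \<partial>lborel)"
        unfolding ennreal_mult''[OF kernel_nonneg]
        by (intro nn_integral_mono) (auto simp: indicator_def mult.commute)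
      also have "\<dots> \<le> ennreal (C * \<omega>1 s)" by (rule kernel_bound[OF s])
      finally show ?thesis using C_nonneg by (simp add: ennreal_mult')
    qed
    then show "(\<integral>\<^sup>+t. ennreal (\<phi> t) * (ennreal (\<omega>2 (s / t)) * indicator {0..} (s / t)) \<partial>lborel) * indicator {0..} s \<le>
        ennreal C * (ennreal (\<omega>1 s) * indicator {0..} s)"
      by (auto simp: indicator_def)
  qed
  also have "\<dots> = ennreal C * (\<integral>\<^sup>+x\<in>{0..}. ennreal (\<omega>1 x) \<partial>m)"
    by (rule nn_integral_cmult) measurable
  finally show ?thesis .
qed

lemma integral_kernel_measure:
  fixes F :: "real \<times> real \<Rightarrow> complex"
  assumes m: "sets m = sets borel" and sf: "sigma_finite_measure m"
    and F: "F \<in> borel_measurable (borel \<Otimes>\<^sub>M borel)"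
    and fin: "(\<integral>\<^sup>+z. ennreal (norm (F z)) \<partial>kernel_measure m) < \<infinity>"
  shows "(LINT z|kernel_measure m. F z) = (LINT s:{0..}|m. LINT t|lborel. F (s, t) * of_real (\<phi> t))"
proof -
  define \<theta> where "\<theta> z = indicator {0..} (fst z) * \<phi> (snd z)" for z :: "real \<times> real"
  have d: "kernel_measure m = density (m \<Otimes>\<^sub>M lborel) \<theta>"
    unfolding kernel_measure_def case_prod_beta \<theta>_def ..
  have \<theta>: "\<theta> \<in> borel_measurable (borel \<Otimes>\<^sub>M borel)" "0 \<le> \<theta> z" for z
    unfolding \<theta>_def using kernel_nonneg by (measurable, simp)
  have "(LINT z|kernel_measure m. F z) = (LINT s|m. LINT t|lborel. \<theta> (s, t) *\<^sub>R F (s, t))"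
    using integral_density_pair_lborel[OF m sf \<theta> F] fin unfolding d by simp
  also have "\<dots> = (LINT s:{0..}|m. LINT t|lborel. F (s, t) * of_real (\<phi> t))"
    unfolding set_lebesgue_integral_def
    by (intro Bochner_Integration.integral_cong refl)
       (auto simp: \<theta>_def indicator_def scaleR_conv_of_real mult.commute)
  finally show ?thesis .
qed

text \<open>
  Fubini's theorem for the kernel measure of \<open>m\<close>.
\<close>

lemma integral_push:
  assumes m [measurable_cong]: "sets m = sets borel" and sf: "sigma_finite_measure m"
    and fin: "(\<integral>\<^sup>+x\<in>{0..}. ennreal (\<omega>1 x) \<partial>m) < \<infinity>" and g: "dominated \<omega>2 g"
  shows "(LINT x:{0..}|push m. g x) = (LINT s:{0..}|m. kernel_average g s)"
proof -
  define g0 where "g0 x = indicator {0..} x *\<^sub>R g x" for x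
  have g0 [measurable]: "g0 \<in> borel_measurable borel" using g by (simp add: dominated_def g0_def[abs_def])
  note [measurable] = weight_nn_measurable[OF w2]
  have s [measurable_cong]: "sets (kernel_measure m) = sets (borel \<Otimes>\<^sub>M borel)"
    unfolding kernel_measure_def by (simp cong: sets_pair_measure_cong add: m)
  obtain K where K: "\<And>x. 0 \<le> x \<Longrightarrow> norm (g x) \<le> K * \<omega>2 x" using g by (auto simp: dominated_def)
  have K0: "0 \<le> K" using dominated_constant_nonneg K .
  have "(\<integral>\<^sup>+z. ennreal (norm (g0 (fst z / snd z))) \<partial>kernel_measure m) = (\<integral>\<^sup>+x. ennreal (norm (g0 x)) \<partial>push m)"
    unfolding push_def case_prod_beta by (subst nn_integral_distr) measurable
  also have "\<dots> \<le> (\<integral>\<^sup>+x. ennreal K * (ennreal (\<omega>2 x) * indicator {0..} x) \<partial>push m)"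
    using K K0 by (intro nn_integral_mono) (auto simp: g0_def indicator_def ennreal_mult'[symmetric] intro!: ennreal_leI)
  also have "\<dots> = ennreal K * (\<integral>\<^sup>+x\<in>{0..}. ennreal (\<omega>2 x) \<partial>push m)"
    by (rule nn_integral_cmult) measurable
  also have "\<dots> < \<infinity>"
    using push_weight_le[OF m] fin by (auto simp: ennreal_mult_less_top intro: le_less_trans)
  finally have f: "(\<integral>\<^sup>+z. ennreal (norm (g0 (fst z / snd z))) \<partial>kernel_measure m) < \<infinity>" .
  have "(LINT x:{0..}|push m. g x) = (LINT x|push m. g0 x)"
    by (simp add: set_lebesgue_integral_def g0_def)
  also have "\<dots> = (LINT z|kernel_measure m. g0 (fst z / snd z))"
    unfolding push_def case_prod_beta by (subst integral_distr) measurable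
  also have "\<dots> = (LINT s:{0..}|m. LINT t|lborel. g0 (s / t) * of_real (\<phi> t))"
    by (subst integral_kernel_measure[OF m sf _ f]) simp_all
  also have "\<dots> = (LINT s:{0..}|m. kernel_average g s)"
    unfolding set_lebesgue_integral_def kernel_average_def
  proof (intro Bochner_Integration.integral_cong refl)
    fix s
    show "indicat_real {0..} s *\<^sub>R (LINT t|lborel. g0 (s / t) * complex_of_real (\<phi> t)) =
        indicat_real {0..} s *\<^sub>R (LINT t|lborel. g (s / t) * complex_of_real (\<phi> t))"
    proof (cases "0 \<le> s")
      case True
      show ?thesis unfolding kernel_restrict[OF True, of g] g0_def ..
    qed simp
  qed
  finally show ?thesis .
qed

definition pushed_pieces :: "(real set \<Rightarrow> complex) \<Rightarrow> ((real \<Rightarrow> complex) \<times> real measure) list" where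
  "pushed_pieces \<mu> = map (\<lambda>c. (\<lambda>_. cnj c, push (rotated_variation \<mu> c))) [1, -1, -\<i>, \<i>]"

text \<open>
  The adjoint on measures, given explicitly by transporting the four Jordan parts.
\<close>

definition pushed_measure :: "(real set \<Rightarrow> complex) \<Rightarrow> real set \<Rightarrow> complex" where
  "pushed_measure \<mu> A = (if A \<in> bdd_borel then pieces_integral (pushed_pieces \<mu>) (indicator A) else 0)"

lemma push_rotated_variation_le:
  assumes \<mu>: "\<mu> \<in> M_space \<omega>1" and c: "norm c = 1"
  shows "(\<integral>\<^sup>+x\<in>{0..}. ennreal (\<omega>2 x) \<partial>push (rotated_variation \<mu> c)) \<le>
    ennreal C * (\<integral>\<^sup>+x\<in>{0..}. ennreal (\<omega>1 x) \<partial>total_variation \<mu>)"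
proof -
  have lf: "locfin_measure \<mu>" using \<mu> by (simp add: M_space_def)
  have "(\<integral>\<^sup>+x\<in>{0..}. ennreal (\<omega>2 x) \<partial>push (rotated_variation \<mu> c)) \<le>
      ennreal C * (\<integral>\<^sup>+x\<in>{0..}. ennreal (\<omega>1 x) \<partial>rotated_variation \<mu> c)"
    by (rule push_weight_le) simp
  also have "\<dots> \<le> ennreal C * (\<integral>\<^sup>+x\<in>{0..}. ennreal (\<omega>1 x) \<partial>total_variation \<mu>)"
    by (intro mult_left_mono nn_integral_rotated_variation_le lf c weight_nn_measurable w1) simp
  finally show ?thesis .
qed

lemma pushed_pieces_represent:
  assumes \<mu>: "\<mu> \<in> M_space \<omega>1"
  shows "represents \<omega>2 (pushed_pieces \<mu>) (pushed_measure \<mu>)"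
proof -
  have "(\<integral>\<^sup>+x\<in>{0..}. ennreal (\<omega>2 x) \<partial>push (rotated_variation \<mu> c)) < top" if "norm c = 1" for c
    using push_rotated_variation_le[OF \<mu> that] \<mu>
    by (auto simp: M_space_def ennreal_mult_less_top intro: le_less_trans)
  then have "admissible \<omega>2 (pushed_pieces \<mu>)"
    by (auto simp: admissible_def pushed_pieces_def)
  then show ?thesis by (simp add: represents_def pushed_measure_def)
qed

lemma pushed_measure_M_space: "\<mu> \<in> M_space \<omega>1 \<Longrightarrow> pushed_measure \<mu> \<in> M_space \<omega>2"
  using represents_M_space[OF w2 pushed_pieces_represent] .

lemma cm_integral_pushed_measure:
  assumes \<mu>: "\<mu> \<in> M_space \<omega>1" and g: "g \<in> C0_space \<omega>2"
  shows "cm_integral (pushed_measure \<mu>) g = cm_integral \<mu> (kernel_average g)"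
proof -
  have lf: "locfin_measure \<mu>" using \<mu> by (simp add: M_space_def)
  have dg: "dominated \<omega>2 g" using g by (rule C0_dominated[OF w2])
  have p: "(LINT x:{0..}|push (rotated_variation \<mu> c). g x) = (LINT x:{0..}|rotated_variation \<mu> c. kernel_average g x)"
    if c: "norm c = 1" for c
  proof (rule integral_push[OF _ rotated_variation_sigma_finite[OF w1 \<mu> c] _ dg])
    show "(\<integral>\<^sup>+x\<in>{0..}. ennreal (\<omega>1 x) \<partial>rotated_variation \<mu> c) < \<infinity>"
      using nn_integral_rotated_variation_le[OF lf c weight_nn_measurable[OF w1]] \<mu>
      by (auto simp: M_space_def intro: le_less_trans)
  qed simp
  have "cm_integral (pushed_measure \<mu>) g = pieces_integral (pushed_pieces \<mu>) g"
    by (rule cm_integral_eq_pieces_integral[OF w2 pushed_measure_M_space[OF \<mu>] pushed_pieces_represent[OF \<mu>] dg])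
  also have "\<dots> = (\<Sum>c\<leftarrow>[1, -1, -\<i>, \<i>]. (LINT x:{0..}|push (rotated_variation \<mu> c). g x) * cnj c)"
    by (simp only: pieces_integral_def pushed_pieces_def map_map comp_def prod.case set_integral_mult_left)
  also have "\<dots> = (\<Sum>c\<leftarrow>[1, -1, -\<i>, \<i>]. (LINT x:{0..}|rotated_variation \<mu> c. kernel_average g x) * cnj c)"
    by (simp add: p)
  also have "\<dots> = cm_integral \<mu> (kernel_average g)"
    by (simp only: cm_integral_jordan_pieces pieces_integral_jordan_pieces)
  finally show ?thesis .
qed

text \<open>
  The factor \<open>4\<close> counts the Jordan parts, each of which is at most \<open>|\<mu>|\<close>.
\<close>

lemma M_norm_pushed_measure_le:
  assumes \<mu>: "\<mu> \<in> M_space \<omega>1"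
  shows "M_norm \<omega>2 (pushed_measure \<mu>) \<le> (4 * C) * M_norm \<omega>1 \<mu>"
proof -
  let ?N = "\<integral>\<^sup>+x\<in>{0..}. ennreal (\<omega>1 x) \<partial>total_variation \<mu>"
  have N: "?N = ennreal (M_norm \<omega>1 \<mu>)" using \<mu> by (simp add: M_space_def M_norm_def)
  have "(\<integral>\<^sup>+x\<in>{0..}. ennreal (\<omega>2 x) \<partial>total_variation (pushed_measure \<mu>)) \<le>
      (\<Sum>c\<leftarrow>[1, -1, -\<i>, \<i>]. \<integral>\<^sup>+x\<in>{0..}. ennreal (\<omega>2 x) \<partial>push (rotated_variation \<mu> c))"
    using represents_total_variation_le[OF w2 pushed_pieces_represent[OF \<mu>]]
    by (simp add: pushed_pieces_def)
  also have "\<dots> \<le> (\<Sum>c\<leftarrow>[1, -1, -\<i>, \<i>]. ennreal C * ?N)"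
    by (intro sum_list_mono push_rotated_variation_le[OF \<mu>]) auto
  also have "\<dots> = ennreal (4 * C * M_norm \<omega>1 \<mu>)"
    unfolding N using C_nonneg by (simp add: ennreal_mult'[symmetric] M_norm_def flip: ennreal_plus)
  finally have "enn2real (\<integral>\<^sup>+x\<in>{0..}. ennreal (\<omega>2 x) \<partial>total_variation (pushed_measure \<mu>)) \<le>
      enn2real (ennreal (4 * C * M_norm \<omega>1 \<mu>))"
    by (rule enn2real_mono) simp
  then show ?thesis using C_nonneg by (simp add: M_norm_def)
qed

section \<open>Duality on functions: dilation averages against kernel averages\<close>

text \<open>
  Since \<open>t \<phi>(t) = \<psi>(t)\<close> almost everywhere on \<open>[0, 1]\<close>, this is the Hardy-Cesaro operator, written with Borel data.
\<close>

definition dilation_average :: "(real \<Rightarrow> complex) \<Rightarrow> real \<Rightarrow> complex" where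
  "dilation_average F x = (LINT t|lborel. F (t * x) * of_real (t * \<phi> t))"

text \<open>
  The kernel measure of Lebesgue measure in the coordinates \<open>(x, t)\<close> with \<open>s = t x\<close>: \<open>\<phi>(t) ds dt = t \<phi>(t) dx dt\<close>.
\<close>

definition dilation_measure :: "(real \<times> real) measure" where
  "dilation_measure =
     density (lborel \<Otimes>\<^sub>M lborel) (\<lambda>z. ennreal (indicator {0..} (fst z) * (snd z * \<phi> (snd z))))"

lemma sets_dilation_measure [measurable_cong]: "sets dilation_measure = sets (borel \<Otimes>\<^sub>M borel)"
  by (simp add: dilation_measure_def cong: sets_pair_measure_cong)

lemma kernel_moment_nonneg: "0 \<le> t * \<phi> t"
  using kernel_nonneg[of t] kernel_support[of t] by (cases "\<phi> t = 0") auto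

lemma dilation_density_measurable [measurable]:
  "(\<lambda>z :: real \<times> real. indicat_real {0..} (fst z) * (snd z * \<phi> (snd z))) \<in> borel_measurable (borel \<Otimes>\<^sub>M borel)"
  by measurable

lemma nn_integral_dilation_measure:
  assumes F [measurable]: "F \<in> borel_measurable (borel \<Otimes>\<^sub>M borel)"
  shows "(\<integral>\<^sup>+z. F z \<partial>dilation_measure) = (\<integral>\<^sup>+x\<in>{0..}. (\<integral>\<^sup>+t. ennreal (t * \<phi> t) * F (x, t) \<partial>lborel) \<partial>lborel)"
proof -
  have "(\<integral>\<^sup>+z. F z \<partial>dilation_measure) =
      (\<integral>\<^sup>+z. ennreal (indicator {0..} (fst z) * (snd z * \<phi> (snd z))) * F z \<partial>(lborel \<Otimes>\<^sub>M lborel))"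
    unfolding dilation_measure_def by (subst nn_integral_density) simp_all
  also have "\<dots> = (\<integral>\<^sup>+x. \<integral>\<^sup>+t. ennreal (indicator {0..} x * (t * \<phi> t)) * F (x, t) \<partial>lborel \<partial>lborel)"
    by (subst lborel.nn_integral_fst[symmetric]) simp_all
  also have "\<dots> = (\<integral>\<^sup>+x\<in>{0..}. (\<integral>\<^sup>+t. ennreal (t * \<phi> t) * F (x, t) \<partial>lborel) \<partial>lborel)"
    by (intro nn_integral_cong) (auto simp: indicator_def)
  finally show ?thesis .
qed

text \<open>
  The substitution \<open>s = t x\<close> for fixed \<open>t\<close>. As an equality of measures it serves the norm estimate and the
  pairing identity alike.
\<close>

lemma kernel_measure_lborel:
  "kernel_measure lborel = distr dilation_measure (borel \<Otimes>\<^sub>M borel) (\<lambda>z. (snd z * fst z, snd z))"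
proof (rule measure_eqI)
  show sets: "sets (kernel_measure lborel) = sets (distr dilation_measure (borel \<Otimes>\<^sub>M borel) (\<lambda>z. (snd z * fst z, snd z)))"
    by (simp add: kernel_measure_def cong: sets_pair_measure_cong)
  fix A assume "A \<in> sets (kernel_measure lborel)"
  then have A [measurable]: "A \<in> sets (borel \<Otimes>\<^sub>M borel)" unfolding sets by simp
  have "emeasure (distr dilation_measure (borel \<Otimes>\<^sub>M borel) (\<lambda>z. (snd z * fst z, snd z))) A =
      (\<integral>\<^sup>+z. indicator A z \<partial>distr dilation_measure (borel \<Otimes>\<^sub>M borel) (\<lambda>z. (snd z * fst z, snd z)))"
    by simp
  also have "\<dots> = (\<integral>\<^sup>+z. indicator A (snd z * fst z, snd z) \<partial>dilation_measure)"
    by (rule nn_integral_distr) measurable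
  also have "\<dots> = (\<integral>\<^sup>+x. \<integral>\<^sup>+t. ennreal (t * \<phi> t) * indicator A (t * x, t) * indicator {0..} x \<partial>lborel \<partial>lborel)"
    by (subst nn_integral_dilation_measure) (simp_all add: nn_integral_multc)
  also have "\<dots> = (\<integral>\<^sup>+t. \<integral>\<^sup>+x. ennreal (t * \<phi> t) * indicator A (t * x, t) * indicator {0..} x \<partial>lborel \<partial>lborel)"
    by (rule lborel_pair.Fubini') simp
  also have "\<dots> = (\<integral>\<^sup>+t. \<integral>\<^sup>+s. ennreal (\<phi> t) * indicator A (s, t) * indicator {0..} s \<partial>lborel \<partial>lborel)"
  proof (rule nn_integral_cong)
    fix t
    show "(\<integral>\<^sup>+x. ennreal (t * \<phi> t) * indicator A (t * x, t) * indicator {0..} x \<partial>lborel) =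
        (\<integral>\<^sup>+s. ennreal (\<phi> t) * indicator A (s, t) * indicator {0..} s \<partial>lborel)"
    proof (cases "\<phi> t = 0")
      case False
      then have t: "0 < t" using kernel_support[of t] by simp
      have "(\<integral>\<^sup>+s. ennreal (\<phi> t) * indicator A (s, t) * indicator {0..} s \<partial>lborel) =
          ennreal \<bar>t\<bar> * (\<integral>\<^sup>+x. ennreal (\<phi> t) * indicator A (0 + t * x, t) * indicator {0..} (0 + t * x) \<partial>lborel)"
        using t by (intro nn_integral_real_affine) simp_all
      also have "\<dots> = (\<integral>\<^sup>+x. ennreal \<bar>t\<bar> * (ennreal (\<phi> t) * indicator A (0 + t * x, t) * indicator {0..} (0 + t * x)) \<partial>lborel)"
        by (rule nn_integral_cmult[symmetric]) simp
      also have "\<dots> = (\<integral>\<^sup>+x. ennreal (t * \<phi> t) * indicator A (t * x, t) * indicator {0..} x \<partial>lborel)"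
        using t by (intro nn_integral_cong) (auto simp: indicator_def ennreal_mult' zero_le_mult_iff)
      finally show ?thesis by simp
    qed simp
  qed
  also have "\<dots> = (\<integral>\<^sup>+s. \<integral>\<^sup>+t. ennreal (\<phi> t) * indicator A (s, t) * indicator {0..} s \<partial>lborel \<partial>lborel)"
    by (rule lborel_pair.Fubini'[symmetric]) simp
  also have "\<dots> = (\<integral>\<^sup>+z. indicator A z \<partial>kernel_measure lborel)"
    by (subst nn_integral_kernel_measure) (simp_all add: nn_integral_multc)
  also have "\<dots> = emeasure (kernel_measure lborel) A"
    using A by (intro nn_integral_indicator) (simp add: sets)
  finally show "emeasure (kernel_measure lborel) A =
      emeasure (distr dilation_measure (borel \<Otimes>\<^sub>M borel) (\<lambda>z. (snd z * fst z, snd z))) A" ..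
qed

lemma dilation_average_measurable [measurable]:
  assumes [measurable]: "F \<in> borel_measurable borel" shows "dilation_average F \<in> borel_measurable borel"
  unfolding dilation_average_def[abs_def] by measurable

text \<open>
  Both sides are compared through the integral of \<open>|F s| * \<omega>2 (s / t)\<close> against the kernel measure.
\<close>

lemma dilation_average_nn_bound:
  fixes F :: "real \<Rightarrow> complex"
  assumes F [measurable]: "F \<in> borel_measurable borel"
  shows "(\<integral>\<^sup>+x\<in>{0..}. (\<integral>\<^sup>+t. ennreal (norm (F (t * x) * of_real (t * \<phi> t))) \<partial>lborel) * ennreal (\<omega>2 x) \<partial>lborel) \<le>
    ennreal C * (\<integral>\<^sup>+s\<in>{0..}. ennreal (\<omega>1 s * norm (F s)) \<partial>lborel)"
proof -
  note [measurable] = weight_nn_measurable[OF w2] weight_nn_measurable[OF w1]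
  define w where "w x = ennreal (\<omega>2 x) * indicator {0..} x" for x
  have w [measurable]: "w \<in> borel_measurable borel" unfolding w_def by measurable
  have "(\<integral>\<^sup>+x\<in>{0..}. (\<integral>\<^sup>+t. ennreal (norm (F (t * x) * of_real (t * \<phi> t))) \<partial>lborel) * ennreal (\<omega>2 x) \<partial>lborel) =
      (\<integral>\<^sup>+x\<in>{0..}. (\<integral>\<^sup>+t. ennreal (t * \<phi> t) * (ennreal (norm (F (t * x))) * w (t * x / t)) \<partial>lborel) \<partial>lborel)"
  proof (rule nn_integral_cong)
    fix x :: real
    show "(\<integral>\<^sup>+t. ennreal (norm (F (t * x) * of_real (t * \<phi> t))) \<partial>lborel) * ennreal (\<omega>2 x) * indicator {0..} x =
        (\<integral>\<^sup>+t. ennreal (t * \<phi> t) * (ennreal (norm (F (t * x))) * w (t * x / t)) \<partial>lborel) * indicator {0..} x"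
    proof (cases "0 \<le> x")
      case True
      have "(\<integral>\<^sup>+t. ennreal (norm (F (t * x) * of_real (t * \<phi> t))) \<partial>lborel) * ennreal (\<omega>2 x) =
          (\<integral>\<^sup>+t. ennreal (norm (F (t * x) * of_real (t * \<phi> t))) * ennreal (\<omega>2 x) \<partial>lborel)"
        by (rule nn_integral_multc[symmetric]) measurable
      also have "\<dots> = (\<integral>\<^sup>+t. ennreal (t * \<phi> t) * (ennreal (norm (F (t * x))) * w (t * x / t)) \<partial>lborel)"
      proof (rule nn_integral_cong)
        fix t
        have "ennreal (norm (F (t * x) * of_real (t * \<phi> t))) = ennreal (t * \<phi> t) * ennreal (norm (F (t * x)))"
          using kernel_moment_nonneg[of t]
          unfolding norm_mult norm_of_real by (simp add: abs_mult[symmetric] ennreal_mult' mult.commute del: abs_mult)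
        then show "ennreal (norm (F (t * x) * of_real (t * \<phi> t))) * ennreal (\<omega>2 x) =
            ennreal (t * \<phi> t) * (ennreal (norm (F (t * x))) * w (t * x / t))"
          using True by (cases "t = 0") (auto simp: w_def mult.assoc)
      qed
      finally show ?thesis using True by simp
    qed simp
  qed
  also have "\<dots> = (\<integral>\<^sup>+z. ennreal (norm (F (snd z * fst z))) * w (snd z * fst z / snd z) \<partial>dilation_measure)"
    by (subst nn_integral_dilation_measure) simp_all
  also have "\<dots> = (\<integral>\<^sup>+z. ennreal (norm (F (fst z))) * w (fst z / snd z) \<partial>kernel_measure lborel)"
    unfolding kernel_measure_lborel by (subst nn_integral_distr) simp_all
  also have "\<dots> = (\<integral>\<^sup>+s\<in>{0..}. (\<integral>\<^sup>+t. ennreal (\<phi> t) * (ennreal (norm (F s)) * w (s / t)) \<partial>lborel) \<partial>lborel)"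
    by (subst nn_integral_kernel_measure) simp_all
  also have "\<dots> \<le> (\<integral>\<^sup>+s. ennreal C * (ennreal (\<omega>1 s * norm (F s)) * indicator {0..} s) \<partial>lborel)"
  proof (rule nn_integral_mono)
    fix s :: real
    show "(\<integral>\<^sup>+t. ennreal (\<phi> t) * (ennreal (norm (F s)) * w (s / t)) \<partial>lborel) * indicator {0..} s \<le>
        ennreal C * (ennreal (\<omega>1 s * norm (F s)) * indicator {0..} s)"
    proof (cases "0 \<le> s")
      case True
      have "(\<integral>\<^sup>+t. ennreal (\<phi> t) * (ennreal (norm (F s)) * w (s / t)) \<partial>lborel) =
          (\<integral>\<^sup>+t. ennreal (norm (F s)) * (ennreal (\<phi> t) * w (s / t)) \<partial>lborel)"
        by (simp add: mult.left_commute)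
      also have "\<dots> = ennreal (norm (F s)) * (\<integral>\<^sup>+t. ennreal (\<phi> t) * w (s / t) \<partial>lborel)"
        by (rule nn_integral_cmult) measurable
      also have "\<dots> \<le> ennreal (norm (F s)) * ennreal (C * \<omega>1 s)"
      proof (rule mult_left_mono)
        have "(\<integral>\<^sup>+t. ennreal (\<phi> t) * w (s / t) \<partial>lborel) \<le> (\<integral>\<^sup>+t. ennreal (\<omega>2 (s / t) * \<phi> t) \<partial>lborel)"
          unfolding ennreal_mult''[OF kernel_nonneg]
          by (intro nn_integral_mono) (auto simp: w_def indicator_def mult.commute)
        also have "\<dots> \<le> ennreal (C * \<omega>1 s)" by (rule kernel_bound[OF True])
        finally show "(\<integral>\<^sup>+t. ennreal (\<phi> t) * w (s / t) \<partial>lborel) \<le> ennreal (C * \<omega>1 s)" .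
      qed simp
      also have "\<dots> = ennreal C * ennreal (\<omega>1 s * norm (F s))"
        using C_nonneg by (simp add: ennreal_mult'[symmetric] ac_simps)
      finally show ?thesis using True by simp
    qed simp
  qed
  also have "\<dots> = ennreal C * (\<integral>\<^sup>+s\<in>{0..}. ennreal (\<omega>1 s * norm (F s)) \<partial>lborel)"
  proof (rule nn_integral_cmult)
    have "(\<lambda>s. (ennreal (\<omega>1 s) * indicator {0..} s) * ennreal (norm (F s))) \<in> borel_measurable lborel"
      by measurable
    then show "(\<lambda>s. ennreal (\<omega>1 s * norm (F s)) * indicator {0..} s) \<in> borel_measurable lborel"
      by (simp add: ennreal_mult'' mult.assoc mult.commute mult.left_commute)
  qed
  finally show ?thesis .
qed

text \<open>
  The norm estimate gives more than a finite norm of the average: the double integral of absolute values is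
  finite, so almost every inner integral converges absolutely.
\<close>

lemma dilation_average_integrable_AE:
  fixes F :: "real \<Rightarrow> complex"
  assumes F [measurable]: "F \<in> borel_measurable borel"
    and fin: "(\<integral>\<^sup>+s\<in>{0..}. ennreal (\<omega>1 s * norm (F s)) \<partial>lborel) < \<infinity>"
  shows "AE x in lborel. x \<in> {0..} \<longrightarrow> integrable lborel (\<lambda>t. F (t * x) * of_real (t * \<phi> t))"
proof -
  note [measurable] = weight_nn_measurable[OF w2]
  have m: "(\<lambda>x. (\<integral>\<^sup>+t. ennreal (norm (F (t * x) * of_real (t * \<phi> t))) \<partial>lborel) * ennreal (\<omega>2 x) * indicator {0..} x)
      \<in> borel_measurable lborel"
  proof -
    have "(\<lambda>x. (\<integral>\<^sup>+t. ennreal (norm (F (t * x) * of_real (t * \<phi> t))) \<partial>lborel) * (ennreal (\<omega>2 x) * indicator {0..} x))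
      \<in> borel_measurable lborel" by measurable
    then show ?thesis by (simp add: mult.assoc)
  qed
  have "(\<integral>\<^sup>+x\<in>{0..}. (\<integral>\<^sup>+t. ennreal (norm (F (t * x) * of_real (t * \<phi> t))) \<partial>lborel) * ennreal (\<omega>2 x) \<partial>lborel) < \<infinity>"
    by (rule le_less_trans[OF dilation_average_nn_bound[OF F]]) (use fin in \<open>simp add: ennreal_mult_less_top\<close>)
  from nn_integral_PInf_AE[OF m less_imp_neq[OF this]] show ?thesis
  proof eventually_elim
    fix x :: real
    assume *: "(\<integral>\<^sup>+t. ennreal (norm (F (t * x) * of_real (t * \<phi> t))) \<partial>lborel) * ennreal (\<omega>2 x) * indicator {0..} x \<noteq> \<infinity>"
    show "x \<in> {0..} \<longrightarrow> integrable lborel (\<lambda>t. F (t * x) * of_real (t * \<phi> t))"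
    proof
      assume x: "x \<in> {0..}"
      then have "ennreal (\<omega>2 x) \<noteq> 0" using w2_pos[of x] by simp
      then have "(\<integral>\<^sup>+t. ennreal (norm (F (t * x) * of_real (t * \<phi> t))) \<partial>lborel) < \<infinity>"
        using * x by (auto simp: ennreal_mult_eq_top_iff less_top)
      then show "integrable lborel (\<lambda>t. F (t * x) * of_real (t * \<phi> t))"
        by (intro integrableI_bounded) simp_all
    qed
  qed
qed

lemma dilation_average_L1_bound:
  assumes F [measurable]: "F \<in> borel_measurable borel"
  shows "(\<integral>\<^sup>+x\<in>{0..}. ennreal (\<omega>2 x * norm (dilation_average F x)) \<partial>lborel) \<le>
    ennreal C * (\<integral>\<^sup>+s\<in>{0..}. ennreal (\<omega>1 s * norm (F s)) \<partial>lborel)"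
proof -
  have "ennreal (norm (dilation_average F x)) \<le> (\<integral>\<^sup>+t. ennreal (norm (F (t * x) * of_real (t * \<phi> t))) \<partial>lborel)" for x
  proof (cases "integrable lborel (\<lambda>t. F (t * x) * of_real (t * \<phi> t))")
    case True then show ?thesis unfolding dilation_average_def by (rule integral_norm_bound_ennreal)
  next
    case False then show ?thesis unfolding dilation_average_def by (simp add: not_integrable_integral_eq)
  qed
  then have "(\<integral>\<^sup>+x\<in>{0..}. ennreal (\<omega>2 x * norm (dilation_average F x)) \<partial>lborel) \<le>
      (\<integral>\<^sup>+x\<in>{0..}. (\<integral>\<^sup>+t. ennreal (norm (F (t * x) * of_real (t * \<phi> t))) \<partial>lborel) * ennreal (\<omega>2 x) \<partial>lborel)"
    by (intro nn_integral_mono mult_right_mono) (auto simp: ennreal_mult'' mult.commute intro: mult_left_mono)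
  then show ?thesis using dilation_average_nn_bound[OF F] by (rule order_trans)
qed

text \<open>
  Both sides are iterated integrals of \<open>F s * g (s / t)\<close>, once in the coordinates \<open>(x, t)\<close> and once in \<open>(s, t)\<close>.
\<close>

lemma dilation_average_pairing:
  assumes F [measurable]: "F \<in> borel_measurable borel"
    and fin: "(\<integral>\<^sup>+s\<in>{0..}. ennreal (\<omega>1 s * norm (F s)) \<partial>lborel) < \<infinity>"
    and g: "dominated \<omega>2 g"
  shows "(LINT x:{0..}|lborel. dilation_average F x * g x) = (LINT s:{0..}|lborel. F s * kernel_average g s)"
proof -
  define g0 where "g0 x = indicator {0..} x *\<^sub>R g x" for x
  have g0 [measurable]: "g0 \<in> borel_measurable borel" using g by (simp add: dominated_def g0_def[abs_def])
  obtain K where K: "\<And>x. 0 \<le> x \<Longrightarrow> norm (g x) \<le> K * \<omega>2 x" using g by (auto simp: dominated_def)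
  have K0: "0 \<le> K" using dominated_constant_nonneg K .
  note [measurable] = weight_nn_measurable[OF w1]
  define H where "H z = F (fst z) * g0 (fst z / snd z)" for z
  have H [measurable]: "H \<in> borel_measurable (borel \<Otimes>\<^sub>M borel)" unfolding H_def by measurable
  have "(\<integral>\<^sup>+z. ennreal (norm (H z)) \<partial>kernel_measure lborel) =
      (\<integral>\<^sup>+s\<in>{0..}. (\<integral>\<^sup>+t. ennreal (\<phi> t) * ennreal (norm (H (s, t))) \<partial>lborel) \<partial>lborel)"
    by (subst nn_integral_kernel_measure) simp_all
  also have "\<dots> \<le> (\<integral>\<^sup>+s. ennreal (K * C) * (ennreal (\<omega>1 s * norm (F s)) * indicator {0..} s) \<partial>lborel)"
  proof (rule nn_integral_mono)
    fix s :: real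
    show "(\<integral>\<^sup>+t. ennreal (\<phi> t) * ennreal (norm (H (s, t))) \<partial>lborel) * indicator {0..} s \<le>
        ennreal (K * C) * (ennreal (\<omega>1 s * norm (F s)) * indicator {0..} s)"
    proof (cases "0 \<le> s")
      case True
      have "(\<integral>\<^sup>+t. ennreal (\<phi> t) * ennreal (norm (H (s, t))) \<partial>lborel) =
          (\<integral>\<^sup>+t. ennreal (norm (F s)) * ennreal (norm (g0 (s / t) * of_real (\<phi> t))) \<partial>lborel)"
        using kernel_nonneg
        by (intro nn_integral_cong) (simp add: H_def norm_mult ennreal_mult'' mult.commute mult.left_commute)
      also have "\<dots> = ennreal (norm (F s)) * (\<integral>\<^sup>+t. ennreal (norm (g0 (s / t) * of_real (\<phi> t))) \<partial>lborel)"
        by (rule nn_integral_cmult) measurable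
      also have "\<dots> \<le> ennreal (norm (F s)) * ennreal (K * (C * \<omega>1 s))"
        using True K by (intro mult_left_mono kernel_average_nn_bound) (auto simp: g0_def)
      also have "\<dots> = ennreal (K * C) * ennreal (\<omega>1 s * norm (F s))"
        using K0 C_nonneg by (simp add: ennreal_mult'[symmetric] ac_simps)
      finally show ?thesis using True by simp
    qed simp
  qed
  also have "\<dots> = ennreal (K * C) * (\<integral>\<^sup>+s\<in>{0..}. ennreal (\<omega>1 s * norm (F s)) \<partial>lborel)"
  proof (rule nn_integral_cmult)
    have "(\<lambda>s. (ennreal (\<omega>1 s) * indicator {0..} s) * ennreal (norm (F s))) \<in> borel_measurable lborel"
      by measurable
    then show "(\<lambda>s. ennreal (\<omega>1 s * norm (F s)) * indicator {0..} s) \<in> borel_measurable lborel"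
      by (simp add: ennreal_mult'' mult.assoc mult.commute mult.left_commute)
  qed
  also have "\<dots> < \<infinity>" using fin by (simp add: ennreal_mult_less_top)
  finally have f: "(\<integral>\<^sup>+z. ennreal (norm (H z)) \<partial>kernel_measure lborel) < \<infinity>" .
  define T :: "real \<times> real \<Rightarrow> real \<times> real" where "T z = (snd z * fst z, snd z)" for z
  have T [measurable]: "T \<in> (borel \<Otimes>\<^sub>M borel) \<rightarrow>\<^sub>M (borel \<Otimes>\<^sub>M borel)" unfolding T_def by measurable
  have KT: "kernel_measure lborel = distr dilation_measure (borel \<Otimes>\<^sub>M borel) T"
    unfolding kernel_measure_lborel T_def ..
  have f': "(\<integral>\<^sup>+z. ennreal (norm (H (T z))) \<partial>dilation_measure) < \<infinity>"
    using f unfolding KT by (subst (asm) nn_integral_distr) simp_all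
  have "(LINT s:{0..}|lborel. F s * kernel_average g s) = (LINT s:{0..}|lborel. LINT t|lborel. H (s, t) * of_real (\<phi> t))"
    unfolding set_lebesgue_integral_def
  proof (intro Bochner_Integration.integral_cong refl)
    fix s :: real
    have "F s * kernel_average g s = (LINT t|lborel. H (s, t) * of_real (\<phi> t))" if "0 \<le> s"
      unfolding kernel_average_def kernel_restrict[OF that, of g]
      by (subst integral_mult_right_zero[symmetric]) (simp add: H_def g0_def mult.assoc)
    then show "indicat_real {0..} s *\<^sub>R (F s * kernel_average g s) =
        indicat_real {0..} s *\<^sub>R (LINT t|lborel. H (s, t) * of_real (\<phi> t))"
      by (auto simp: indicator_def)
  qed
  also have "\<dots> = (LINT z|kernel_measure lborel. H z)"
    by (rule integral_kernel_measure[OF _ _ H f, symmetric]) (simp_all add: lborel.sigma_finite_measure_axioms)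
  also have "\<dots> = (LINT z|dilation_measure. H (T z))"
    unfolding KT by (rule integral_distr) measurable
  also have "\<dots> = (LINT x|lborel. LINT t|lborel. (indicator {0..} x * (t * \<phi> t)) *\<^sub>R H (T (x, t)))"
    using integral_density_pair_lborel[OF _ lborel.sigma_finite_measure_axioms dilation_density_measurable, of "H \<circ> T"]
      f' kernel_moment_nonneg by (simp add: dilation_measure_def)
  also have "\<dots> = (LINT x:{0..}|lborel. dilation_average F x * g x)"
    unfolding set_lebesgue_integral_def
  proof (intro Bochner_Integration.integral_cong refl)
    fix x :: real
    show "(LINT t|lborel. (indicator {0..} x * (t * \<phi> t)) *\<^sub>R H (T (x, t))) =
        indicat_real {0..} x *\<^sub>R (dilation_average F x * g x)"
    proof (cases "0 \<le> x")
      case True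
      have "(LINT t|lborel. (indicator {0..} x * (t * \<phi> t)) *\<^sub>R H (T (x, t))) =
          (LINT t|lborel. (F (t * x) * of_real (t * \<phi> t)) * g x)"
      proof (intro Bochner_Integration.integral_cong refl)
        fix t
        show "(indicator {0..} x * (t * \<phi> t)) *\<^sub>R H (T (x, t)) = (F (t * x) * of_real (t * \<phi> t)) * g x"
          using True by (cases "t = 0") (simp_all add: H_def T_def g0_def scaleR_conv_of_real)
      qed
      also have "\<dots> = dilation_average F x * g x" unfolding dilation_average_def by (rule integral_mult_left_zero)
      finally show ?thesis using True by simp
    qed simp
  qed
  finally show ?thesis ..
qed

end

section \<open>Borel representatives and the spaces of functions\<close>

text \<open>
  Composing a Lebesgue measurable function with a Borel map can destroy measurability. The integrands
  \<open>f (t * x)\<close> on the plane are therefore formed with a Borel function that equals \<open>f\<close> almost everywhere on \<open>S\<close>.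
\<close>

definition borel_rep :: "real set \<Rightarrow> (real \<Rightarrow> 'a::euclidean_space) \<Rightarrow> (real \<Rightarrow> 'a) \<Rightarrow> bool" where
  "borel_rep S f f' \<longleftrightarrow> f' \<in> borel_measurable borel \<and> (AE x in lborel. x \<in> S \<longrightarrow> f x = f' x)"

lemma AE_lebesgue_on_iff:
  "S \<in> sets borel \<Longrightarrow> (AE x in lebesgue_on S. P x) \<longleftrightarrow> (AE x in lborel. x \<in> S \<longrightarrow> P x)"
  by (subst AE_restrict_space_iff) (auto simp: AE_completion_iff)

lemma borel_rep_ex_real:
  fixes f :: "real \<Rightarrow> real"
  assumes "f \<in> borel_measurable (lebesgue_on S)" "S \<in> sets borel"
  shows "\<exists>f'. borel_rep S f f'"
proof -
  have "(\<lambda>x. if x \<in> S then f x else 0) \<in> borel_measurable lebesgue"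
    using assms by (intro borel_measurable_if_I) auto
  from completion_ex_borel_measurable_real[OF this] obtain f'
    where f': "f' \<in> borel_measurable lborel" "AE x in lborel. (if x \<in> S then f x else 0) = f' x" by blast
  from f'(2) have "AE x in lborel. x \<in> S \<longrightarrow> f x = f' x" by eventually_elim auto
  then show ?thesis using f'(1) by (auto simp: borel_rep_def)
qed

lemma borel_rep_ex_complex:
  fixes f :: "real \<Rightarrow> complex"
  assumes f [measurable]: "f \<in> borel_measurable (lebesgue_on S)" and S: "S \<in> sets borel"
  shows "\<exists>f'. borel_rep S f f'"
proof -
  have "(\<lambda>x. Re (f x)) \<in> borel_measurable (lebesgue_on S)" "(\<lambda>x. Im (f x)) \<in> borel_measurable (lebesgue_on S)"
    by measurable
  then obtain r i where r: "borel_rep S (\<lambda>x. Re (f x)) r" and i: "borel_rep S (\<lambda>x. Im (f x)) i"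
    using borel_rep_ex_real[OF _ S] by metis
  have "AE x in lborel. x \<in> S \<longrightarrow> Re (f x) = r x" "AE x in lborel. x \<in> S \<longrightarrow> Im (f x) = i x"
    using r i by (auto simp: borel_rep_def)
  then have "AE x in lborel. x \<in> S \<longrightarrow> f x = of_real (r x) + \<i> * of_real (i x)"
    by eventually_elim (auto simp: complex_eq_iff)
  moreover have "(\<lambda>x. of_real (r x) + \<i> * of_real (i x)) \<in> borel_measurable borel"
  proof -
    have [measurable]: "r \<in> borel_measurable borel" "i \<in> borel_measurable borel"
      using r i by (auto simp: borel_rep_def)
    show ?thesis by measurable
  qed
  ultimately show ?thesis by (auto simp: borel_rep_def)
qed

lemma borel_rep_measurable:
  assumes "borel_rep S f f'" and S: "S \<in> sets borel"
  shows "f \<in> borel_measurable (lebesgue_on S)"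
proof (rule borel_measurable_if_D)
  have f' [measurable]: "f' \<in> borel_measurable borel" and ae: "AE x in lborel. x \<in> S \<longrightarrow> f x = f' x"
    using assms(1) by (auto simp: borel_rep_def)
  note [measurable] = S
  have "(\<lambda>x. if x \<in> S then f' x else 0) \<in> borel_measurable lborel" by measurable
  then have "(\<lambda>x. if x \<in> S then f' x else 0) \<in> borel_measurable lebesgue" by (rule measurable_completion)
  moreover have "AE x in lebesgue. (if x \<in> S then f' x else 0) = (if x \<in> S then f x else 0)"
    unfolding AE_completion_iff using ae by eventually_elim auto
  ultimately show "(\<lambda>x. if x \<in> S then f x else 0) \<in> borel_measurable lebesgue"
    by (rule borel_measurable_AE)
qed

lemma borel_rep_integral:
  fixes f :: "real \<Rightarrow> 'a::euclidean_space"
  assumes f: "borel_rep S f f'" and S: "S \<in> sets borel"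
  shows "(LINT x|lebesgue_on S. f x) = (LINT x:S|lborel. f' x)"
proof -
  have f' [measurable]: "f' \<in> borel_measurable borel" and ae: "AE x in lborel. x \<in> S \<longrightarrow> f x = f' x"
    using f by (auto simp: borel_rep_def)
  note [measurable] = S
  have m: "(\<lambda>x. indicator S x *\<^sub>R f' x) \<in> borel_measurable lborel" by measurable
  have "(LINT x|lebesgue_on S. f x) = (LINT x|lebesgue. indicator S x *\<^sub>R f x)"
    using S by (intro integral_restrict_space) auto
  also have "\<dots> = (LINT x|lebesgue. indicator S x *\<^sub>R f' x)"
  proof (rule integral_cong_AE)
    have "(\<lambda>x. if x \<in> S then f x else 0) \<in> borel_measurable lebesgue"
      using borel_rep_measurable[OF f S] S by (intro borel_measurable_if_I) auto
    also have "(\<lambda>x. if x \<in> S then f x else 0) = (\<lambda>x. indicator S x *\<^sub>R f x)" by (auto simp: indicator_def)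
    finally show "(\<lambda>x. indicator S x *\<^sub>R f x) \<in> borel_measurable lebesgue" .
    show "(\<lambda>x. indicator S x *\<^sub>R f' x) \<in> borel_measurable lebesgue" using m by (rule measurable_completion)
    show "AE x in lebesgue. indicator S x *\<^sub>R f x = indicator S x *\<^sub>R f' x"
      unfolding AE_completion_iff using ae by eventually_elim (auto simp: indicator_def)
  qed
  also have "\<dots> = (LINT x|lborel. indicator S x *\<^sub>R f' x)" using m by (rule integral_completion)
  finally show ?thesis by (simp add: set_lebesgue_integral_def)
qed

lemma nn_integral_lebesgue_on:
  assumes S: "S \<in> sets borel" and ae: "AE x in lborel. x \<in> S \<longrightarrow> G x = G' x"
  shows "(\<integral>\<^sup>+x. G x \<partial>lebesgue_on S) = (\<integral>\<^sup>+x\<in>S. G' x \<partial>lborel)"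
proof -
  have "(\<integral>\<^sup>+x. G x \<partial>lebesgue_on S) = (\<integral>\<^sup>+x\<in>S. G x \<partial>lborel)"
    using S by (simp add: nn_integral_restrict_space nn_integral_completion)
  also have "\<dots> = (\<integral>\<^sup>+x\<in>S. G' x \<partial>lborel)"
    using ae by (intro nn_integral_cong_AE) (auto elim!: eventually_mono simp: indicator_def)
  finally show ?thesis .
qed

lemma borel_rep_add: "borel_rep S f f' \<Longrightarrow> borel_rep S g g' \<Longrightarrow> borel_rep S (\<lambda>x. f x + g x) (\<lambda>x. f' x + g' x)"
  unfolding borel_rep_def by (auto elim: eventually_elim2)

lemma weight_lebesgue_measurable: "weight \<omega> \<Longrightarrow> \<omega> \<in> borel_measurable (lebesgue_on {0..})"
  by (intro continuous_imp_measurable_on_sets_lebesgue) (auto simp: weight_def)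

lemma L1_space_borel_rep:
  fixes f :: "real \<Rightarrow> complex"
  assumes w: "weight \<omega>" and f: "borel_rep {0..} f f'"
  defines "N \<equiv> \<integral>\<^sup>+x\<in>{0..}. ennreal (\<omega> x * norm (f' x)) \<partial>lborel"
  shows "f \<in> L1_space \<omega> \<longleftrightarrow> N < \<infinity>" and "L1_norm \<omega> f = enn2real N"
proof -
  have m: "f \<in> borel_measurable (lebesgue_on {0..})" by (rule borel_rep_measurable[OF f]) simp
  note [measurable] = m weight_lebesgue_measurable[OF w]
  have mm: "(\<lambda>t. norm (f t) * \<omega> t) \<in> borel_measurable (lebesgue_on {0..})" by measurable
  have ae: "AE x in lborel. x \<in> {0..} \<longrightarrow> f x = f' x" using f by (simp add: borel_rep_def)
  have N: "(\<integral>\<^sup>+x. ennreal (norm (f x) * \<omega> x) \<partial>lebesgue_on {0..}) = N"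
    unfolding N_def
  proof (rule nn_integral_lebesgue_on)
    show "AE x in lborel. x \<in> {0..} \<longrightarrow> ennreal (norm (f x) * \<omega> x) = ennreal (\<omega> x * norm (f' x))"
      using ae by eventually_elim (simp add: mult.commute)
  qed simp
  have nn: "0 \<le> norm (f x) * \<omega> x" if "x \<in> space (lebesgue_on {0..})" for x
    using w that by (simp add: weight_def less_imp_le)
  have "(\<integral>\<^sup>+x. ennreal (norm (norm (f x) * \<omega> x)) \<partial>lebesgue_on {0..}) = N"
    unfolding N[symmetric] using nn by (intro nn_integral_cong) simp
  then show "f \<in> L1_space \<omega> \<longleftrightarrow> N < \<infinity>" using m mm by (simp add: L1_space_def integrable_iff_bounded)
  show "L1_norm \<omega> f = enn2real N"
    unfolding L1_norm_def N[symmetric] using mm nn by (intro integral_eq_nn_integral AE_I2) auto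
qed

lemma L1_norm_AE_zero:
  assumes "AE x in lborel. x \<in> {0..} \<longrightarrow> h x = 0" shows "L1_norm \<omega> h = 0"
  unfolding L1_norm_def
proof (rule integral_eq_zero_AE)
  show "AE t in lebesgue_on {0..}. norm (h t) * \<omega> t = 0"
    using assms by (subst AE_lebesgue_on_iff) (auto elim: eventually_mono)
qed

text \<open>
  A closed set that contains almost every point of \<open>(0, \<infinity>)\<close> contains \<open>(0, \<infinity>)\<close>, and then its closure.
\<close>

lemma AE_half_line_closed:
  fixes P :: "real \<Rightarrow> bool"
  assumes ae: "AE x in lebesgue_on {0..}. P x" and cl: "closed {x \<in> {0..}. P x}" and x: "0 \<le> x"
  shows "P x"
proof -
  let ?C = "{x \<in> {0..}. P x}"
  have "AE x in lebesgue. x \<in> {0<..} \<longrightarrow> x \<in> ?C"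
    using ae by (subst (asm) AE_restrict_space_iff) (auto elim: eventually_mono)
  then have "{0<..} \<subseteq> ?C"
    using mem_closed_if_AE_lebesgue_open[OF open_greaterThan cl] by (intro subsetI)
  then have "closure {0<..} \<subseteq> ?C" using cl by (rule closure_minimal)
  then show ?thesis using x by auto
qed

lemma Linf_quotient_measurable:
  assumes w: "weight \<omega>" and h: "h \<in> borel_measurable (lebesgue_on {0..})"
  shows "(\<lambda>t. ennreal (norm (h t) / \<omega> t)) \<in> borel_measurable (lebesgue_on {0..})"
proof -
  note [measurable] = h weight_lebesgue_measurable[OF w]
  show ?thesis by measurable
qed

lemma Linf_AE_le:
  assumes w: "weight \<omega>" and h: "h \<in> Linf_space \<omega>"
  shows "AE t in lebesgue_on {0..}. norm (h t) \<le> Linf_norm \<omega> h * \<omega> t"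
proof -
  have e: "Linf_esssup \<omega> h = ennreal (Linf_norm \<omega> h)" and n: "0 \<le> Linf_norm \<omega> h"
    using h by (auto simp: Linf_space_def Linf_norm_def)
  have "AE t in lebesgue_on {0..}. ennreal (norm (h t) / \<omega> t) \<le> ennreal (Linf_norm \<omega> h)"
    unfolding e[symmetric] Linf_esssup_def by (rule esssup_AE)
  moreover have "AE t in lebesgue_on {0..}. t \<in> {0..}" using AE_space[of "lebesgue_on {0..}"] by simp
  ultimately show ?thesis
  proof eventually_elim
    fix t :: real assume "ennreal (norm (h t) / \<omega> t) \<le> ennreal (Linf_norm \<omega> h)" "t \<in> {0..}"
    then show "norm (h t) \<le> Linf_norm \<omega> h * \<omega> t"
      using n w by (simp add: weight_def divide_le_eq)
  qed
qed

lemma Linf_leI: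
  assumes w: "weight \<omega>" and h: "h \<in> borel_measurable (lebesgue_on {0..})" and c: "0 \<le> c"
    and le: "\<And>t. 0 \<le> t \<Longrightarrow> norm (h t) \<le> c * \<omega> t"
  shows "h \<in> Linf_space \<omega>" and "Linf_norm \<omega> h \<le> c"
proof -
  have "Linf_esssup \<omega> h \<le> ennreal c"
    unfolding Linf_esssup_def
  proof (rule esssup_I[OF Linf_quotient_measurable[OF w h]], rule AE_I2)
    fix t :: real assume "t \<in> space (lebesgue_on {0..})"
    then show "ennreal (norm (h t) / \<omega> t) \<le> ennreal c"
      using le[of t] w by (intro ennreal_leI) (simp add: weight_def divide_le_eq)
  qed
  then show "h \<in> Linf_space \<omega>" "Linf_norm \<omega> h \<le> c"
    using h c by (auto simp: Linf_space_def Linf_norm_def intro: le_less_trans enn2real_leI)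
qed

lemma C0_lebesgue_measurable: "g \<in> C0_space \<omega> \<Longrightarrow> g \<in> borel_measurable (lebesgue_on {0..})"
  by (intro continuous_imp_measurable_on_sets_lebesgue) (auto simp: C0_space_def)

lemma C0_Linf:
  assumes w: "weight \<omega>" and g: "g \<in> C0_space \<omega>"
  shows "g \<in> Linf_space \<omega>"
proof -
  obtain K where K: "\<And>x. 0 \<le> x \<Longrightarrow> norm (g x) \<le> K * \<omega> x"
    using C0_dominated[OF w g] by (auto simp: dominated_def)
  have "norm (g x) \<le> \<bar>K\<bar> * \<omega> x" if "0 \<le> x" for x
    using K[OF that] w that by (smt (verit) mult_right_mono weight_def)
  then show ?thesis by (intro Linf_leI[OF w C0_lebesgue_measurable[OF g], of "\<bar>K\<bar>"]) auto
qed

text \<open>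
  For a continuous function the essential supremum is a bound at every point, in particular at each \<open>s / t\<close>
  at which the average evaluates it.
\<close>

lemma C0_pointwise_le:
  assumes w: "weight \<omega>" and g: "g \<in> C0_space \<omega>" and x: "0 \<le> x"
  shows "norm (g x) \<le> Linf_norm \<omega> g * \<omega> x"
proof (rule AE_half_line_closed[OF Linf_AE_le[OF w C0_Linf[OF w g]] _ x])
  have "closed ({0..} \<inter> (\<lambda>x. Linf_norm \<omega> g * \<omega> x - norm (g x)) -` {0..})"
    using w g by (intro continuous_closed_preimage) (auto simp: weight_def C0_space_def intro!: continuous_intros)
  also have "{0..} \<inter> (\<lambda>x. Linf_norm \<omega> g * \<omega> x - norm (g x)) -` {0..} =
      {x \<in> {0..}. norm (g x) \<le> Linf_norm \<omega> g * \<omega> x}" by auto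
  finally show "closed {x \<in> {0..}. norm (g x) \<le> Linf_norm \<omega> g * \<omega> x}" .
qed

lemma continuous_AE_eq:
  fixes f g :: "real \<Rightarrow> complex"
  assumes "continuous_on {0..} f" "continuous_on {0..} g" "AE x in lebesgue_on {0..}. f x = g x" "0 \<le> x"
  shows "f x = g x"
proof (rule AE_half_line_closed[OF assms(3) _ assms(4)])
  have "closed {x \<in> {0..}. f x - g x = 0}"
    using assms by (intro continuous_closed_preimage_constant continuous_intros) auto
  then show "closed {x \<in> {0..}. f x = g x}" by simp
qed

text \<open>
  The weights cancel in the product, which is bounded by \<open>|f| \<omega>\<close> times the norm of \<open>k\<close>.
\<close>

lemma L1_Linf_integrable:
  assumes w: "weight \<omega>" and f: "f \<in> L1_space \<omega>" and k: "k \<in> Linf_space \<omega>"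
  shows "integrable (lebesgue_on {0..}) (\<lambda>t. f t * k t)"
proof (rule Bochner_Integration.integrable_bound)
  show "integrable (lebesgue_on {0..}) (\<lambda>t. Linf_norm \<omega> k * (norm (f t) * \<omega> t))"
    using f by (simp add: L1_space_def)
  show "(\<lambda>t. f t * k t) \<in> borel_measurable (lebesgue_on {0..})"
    using f k by (auto simp: L1_space_def Linf_space_def intro!: borel_measurable_times)
  show "AE t in lebesgue_on {0..}. norm (f t * k t) \<le> norm (Linf_norm \<omega> k * (norm (f t) * \<omega> t))"
    using Linf_AE_le[OF w k]
  proof eventually_elim
    fix t assume "norm (k t) \<le> Linf_norm \<omega> k * \<omega> t"
    then have "norm (f t) * norm (k t) \<le> norm (f t) * (Linf_norm \<omega> k * \<omega> t)" by (rule mult_left_mono) simp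
    then show "norm (f t * k t) \<le> norm (Linf_norm \<omega> k * (norm (f t) * \<omega> t))"
      by (simp add: norm_mult ac_simps)
  qed
qed

lemma Linf_eq_if_pairing_eq:
  assumes w: "weight \<omega>" and k: "k \<in> Linf_space \<omega>" and l: "l \<in> Linf_space \<omega>"
    and eq: "\<And>f. f \<in> L1_space \<omega> \<Longrightarrow> L1_pairing f k = L1_pairing f l"
  shows "AE x in lebesgue_on {0..}. k x = l x"
proof -
  have [measurable]: "k \<in> borel_measurable (lebesgue_on {0..})" "l \<in> borel_measurable (lebesgue_on {0..})"
    using k l by (auto simp: Linf_space_def)
  note [measurable] = weight_lebesgue_measurable[OF w]
  have "AE x in lebesgue_on {0..}. x \<le> real n \<longrightarrow> k x = l x" for n
  proof -
    \<comment> \<open>Paired with \<open>k - l\<close> this function gives \<open>\<integral> |k - l|\<close> over \<open>{0..n}\<close>; it is bounded with bounded support,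
      and so lies in \<open>L\<^sup>1(\<omega>)\<close> for every weight.\<close>
    define f where "f x = indicator {0..real n} x * cnj (sgn (k x - l x))" for x
    have I [measurable]: "(\<lambda>x. indicator {0..real n} x :: complex) \<in> borel_measurable (lebesgue_on {0..})"
      by (intro measurable_restrict_space1 measurable_completion) measurable
    have "(\<lambda>x. sgn (k x - l x)) \<in> borel_measurable (lebesgue_on {0..})"
      unfolding sgn_div_norm by measurable
    then have "(\<lambda>x. cnj (sgn (k x - l x))) \<in> borel_measurable (lebesgue_on {0..})"
      by (rule measurable_compose) (intro borel_measurable_continuous_onI continuous_intros)
    then have fm [measurable]: "f \<in> borel_measurable (lebesgue_on {0..})"
      unfolding f_def[abs_def] by (rule borel_measurable_times[OF I])
    have "integrable (lebesgue_on {0..}) (\<lambda>t. norm (f t) * \<omega> t)"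
    proof (rule Bochner_Integration.integrable_bound)
      have "continuous_on {0..real n} \<omega>" using w by (auto simp: weight_def intro: continuous_on_subset)
      then have i: "integrable lborel (\<lambda>x. indicator {0..real n} x *\<^sub>R \<omega> x)"
        using borel_integrable_compact[of "{0..real n}" \<omega>] by simp
      then have "integrable lebesgue (\<lambda>x. indicator {0..real n} x *\<^sub>R \<omega> x)"
        using integrable_completion[OF borel_measurable_integrable[OF i]] by blast
      also have "(\<lambda>x. indicator {0..real n} x *\<^sub>R \<omega> x) =
          (\<lambda>x. indicator {0..} x *\<^sub>R (indicator {0..real n} x * \<omega> x))"
        by (auto simp: indicator_def)
      finally have "integrable lebesgue (\<lambda>x. indicator {0..} x *\<^sub>R (indicator {0..real n} x * \<omega> x))" .
      then show "integrable (lebesgue_on {0..}) (\<lambda>x. indicator {0..real n} x * \<omega> x)"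
        by (subst integrable_restrict_space) auto
      show "AE t in lebesgue_on {0..}. norm (norm (f t) * \<omega> t) \<le> norm (indicator {0..real n} t * \<omega> t)"
        by (rule AE_I2) (auto simp: f_def indicator_def norm_mult norm_sgn)
    qed measurable
    then have f: "f \<in> L1_space \<omega>" using fm by (simp add: L1_space_def)
    have ik: "integrable (lebesgue_on {0..}) (\<lambda>t. f t * k t)" "integrable (lebesgue_on {0..}) (\<lambda>t. f t * l t)"
      using L1_Linf_integrable[OF w f] k l by auto
    have e: "f t * k t - f t * l t = of_real (indicator {0..real n} t * norm (k t - l t))" for t
    proof -
      have "cnj (sgn z) * z = of_real (norm z)" for z :: complex
      proof -
        have "cnj (sgn z) * z = (z * cnj z) / of_real (norm z)"
          by (simp add: sgn_div_norm scaleR_conv_of_real divide_inverse ac_simps)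
        also have "\<dots> = of_real ((norm z)\<^sup>2) / of_real (norm z)" by (simp only: complex_norm_square)
        also have "\<dots> = of_real (norm z)" by (simp add: power2_eq_square)
        finally show ?thesis .
      qed
      then show ?thesis by (simp add: f_def indicator_def flip: right_diff_distrib)
    qed
    have "(LINT t|lebesgue_on {0..}. f t * k t - f t * l t) = 0"
      using eq[OF f] ik by (simp add: L1_pairing_def)
    then have "(LINT t|lebesgue_on {0..}. indicator {0..real n} t * norm (k t - l t)) = 0"
      unfolding e integral_complex_of_real by simp
    moreover have "integrable (lebesgue_on {0..}) (\<lambda>t. indicator {0..real n} t * norm (k t - l t))"
      using Bochner_Integration.integrable_diff[OF ik] unfolding e complex_of_real_integrable_eq .
    ultimately have "AE t in lebesgue_on {0..}. indicator {0..real n} t * norm (k t - l t) = 0"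
      by (subst (asm) integral_nonneg_eq_0_iff_AE) auto
    moreover have "AE t in lebesgue_on {0..}. t \<in> {0..}" using AE_space[of "lebesgue_on {0..}"] by simp
    ultimately show ?thesis by eventually_elim (auto simp: indicator_def)
  qed
  then have "AE x in lebesgue_on {0..}. \<forall>n. x \<le> real n \<longrightarrow> k x = l x"
    unfolding AE_all_countable by blast
  then show ?thesis by eventually_elim (use real_arch_simple in blast)
qed

lemma fun_measure_represents:
  assumes w: "weight \<omega>" and f: "f \<in> L1_space \<omega>" and f': "borel_rep {0..} f f'"
  shows "represents \<omega> [(f', lborel)] (fun_measure f)"
proof -
  have "fun_measure f A = pieces_integral [(f', lborel)] (indicator A)" if A: "A \<in> bdd_borel" for A
  proof -
    have A': "A \<in> sets borel" "A \<subseteq> {0..}" using A by (auto simp: bdd_borel_def)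
    have "borel_rep A f f'" using f' A'(2) unfolding borel_rep_def by (auto elim!: eventually_mono)
    then have "fun_measure f A = (LINT x:A|lborel. f' x)"
      using borel_rep_integral A' A by (simp add: fun_measure_def)
    also have "\<dots> = (LINT x:{0..}|lborel. indicator A x * f' x)"
      unfolding set_lebesgue_integral_def
      using A'(2) by (intro Bochner_Integration.integral_cong) (auto simp: indicator_def)
    finally show ?thesis by simp
  qed
  then show ?thesis
    using L1_space_borel_rep(1)[OF w f'] f f'
    by (auto simp: represents_def admissible_Cons borel_rep_def fun_measure_def)
qed

lemma cm_integral_fun_measure:
  assumes w: "weight \<omega>" and f: "f \<in> L1_space \<omega>" and f': "borel_rep {0..} f f'" and g: "g \<in> C0_space \<omega>"
  shows "cm_integral (fun_measure f) g = (LINT x:{0..}|lborel. f' x * g x)"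
proof -
  note r = fun_measure_represents[OF w f f']
  show ?thesis
    using cm_integral_eq_pieces_integral[OF w represents_M_space[OF w r] r C0_dominated[OF w g]]
    by (simp add: mult.commute)
qed

lemma L1_pairing_borel_rep:
  assumes f': "borel_rep {0..} f f'" and g: "continuous_on {0..} g"
  shows "L1_pairing f g = (LINT x:{0..}|lborel. f' x * g x)"
proof -
  define g0 where "g0 x = indicator {0..} x *\<^sub>R g x" for x
  have [measurable]: "g0 \<in> borel_measurable borel"
    unfolding g0_def[abs_def] using g by (rule borel_measurable_continuous_on_indicator[rotated]) simp
  have "borel_rep {0..} (\<lambda>x. f x * g x) (\<lambda>x. f' x * g0 x)"
  proof -
    have [measurable]: "f' \<in> borel_measurable borel" and ae: "AE x in lborel. x \<in> {0..} \<longrightarrow> f x = f' x"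
      using f' by (auto simp: borel_rep_def)
    have "(\<lambda>x. f' x * g0 x) \<in> borel_measurable borel" by measurable
    moreover have "AE x in lborel. x \<in> {0..} \<longrightarrow> f x * g x = f' x * g0 x"
      using ae by eventually_elim (simp add: g0_def)
    ultimately show ?thesis by (simp add: borel_rep_def)
  qed
  then have "L1_pairing f g = (LINT x:{0..}|lborel. f' x * g0 x)"
    unfolding L1_pairing_def by (rule borel_rep_integral) simp
  also have "\<dots> = (LINT x:{0..}|lborel. f' x * g x)"
    unfolding set_lebesgue_integral_def
    by (intro Bochner_Integration.integral_cong) (auto simp: g0_def indicator_def)
  finally show ?thesis .
qed

lemma C0_add: "f \<in> C0_space \<omega> \<Longrightarrow> g \<in> C0_space \<omega> \<Longrightarrow> (\<lambda>x. f x + g x) \<in> C0_space \<omega>"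
  unfolding C0_space_def by (auto simp: add_divide_distrib intro!: continuous_intros tendsto_add_zero)

lemma C0_cmult: "f \<in> C0_space \<omega> \<Longrightarrow> (\<lambda>x. c * f x) \<in> C0_space \<omega>"
  unfolding C0_space_def by (auto intro!: continuous_intros tendsto_mult_right_zero simp flip: times_divide_eq_right)

lemma Linf_norm_zero:
  assumes w: "weight \<omega>" and "\<And>x. 0 \<le> x \<Longrightarrow> h x = 0" shows "Linf_norm \<omega> h = 0"
proof -
  have "h \<in> borel_measurable (lebesgue_on {0..}) \<longleftrightarrow> (\<lambda>_ :: real. 0 :: complex) \<in> borel_measurable (lebesgue_on {0..})"
    using assms by (intro measurable_cong) auto
  then have "Linf_norm \<omega> h \<le> 0" using assms by (intro Linf_leI[OF w]) auto
  then show ?thesis by (simp add: Linf_norm_def order.antisym)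
qed

section \<open>The three operators\<close>

text \<open>
  The kernel \<open>\<phi>\<close> determines \<open>\<psi>\<close> only up to a null set, which is all that the operator sees.
\<close>

locale hardy_cesaro = dilation_kernel +
  fixes \<psi> :: "real \<Rightarrow> real"
  assumes kernel_eq: "AE t in lborel. t \<in> {0..1} \<longrightarrow> \<psi> t = t * \<phi> t"
begin

text \<open>
  For \<open>x > 0\<close> the dilation \<open>t \<mapsto> t x\<close> pulls null sets back to null sets. At \<open>x = 0\<close> the operator sees the
  arbitrary value \<open>f 0\<close>, so the two sides agree only almost everywhere.
\<close>

lemma U_op_borel_rep:
  assumes f: "borel_rep {0..} f f'"
  shows "borel_rep {0..} (U_op \<psi> f) (dilation_average f')"
proof -
  have f' [measurable]: "f' \<in> borel_measurable borel" and ae: "AE x in lborel. x \<in> {0..} \<longrightarrow> f x = f' x"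
    using f by (auto simp: borel_rep_def)
  have eq: "U_op \<psi> f x = dilation_average f' x" if x: "0 < x" for x
  proof -
    obtain N where N1: "{y \<in> space lborel. \<not> (y \<in> {0..} \<longrightarrow> f y = f' y)} \<subseteq> N"
      and N0: "emeasure lborel N = 0" and N: "N \<in> sets lborel"
      using ae by (rule AE_E)
    have [measurable]: "N \<in> sets borel" using N by simp
    have "AE y in lborel. y \<notin> N" using N N0 by (intro AE_not_in) (simp add: null_sets_def)
    then have "AE t in lborel. 0 + x * t \<notin> N" using x by (intro AE_borel_affine) auto
    then have "AE t in lborel. t \<in> {0..} \<longrightarrow> f (t * x) = f' (t * x)"
    proof eventually_elim
      fix t assume t: "0 + x * t \<notin> N"
      show "t \<in> {0..} \<longrightarrow> f (t * x) = f' (t * x)"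
      proof
        assume "t \<in> {0..}"
        then have "t * x \<in> {0..}" using x by simp
        moreover have "t * x \<notin> N" using t by (simp add: mult.commute)
        ultimately show "f (t * x) = f' (t * x)" using N1 by auto
      qed
    qed
    then have "AE t in lborel. t \<in> {0..1} \<longrightarrow> f (t * x) * of_real (\<psi> t) = f' (t * x) * of_real (t * \<phi> t)"
      using kernel_eq by eventually_elim auto
    then have "borel_rep {0..1} (\<lambda>t. f (t * x) * of_real (\<psi> t)) (\<lambda>t. f' (t * x) * of_real (t * \<phi> t))"
      by (simp add: borel_rep_def)
    then have "U_op \<psi> f x = (LINT t:{0..1}|lborel. f' (t * x) * of_real (t * \<phi> t))"
      unfolding U_op_def by (rule borel_rep_integral) simp
    also have "\<dots> = dilation_average f' x"
      unfolding dilation_average_def set_lebesgue_integral_def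
    proof (intro Bochner_Integration.integral_cong refl)
      fix t show "indicator {0..1} t *\<^sub>R (f' (t * x) * of_real (t * \<phi> t)) = f' (t * x) * of_real (t * \<phi> t)"
        using kernel_support[of t] by (cases "\<phi> t = 0") auto
    qed
    finally show ?thesis .
  qed
  have "AE x in lborel. x \<noteq> (0::real)" by (rule AE_lborel_singleton)
  then have "AE x in lborel. x \<in> {0..} \<longrightarrow> U_op \<psi> f x = dilation_average f' x"
    by eventually_elim (auto intro: eq)
  then show ?thesis using dilation_average_measurable[OF f'] by (simp add: borel_rep_def)
qed

lemma L1_borel_rep:
  assumes "f \<in> L1_space \<omega>1"
  obtains f' where "borel_rep {0..} f f'" "f' \<in> borel_measurable borel"
    "(\<integral>\<^sup>+s\<in>{0..}. ennreal (\<omega>1 s * norm (f' s)) \<partial>lborel) < \<infinity>"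
proof -
  have "f \<in> borel_measurable (lebesgue_on {0..})" using assms by (simp add: L1_space_def)
  then obtain f' where f': "borel_rep {0..} f f'" using borel_rep_ex_complex[of f "{0..}"] by auto
  then show ?thesis using that L1_space_borel_rep(1)[OF w1 f'] assms by (auto simp: borel_rep_def)
qed

lemma U_op_L1:
  assumes f: "f \<in> L1_space \<omega>1"
  shows "U_op \<psi> f \<in> L1_space \<omega>2" and "L1_norm \<omega>2 (U_op \<psi> f) \<le> C * L1_norm \<omega>1 f"
proof -
  obtain f' where f': "borel_rep {0..} f f'" "f' \<in> borel_measurable borel"
    and fin: "(\<integral>\<^sup>+s\<in>{0..}. ennreal (\<omega>1 s * norm (f' s)) \<partial>lborel) < \<infinity>"
    using L1_borel_rep[OF f] .
  note r = U_op_borel_rep[OF f'(1)]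
  have top: "ennreal C * (\<integral>\<^sup>+s\<in>{0..}. ennreal (\<omega>1 s * norm (f' s)) \<partial>lborel) < \<infinity>"
    using fin by (simp add: ennreal_mult_less_top)
  show "U_op \<psi> f \<in> L1_space \<omega>2"
    unfolding L1_space_borel_rep(1)[OF w2 r] using dilation_average_L1_bound[OF f'(2)] top by (rule le_less_trans)
  have "L1_norm \<omega>2 (U_op \<psi> f) \<le> enn2real (ennreal C * (\<integral>\<^sup>+s\<in>{0..}. ennreal (\<omega>1 s * norm (f' s)) \<partial>lborel))"
    unfolding L1_space_borel_rep(2)[OF w2 r] using dilation_average_L1_bound[OF f'(2)] top
    by (intro enn2real_mono) simp_all
  also have "\<dots> = C * L1_norm \<omega>1 f"
    unfolding L1_space_borel_rep(2)[OF w1 f'(1)] using C_nonneg by (simp add: enn2real_mult)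
  finally show "L1_norm \<omega>2 (U_op \<psi> f) \<le> C * L1_norm \<omega>1 f" .
qed

text \<open>
  Additivity holds at those \<open>x\<close> for which both integrands are integrable, hence only almost everywhere.
\<close>

lemma U_op_add_AE:
  assumes f: "f \<in> L1_space \<omega>1" and g: "g \<in> L1_space \<omega>1"
  shows "AE x in lborel. x \<in> {0..} \<longrightarrow> U_op \<psi> (\<lambda>x. f x + g x) x = U_op \<psi> f x + U_op \<psi> g x"
proof -
  obtain f' where f': "borel_rep {0..} f f'" "f' \<in> borel_measurable borel"
    and ff: "(\<integral>\<^sup>+s\<in>{0..}. ennreal (\<omega>1 s * norm (f' s)) \<partial>lborel) < \<infinity>"
    using L1_borel_rep[OF f] .
  obtain g' where g': "borel_rep {0..} g g'" "g' \<in> borel_measurable borel"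
    and gf: "(\<integral>\<^sup>+s\<in>{0..}. ennreal (\<omega>1 s * norm (g' s)) \<partial>lborel) < \<infinity>"
    using L1_borel_rep[OF g] .
  have "AE x in lborel. x \<in> {0..} \<longrightarrow> U_op \<psi> f x = dilation_average f' x"
    "AE x in lborel. x \<in> {0..} \<longrightarrow> U_op \<psi> g x = dilation_average g' x"
    "AE x in lborel. x \<in> {0..} \<longrightarrow> U_op \<psi> (\<lambda>x. f x + g x) x = dilation_average (\<lambda>x. f' x + g' x) x"
    using U_op_borel_rep[OF f'(1)] U_op_borel_rep[OF g'(1)] U_op_borel_rep[OF borel_rep_add[OF f'(1) g'(1)]]
    by (auto simp: borel_rep_def)
  with dilation_average_integrable_AE[OF f'(2) ff] dilation_average_integrable_AE[OF g'(2) gf] show ?thesis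
  proof eventually_elim
    case (elim x)
    show ?case
    proof
      assume x: "x \<in> {0..}"
      have "dilation_average (\<lambda>x. f' x + g' x) x = dilation_average f' x + dilation_average g' x"
        unfolding dilation_average_def distrib_right using elim x by (intro Bochner_Integration.integral_add) auto
      then show "U_op \<psi> (\<lambda>x. f x + g x) x = U_op \<psi> f x + U_op \<psi> g x" using elim x by simp
    qed
  qed
qed

lemma U_op_cmult: "U_op \<psi> (\<lambda>x. c * f x) x = c * U_op \<psi> f x"
  by (simp add: U_op_def mult.assoc)

lemma U_op_bounded:
  "bounded_operator (L1_space \<omega>1) (L1_norm \<omega>1) (L1_space \<omega>2) (L1_norm \<omega>2) (U_op \<psi>)"
  unfolding bounded_operator_def
proof (intro conjI ballI allI exI[of _ C])
  fix f g assume "f \<in> L1_space \<omega>1" "g \<in> L1_space \<omega>1"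
  from U_op_add_AE[OF this]
  show "L1_norm \<omega>2 (\<lambda>y. U_op \<psi> (\<lambda>x. f x + g x) y - (U_op \<psi> f y + U_op \<psi> g y)) = 0"
    by (intro L1_norm_AE_zero) (auto elim!: eventually_mono)
next
  fix c f
  show "L1_norm \<omega>2 (\<lambda>y. U_op \<psi> (\<lambda>x. c * f x) y - c * U_op \<psi> f y) = 0"
    by (intro L1_norm_AE_zero) (simp add: U_op_cmult)
qed (auto intro: U_op_L1)

lemma kernel_average_pairing:
  assumes f: "f \<in> L1_space \<omega>1" and g: "g \<in> C0_space \<omega>2"
  shows "L1_pairing f (kernel_average g) = L1_pairing (U_op \<psi> f) g"
proof -
  obtain f' where f': "borel_rep {0..} f f'" "f' \<in> borel_measurable borel"
    and fin: "(\<integral>\<^sup>+s\<in>{0..}. ennreal (\<omega>1 s * norm (f' s)) \<partial>lborel) < \<infinity>"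
    using L1_borel_rep[OF f] .
  have c: "continuous_on {0..} g" "continuous_on {0..} (kernel_average g)"
    using g kernel_average_C0[OF g] by (auto simp: C0_space_def)
  show ?thesis
    unfolding L1_pairing_borel_rep[OF f'(1) c(2)] L1_pairing_borel_rep[OF U_op_borel_rep[OF f'(1)] c(1)]
    by (rule dilation_average_pairing[OF f'(2) fin C0_dominated[OF w2 g], symmetric])
qed

text \<open>
  The choices in the definition of \<^const>\<open>V_op\<close> are unique up to a null set, and two continuous
  functions that agree almost everywhere on the half-line agree at each of its points.
\<close>

lemma V_op:
  assumes g: "g \<in> C0_space \<omega>2"
  shows "V_op \<psi> \<omega>1 g \<in> C0_space \<omega>1" and "0 \<le> x \<Longrightarrow> V_op \<psi> \<omega>1 g x = kernel_average g x"
proof -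
  define k where "k = L1_adjoint \<omega>1 (U_op \<psi>) g"
  have Wl: "kernel_average g \<in> Linf_space \<omega>1" by (rule C0_Linf[OF w1 kernel_average_C0[OF g]])
  have "\<exists>k. k \<in> Linf_space \<omega>1 \<and> (\<forall>f\<in>L1_space \<omega>1. L1_pairing f k = L1_pairing (U_op \<psi> f) g)"
    using Wl kernel_average_pairing[OF _ g] by blast
  from someI_ex[OF this] have k: "k \<in> Linf_space \<omega>1" "\<And>f. f \<in> L1_space \<omega>1 \<Longrightarrow> L1_pairing f k = L1_pairing (U_op \<psi> f) g"
    unfolding k_def L1_adjoint_def by auto
  have ae: "AE x in lebesgue_on {0..}. kernel_average g x = k x"
    using Wl k(1) by (rule Linf_eq_if_pairing_eq[OF w1]) (simp add: kernel_average_pairing[OF _ g] k(2))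
  then have "\<exists>v. v \<in> C0_space \<omega>1 \<and> (AE x in lebesgue_on {0..}. v x = k x)" using kernel_average_C0[OF g] by blast
  from someI_ex[OF this] have v: "V_op \<psi> \<omega>1 g \<in> C0_space \<omega>1"
      "AE x in lebesgue_on {0..}. V_op \<psi> \<omega>1 g x = k x"
    unfolding V_op_def k_def by auto
  show "V_op \<psi> \<omega>1 g \<in> C0_space \<omega>1" by (rule v)
  assume x: "0 \<le> x"
  have "AE x in lebesgue_on {0..}. V_op \<psi> \<omega>1 g x = kernel_average g x" using v(2) ae by eventually_elim simp
  then show "V_op \<psi> \<omega>1 g x = kernel_average g x"
    using v(1) kernel_average_C0[OF g] x by (intro continuous_AE_eq) (auto simp: C0_space_def)
qed

lemma V_op_pairing:
  assumes "f \<in> L1_space \<omega>1" "g \<in> C0_space \<omega>2"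
  shows "L1_pairing f (V_op \<psi> \<omega>1 g) = L1_pairing (U_op \<psi> f) g"
proof -
  have "L1_pairing f (V_op \<psi> \<omega>1 g) = L1_pairing f (kernel_average g)"
    unfolding L1_pairing_def using V_op(2)[OF assms(2)]
    by (intro Bochner_Integration.integral_cong) auto
  then show ?thesis using kernel_average_pairing[OF assms] by simp
qed

lemma V_op_bounded:
  "bounded_operator (C0_space \<omega>2) (Linf_norm \<omega>2) (C0_space \<omega>1) (Linf_norm \<omega>1) (V_op \<psi> \<omega>1)"
  unfolding bounded_operator_def
proof (intro conjI ballI allI exI[of _ C])
  fix f g assume fg: "f \<in> C0_space \<omega>2" "g \<in> C0_space \<omega>2"
  show "Linf_norm \<omega>1 (\<lambda>y. V_op \<psi> \<omega>1 (\<lambda>x. f x + g x) y - (V_op \<psi> \<omega>1 f y + V_op \<psi> \<omega>1 g y)) = 0"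
    using fg by (intro Linf_norm_zero w1) (simp add: V_op C0_add kernel_average_add C0_dominated w2)
next
  fix c f assume "f \<in> C0_space \<omega>2"
  then show "Linf_norm \<omega>1 (\<lambda>y. V_op \<psi> \<omega>1 (\<lambda>x. c * f x) y - c * V_op \<psi> \<omega>1 f y) = 0"
    by (intro Linf_norm_zero w1) (simp add: V_op C0_cmult kernel_average_cmult)
next
  fix g assume g: "g \<in> C0_space \<omega>2"
  have "0 \<le> C * Linf_norm \<omega>2 g" using C_nonneg by (simp add: Linf_norm_def)
  then show "Linf_norm \<omega>1 (V_op \<psi> \<omega>1 g) \<le> C * Linf_norm \<omega>2 g"
  proof (rule Linf_leI(2)[OF w1 C0_lebesgue_measurable[OF V_op(1)[OF g]]])
    fix s :: real assume s: "0 \<le> s"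
    show "norm (V_op \<psi> \<omega>1 g s) \<le> C * Linf_norm \<omega>2 g * \<omega>1 s"
      using norm_kernel_average_le[OF C0_dominated[OF w2 g] C0_pointwise_le[OF w2 g] s] V_op(2)[OF g s]
      by (simp add: ac_simps)
  qed
qed (rule V_op)

lemma cm_integral_V_op:
  assumes "g \<in> C0_space \<omega>2" shows "cm_integral \<mu> (V_op \<psi> \<omega>1 g) = cm_integral \<mu> (kernel_average g)"
  unfolding cm_integral_jordan_pieces using V_op(2)[OF assms] by (rule pieces_integral_cong)

text \<open>
  The description in the definition of \<^const>\<open>C0_adjoint\<close> has exactly one solution: transport gives one, and there is
  no other because elements of \<open>M(\<omega>2)\<close> are determined by their integrals against \<open>C\<^sub>0(1/\<omega>2)\<close>.
\<close>

lemma U_bar_eq_pushed_measure: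
  assumes \<mu>: "\<mu> \<in> M_space \<omega>1" shows "U_bar \<psi> \<omega>1 \<omega>2 \<mu> = pushed_measure \<mu>"
  unfolding U_bar_def C0_adjoint_def
proof (rule the_equality)
  show *: "pushed_measure \<mu> \<in> M_space \<omega>2 \<and>
      (\<forall>g\<in>C0_space \<omega>2. cm_integral (pushed_measure \<mu>) g = cm_integral \<mu> (V_op \<psi> \<omega>1 g))"
    using pushed_measure_M_space[OF \<mu>] by (simp add: cm_integral_pushed_measure[OF \<mu>] cm_integral_V_op)
  fix \<nu> assume "\<nu> \<in> M_space \<omega>2 \<and> (\<forall>g\<in>C0_space \<omega>2. cm_integral \<nu> g = cm_integral \<mu> (V_op \<psi> \<omega>1 g))"
  then show "\<nu> = pushed_measure \<mu>" using * by (intro M_space_eqI[OF w2]) auto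
qed

lemma U_bar:
  assumes \<mu>: "\<mu> \<in> M_space \<omega>1"
  shows "U_bar \<psi> \<omega>1 \<omega>2 \<mu> \<in> M_space \<omega>2"
    and "g \<in> C0_space \<omega>2 \<Longrightarrow> cm_integral (U_bar \<psi> \<omega>1 \<omega>2 \<mu>) g = cm_integral \<mu> (V_op \<psi> \<omega>1 g)"
    and "M_norm \<omega>2 (U_bar \<psi> \<omega>1 \<omega>2 \<mu>) \<le> (4 * C) * M_norm \<omega>1 \<mu>"
  using pushed_measure_M_space[OF \<mu>] M_norm_pushed_measure_le[OF \<mu>]
  by (simp_all add: U_bar_eq_pushed_measure[OF \<mu>] cm_integral_pushed_measure[OF \<mu>] cm_integral_V_op)

lemma U_bar_eqI:
  assumes "\<mu> \<in> M_space \<omega>1" "\<nu> \<in> M_space \<omega>2"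
    and "\<And>g. g \<in> C0_space \<omega>2 \<Longrightarrow> cm_integral \<nu> g = cm_integral \<mu> (V_op \<psi> \<omega>1 g)"
  shows "U_bar \<psi> \<omega>1 \<omega>2 \<mu> = \<nu>"
  using assms U_bar by (intro M_space_eqI[OF w2]) auto

lemma U_bar_add:
  assumes \<mu>: "\<mu> \<in> M_space \<omega>1" and \<nu>: "\<nu> \<in> M_space \<omega>1"
  shows "U_bar \<psi> \<omega>1 \<omega>2 (\<lambda>A. \<mu> A + \<nu> A) = (\<lambda>A. U_bar \<psi> \<omega>1 \<omega>2 \<mu> A + U_bar \<psi> \<omega>1 \<omega>2 \<nu> A)"
  using M_space_add[OF w1 \<mu> \<nu>] M_space_add[OF w2 U_bar(1)[OF \<mu>] U_bar(1)[OF \<nu>]]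
proof (rule U_bar_eqI)
  fix g assume g: "g \<in> C0_space \<omega>2"
  show "cm_integral (\<lambda>A. U_bar \<psi> \<omega>1 \<omega>2 \<mu> A + U_bar \<psi> \<omega>1 \<omega>2 \<nu> A) g = cm_integral (\<lambda>A. \<mu> A + \<nu> A) (V_op \<psi> \<omega>1 g)"
    using cm_integral_add[OF w2 U_bar(1)[OF \<mu>] U_bar(1)[OF \<nu>] g] cm_integral_add[OF w1 \<mu> \<nu> V_op(1)[OF g]]
      U_bar(2)[OF \<mu> g] U_bar(2)[OF \<nu> g] by simp
qed

lemma U_bar_cmult:
  assumes \<mu>: "\<mu> \<in> M_space \<omega>1"
  shows "U_bar \<psi> \<omega>1 \<omega>2 (\<lambda>A. c * \<mu> A) = (\<lambda>A. c * U_bar \<psi> \<omega>1 \<omega>2 \<mu> A)"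
  using M_space_cmult[OF w1 \<mu>] M_space_cmult[OF w2 U_bar(1)[OF \<mu>]]
proof (rule U_bar_eqI)
  fix g assume g: "g \<in> C0_space \<omega>2"
  show "cm_integral (\<lambda>A. c * U_bar \<psi> \<omega>1 \<omega>2 \<mu> A) g = cm_integral (\<lambda>A. c * \<mu> A) (V_op \<psi> \<omega>1 g)"
    using cm_integral_cmult[OF w2 U_bar(1)[OF \<mu>] g] cm_integral_cmult[OF w1 \<mu> V_op(1)[OF g]]
      U_bar(2)[OF \<mu> g] by simp
qed

lemma U_bar_bounded:
  "bounded_operator (M_space \<omega>1) (M_norm \<omega>1) (M_space \<omega>2) (M_norm \<omega>2) (U_bar \<psi> \<omega>1 \<omega>2)"
  unfolding bounded_operator_def
  by (intro conjI ballI allI exI[of _ "4 * C"]) (simp_all add: U_bar U_bar_add U_bar_cmult M_norm_zero w2)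

text \<open>
  The measure with density \<open>U f\<close> has the integrals that characterise the image of \<open>f(t) dt\<close>, by the pairing identity.
\<close>

lemma U_bar_fun_measure:
  assumes f: "f \<in> L1_space \<omega>1"
  shows "fun_measure f \<in> M_space \<omega>1" and "U_bar \<psi> \<omega>1 \<omega>2 (fun_measure f) = fun_measure (U_op \<psi> f)"
proof -
  obtain f' where f': "borel_rep {0..} f f'" using L1_borel_rep[OF f] by blast
  show m1: "fun_measure f \<in> M_space \<omega>1"
    by (rule represents_M_space[OF w1 fun_measure_represents[OF w1 f f']])
  have m2: "fun_measure (U_op \<psi> f) \<in> M_space \<omega>2"
    by (rule represents_M_space[OF w2 fun_measure_represents[OF w2 U_op_L1(1)[OF f] U_op_borel_rep[OF f']]])
  from m1 m2 show "U_bar \<psi> \<omega>1 \<omega>2 (fun_measure f) = fun_measure (U_op \<psi> f)"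
  proof (rule U_bar_eqI)
    fix g assume g: "g \<in> C0_space \<omega>2"
    have "cm_integral (fun_measure (U_op \<psi> f)) g = L1_pairing (U_op \<psi> f) g"
      using cm_integral_fun_measure[OF w2 U_op_L1(1)[OF f] U_op_borel_rep[OF f'] g]
        L1_pairing_borel_rep[OF U_op_borel_rep[OF f']] g by (simp add: C0_space_def)
    also have "\<dots> = L1_pairing f (V_op \<psi> \<omega>1 g)" by (rule V_op_pairing[OF f g, symmetric])
    also have "\<dots> = cm_integral (fun_measure f) (V_op \<psi> \<omega>1 g)"
      using cm_integral_fun_measure[OF w1 f f' V_op(1)[OF g]]
        L1_pairing_borel_rep[OF f'] V_op(1)[OF g] by (simp add: C0_space_def)
    finally show "cm_integral (fun_measure (U_op \<psi> f)) g = cm_integral (fun_measure f) (V_op \<psi> \<omega>1 g)" .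
  qed
qed

end

theorem corollary3p2:
  fixes \<psi> \<omega>1 \<omega>2 :: "real \<Rightarrow> real" and C :: real
  assumes "\<psi> \<in> borel_measurable (lebesgue_on {0..1})"
    and "\<forall>t\<in>{0..1}. 0 \<le> \<psi> t"
    and "weight \<omega>1" and "weight \<omega>2"
    and "\<forall>s\<ge>0. (\<integral>\<^sup>+t. ennreal (\<omega>2 (s / t) * (\<psi> t / t)) \<partial>lebesgue_on {0..1}) \<le> ennreal (C * \<omega>1 s)"
  shows "bounded_operator (L1_space \<omega>1) (L1_norm \<omega>1) (L1_space \<omega>2) (L1_norm \<omega>2) (U_op \<psi>)
    \<and> bounded_operator (C0_space \<omega>2) (Linf_norm \<omega>2) (C0_space \<omega>1) (Linf_norm \<omega>1) (V_op \<psi> \<omega>1)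
    \<and> (\<forall>f\<in>L1_space \<omega>1. \<forall>g\<in>C0_space \<omega>2.
          L1_pairing f (V_op \<psi> \<omega>1 g) = L1_pairing (U_op \<psi> f) g)
    \<and> bounded_operator (M_space \<omega>1) (M_norm \<omega>1) (M_space \<omega>2) (M_norm \<omega>2) (U_bar \<psi> \<omega>1 \<omega>2)
    \<and> (\<forall>\<mu>\<in>M_space \<omega>1. \<forall>g\<in>C0_space \<omega>2.
          cm_integral (U_bar \<psi> \<omega>1 \<omega>2 \<mu>) g = cm_integral \<mu> (V_op \<psi> \<omega>1 g))
    \<and> (\<forall>f\<in>L1_space \<omega>1.
          fun_measure f \<in> M_space \<omega>1 \<and>
          U_bar \<psi> \<omega>1 \<omega>2 (fun_measure f) = fun_measure (U_op \<psi> f))"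
proof -
  obtain \<psi>' where rep: "borel_rep {0..1} \<psi> \<psi>'" using borel_rep_ex_real[OF assms(1)] by auto
  have [measurable]: "\<psi>' \<in> borel_measurable borel" using rep by (simp add: borel_rep_def)
  have ae: "AE t in lborel. t \<in> {0..1} \<longrightarrow> \<psi> t = \<psi>' t" using rep by (simp add: borel_rep_def)
  \<comment> \<open>The absolute value makes the kernel non-negative everywhere, as \<open>\<psi>'\<close> agrees with \<open>\<psi>\<close> only almost everywhere.\<close>
  define \<phi> where "\<phi> t = indicator {0<..1} t * \<bar>\<psi>' t\<bar> / t" for t
  have eq: "AE t in lborel. t \<in> {0..1} \<longrightarrow> \<psi> t = t * \<phi> t"
    using ae AE_lborel_singleton[of "0 :: real"]
  proof eventually_elim
    fix t :: real assume t: "t \<in> {0..1} \<longrightarrow> \<psi> t = \<psi>' t" "t \<noteq> 0"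
    have "0 \<le> \<psi> t" if "t \<in> {0..1}" using assms(2) that by blast
    then show "t \<in> {0..1} \<longrightarrow> \<psi> t = t * \<phi> t" using t by (auto simp: \<phi>_def)
  qed
  \<comment> \<open>The constant \<open>C\<close> may be negative, in which case the condition forces \<open>\<psi>\<close> to vanish almost everywhere.\<close>
  interpret hardy_cesaro \<phi> \<omega>1 \<omega>2 "max 0 C" \<psi>
  proof
    show "\<phi> \<in> borel_measurable borel" unfolding \<phi>_def by measurable
    show "0 \<le> \<phi> t" for t by (auto simp: \<phi>_def indicator_def)
    show "0 < t \<and> t \<le> 1" if "\<phi> t \<noteq> 0" for t using that by (auto simp: \<phi>_def indicator_def split: if_splits)
    show "(\<integral>\<^sup>+t. ennreal (\<omega>2 (s / t) * \<phi> t) \<partial>lborel) \<le> ennreal (max 0 C * \<omega>1 s)" if s: "0 \<le> s" for s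
    proof -
      have "AE t in lborel. t \<in> {0..1} \<longrightarrow> ennreal (\<omega>2 (s / t) * (\<psi> t / t)) = ennreal (\<omega>2 (s / t) * \<phi> t)"
        using eq AE_lborel_singleton[of "0 :: real"] by eventually_elim auto
      then have "(\<integral>\<^sup>+t. ennreal (\<omega>2 (s / t) * (\<psi> t / t)) \<partial>lebesgue_on {0..1}) =
          (\<integral>\<^sup>+t\<in>{0..1}. ennreal (\<omega>2 (s / t) * \<phi> t) \<partial>lborel)"
        by (rule nn_integral_lebesgue_on[rotated]) simp
      also have "\<dots> = (\<integral>\<^sup>+t. ennreal (\<omega>2 (s / t) * \<phi> t) \<partial>lborel)"
        by (intro nn_integral_cong) (auto simp: \<phi>_def indicator_def)
      finally have "(\<integral>\<^sup>+t. ennreal (\<omega>2 (s / t) * \<phi> t) \<partial>lborel) \<le> ennreal (C * \<omega>1 s)"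
        using assms(5)[rule_format, OF s] by (simp only:)
      also have "\<dots> \<le> ennreal (max 0 C * \<omega>1 s)"
        using assms(3) s by (intro ennreal_leI mult_right_mono) (auto simp: weight_def less_imp_le)
      finally show ?thesis .
    qed
  qed (use assms eq in auto)
  show ?thesis
    using U_op_bounded V_op_bounded V_op_pairing U_bar_bounded U_bar(2) U_bar_fun_measure by blast
qed

end
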